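(* Let $(M,\mathcal{O})$ be a formal manifold, let $\mathcal{F}$ be a sheaf of $\mathcal{O}$-modules, and let $E$ be a quasi-complete LCS. Then the presheaf $$\mathrm{D}^{-\infty}(\mathcal{F};E):\ U\mapsto\mathrm{D}^{-\infty}(U;\mathcal{F};E)\qquad(U\subset M\text{ open})$$ is a sheaf on $M$.
   Context: Formal manifolds. For a smooth manifold $N$ and $k\in\mathbb{N}$, $N^{(k)}$ is the locally ringed space $(N,\mathcal{O}_N^{(k)})$ over $\mathrm{Spec}(\mathbb{C})$ with $\mathcal{O}_N^{(k)}(U)=\mathrm{C}^\infty(U)[[y_1,\dots,y_k]]$ (complex-valued smooth functions). A formal manifold is a locally ringed space $(M,\mathcal{O})$ over $\mathrm{Spec}(\mathbb{C})$ with $M$ paracompact Hausdorff such that every point has an open neighborhood $U$ with $(U,\mathcal{O}|_U)\cong(\mathbb{R}^n)^{(k)}$ for some $n,k\in\mathbb{N}$. For $f\in\mathcal{O}(U)$, $f(a)\in\mathbb{C}$ is the residue of the germ of $f$ at $a$; $\underline{\mathcal{O}}$ is the quotient of $\mathcal{O}$ by the ideal sheaf of sections $f$ with $f(a)=0$ for all $a$, and $(M,\underline{\mathcal{O}})$ is a smooth manifold with its sheaf of complex-valued smooth functions. LCS. An LCS is a locally convex topological vector space over $\mathbb{C}$, possibly non-Hausdorff; (quasi-)complete LCS are by convention Hausdorff. $\mathcal{L}_b(X,Y)$ is the space of continuous linear maps with the strong topology. Inductive limits are in the category of LCS. Smooth topology. A $\mathbb{C}$-linear sheaf homomorphism $D:\mathcal{F}|_U\to\underline{\mathcal{O}}|_U$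 has order $\le r$ if for every open $W\subset U$ and $f_0,\dots,f_r\in\mathcal{O}(W)$, $[\cdots[[D|_W,f_0],f_1],\dots,f_r]=0$, where $[D,f]=D\circ f-f\circ D$; it is a differential operator if it is locally of finite order. $\mathrm{Diff}_c(\mathcal{F}|_U,\underline{\mathcal{O}}|_U)$ is the space of differential operators with compact support (complement of the largest open set on which $D$ is zero). $\mathcal{F}(U)$ has the topology defined by the seminorms $|u|_D=\sup_{a\in U}|(D(u))(a)|$, $D\in\mathrm{Diff}_c(\mathcal{F}|_U,\underline{\mathcal{O}}|_U)$. The presheaf. For $K\subset U$ compact, $\mathcal{F}_K(U)\subset\mathcal{F}(U)$ is the subspace of sections supported in $K$ (subspace topology); $\mathcal{F}_c(U)=\varinjlim_K\mathcal{F}_K(U)$ with the inductive limit topology. For open $V\subset U$, extension by zero $\mathrm{ext}_{U,V}:\mathcal{F}_c(V)\to\mathcal{F}_c(U)$ is continuous. $\mathrm{D}^{-\infty}(U;\mathcal{F};E)=\mathcal{L}_b(\mathcal{F}_c(U),E)$, with restriction maps $\eta\mapsto\eta\circ\mathrm{ext}_{U,V}$. *)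

theory Defs
  imports
    "HOL-Analysis.Analysis"
    "HOL-Algebra.QuotRing"
    "HOL-Algebra.Module"
    "HOL-Algebra.Algebraic_Closure_Type"
begin

abbreviation complex_ring :: "complex ring"
  where "complex_ring \<equiv> ring_of_type_algebra"

section \<open>Presheaves and sheaves\<close>

text \<open>
  The sections over \<open>U\<close> are a record of arbitrary type \<open>'m\<close> (ring, module, topological vector
  space, ...) with elements of type \<open>'s\<close>. Only the values at open sets matter. As the open subsets
  of an open subspace \<open>subtopology M U\<close> are open in \<open>M\<close>, the restriction of \<open>P\<close> to \<open>U\<close> is given by
  the same \<open>P\<close> over the space \<open>subtopology M U\<close>.
\<close>

record ('a, 's, 'm) presheaf =
  sec :: "'a set \<Rightarrow> 'm"
  res :: "'a set \<Rightarrow> 'a set \<Rightarrow> 's \<Rightarrow> 's"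

locale presheaf_on =
  fixes M :: "'a topology" and P :: "('a, 's, ('s, 'z) partial_object_scheme) presheaf"
  assumes res_closed:
      "\<lbrakk>openin M U; openin M V; V \<subseteq> U; s \<in> carrier (sec P U)\<rbrakk> \<Longrightarrow> res P U V s \<in> carrier (sec P V)"
    and res_self:
      "\<lbrakk>openin M U; s \<in> carrier (sec P U)\<rbrakk> \<Longrightarrow> res P U U s = s"
    and res_res:
      "\<lbrakk>openin M U; openin M V; openin M W; W \<subseteq> V; V \<subseteq> U; s \<in> carrier (sec P U)\<rbrakk>
        \<Longrightarrow> res P V W (res P U V s) = res P U W s"

locale sheaf_on = presheaf_on M P for M P +
  assumes locality:
      "\<lbrakk>\<And>V. V \<in> \<C> \<Longrightarrow> openin M V; \<Union>\<C> = U;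
        s \<in> carrier (sec P U); t \<in> carrier (sec P U);
        \<And>V. V \<in> \<C> \<Longrightarrow> res P U V s = res P U V t\<rbrakk> \<Longrightarrow> s = t"
    and gluing:
      "\<lbrakk>\<And>V. V \<in> \<C> \<Longrightarrow> openin M V; \<Union>\<C> = U;
        \<And>V. V \<in> \<C> \<Longrightarrow> \<sigma> V \<in> carrier (sec P V);
        \<And>V W. V \<in> \<C> \<Longrightarrow> W \<in> \<C> \<Longrightarrow> res P V (V \<inter> W) (\<sigma> V) = res P W (V \<inter> W) (\<sigma> W)\<rbrakk>
        \<Longrightarrow> \<exists>t \<in> carrier (sec P U). \<forall>V \<in> \<C>. res P U V t = \<sigma> V"

locale sheaf_of_complex_algebras = sheaf_on M \<O>
  for M :: "'a topology" and \<O> :: "('a, 'o, (complex, 'o) module) presheaf" +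
  assumes algebra_sec: "openin M U \<Longrightarrow> Module.algebra complex_ring (sec \<O> U)"
    and res_ring_hom:
      "\<lbrakk>openin M U; openin M V; V \<subseteq> U\<rbrakk> \<Longrightarrow> res \<O> U V \<in> ring_hom (sec \<O> U) (sec \<O> V)"
    and res_smult_complex:
      "\<lbrakk>openin M U; openin M V; V \<subseteq> U; f \<in> carrier (sec \<O> U)\<rbrakk>
        \<Longrightarrow> res \<O> U V (c \<odot>\<^bsub>sec \<O> U\<^esub> f) = c \<odot>\<^bsub>sec \<O> V\<^esub> res \<O> U V f"

locale sheaf_of_modules = sheaf_on M \<F>
  for M :: "'a topology" and \<O> :: "('a, 'o, (complex, 'o) module) presheaf"
    and \<F> :: "('a, 'f, ('o, 'f) module) presheaf" +
  assumes module_sec: "openin M U \<Longrightarrow> Module.module (sec \<O> U) (sec \<F> U)"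
    and res_add:
      "\<lbrakk>openin M U; openin M V; V \<subseteq> U; u \<in> carrier (sec \<F> U); v \<in> carrier (sec \<F> U)\<rbrakk>
        \<Longrightarrow> res \<F> U V (u \<oplus>\<^bsub>sec \<F> U\<^esub> v) = res \<F> U V u \<oplus>\<^bsub>sec \<F> V\<^esub> res \<F> U V v"
    and res_smult:
      "\<lbrakk>openin M U; openin M V; V \<subseteq> U; f \<in> carrier (sec \<O> U); u \<in> carrier (sec \<F> U)\<rbrakk>
        \<Longrightarrow> res \<F> U V (f \<odot>\<^bsub>sec \<F> U\<^esub> u) = res \<O> U V f \<odot>\<^bsub>sec \<F> V\<^esub> res \<F> U V u"

section \<open>Stalks, locally ringed spaces and values of sections\<close>

definition germ ::
    "'a topology \<Rightarrow> ('a, 's, ('s, 'z) partial_object_scheme) presheaf \<Rightarrow> 'a \<Rightarrow> 'a set \<Rightarrow> 's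
      \<Rightarrow> ('a set \<times> 's) set"
  where "germ M P a U s =
    {(V, t). openin M V \<and> a \<in> V \<and> t \<in> carrier (sec P V) \<and>
      (\<exists>W. openin M W \<and> a \<in> W \<and> W \<subseteq> U \<inter> V \<and> res P U W s = res P V W t)}"

text \<open>All germs occurring in one of the following unions are equal.\<close>

definition stalk ::
    "'a topology \<Rightarrow> ('a, 'o, (complex, 'o) module) presheaf \<Rightarrow> 'a \<Rightarrow> (complex, ('a set \<times> 'o) set) module"
  where "stalk M \<O> a =
    \<lparr>carrier = {germ M \<O> a U f | U f. openin M U \<and> a \<in> U \<and> f \<in> carrier (sec \<O> U)},
     mult = (\<lambda>A B. \<Union>(U, f)\<in>A. \<Union>(V, g)\<in>B. germ M \<O> a (U \<inter> V)
        (res \<O> U (U \<inter> V) f \<otimes>\<^bsub>sec \<O> (U \<inter> V)\<^esub> res \<O> V (U \<inter> V) g)),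
     one = germ M \<O> a (topspace M) \<one>\<^bsub>sec \<O> (topspace M)\<^esub>,
     zero = germ M \<O> a (topspace M) \<zero>\<^bsub>sec \<O> (topspace M)\<^esub>,
     add = (\<lambda>A B. \<Union>(U, f)\<in>A. \<Union>(V, g)\<in>B. germ M \<O> a (U \<inter> V)
        (res \<O> U (U \<inter> V) f \<oplus>\<^bsub>sec \<O> (U \<inter> V)\<^esub> res \<O> V (U \<inter> V) g)),
     smult = (\<lambda>c A. \<Union>(U, f)\<in>A. germ M \<O> a U (c \<odot>\<^bsub>sec \<O> U\<^esub> f))\<rparr>"

definition local_ring :: "('r, 'z) ring_scheme \<Rightarrow> bool"
  where "local_ring R \<longleftrightarrow> cring R \<and> (\<exists>!I. maximalideal I R)"

definition max_ideal :: "('r, 'z) ring_scheme \<Rightarrow> 'r set"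
  where "max_ideal R = (THE I. maximalideal I R)"

text \<open>A morphism from a locally ringed space to \<open>Spec(\<complex>)\<close> is a \<open>\<complex>\<close>-algebra structure on its sheaf.\<close>

locale locally_ringed_space_over_complex = sheaf_of_complex_algebras M \<O> for M \<O> +
  assumes local_stalk: "a \<in> topspace M \<Longrightarrow> local_ring (stalk M \<O> a)"

text \<open>
  The value \<open>f(a)\<close>: the residue class of the germ of \<open>f\<close> in the residue field of the stalk at \<open>a\<close>,
  identified with a complex number via the structure map of the residue field (which is
  bijective on formal manifolds).
\<close>

definition sec_value ::
    "'a topology \<Rightarrow> ('a, 'o, (complex, 'o) module) presheaf \<Rightarrow> 'a set \<Rightarrow> 'o \<Rightarrow> 'a \<Rightarrow> complex"
  where "sec_value M \<O> U f a =
    (THE c. max_ideal (stalk M \<O> a) +>\<^bsub>stalk M \<O> a\<^esub> germ M \<O> a U f =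
            max_ideal (stalk M \<O> a) +>\<^bsub>stalk M \<O> a\<^esub> (c \<odot>\<^bsub>stalk M \<O> a\<^esub> \<one>\<^bsub>stalk M \<O> a\<^esub>))"

text \<open>
  An isomorphism of ringed spaces induces ring isomorphisms on the stalks, so that for locally
  ringed spaces it is automatically an isomorphism of locally ringed spaces.
\<close>

definition isomorphic_ringed ::
    "'a topology \<Rightarrow> ('a, 'o, (complex, 'o) module) presheaf \<Rightarrow>
     'b topology \<Rightarrow> ('b, 'p, (complex, 'p) module) presheaf \<Rightarrow> bool"
  where "isomorphic_ringed M \<O> Y \<P> \<longleftrightarrow>
    (\<exists>\<phi> \<psi>. homeomorphic_map M Y \<phi> \<and>
      (\<forall>W. openin Y W \<longrightarrow>
        \<psi> W \<in> ring_iso (sec \<P> W) (sec \<O> {x \<in> topspace M. \<phi> x \<in> W}) \<and>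
        (\<forall>c. \<forall>f \<in> carrier (sec \<P> W).
          \<psi> W (c \<odot>\<^bsub>sec \<P> W\<^esub> f) = c \<odot>\<^bsub>sec \<O> {x \<in> topspace M. \<phi> x \<in> W}\<^esub> \<psi> W f)) \<and>
      (\<forall>V W. openin Y V \<longrightarrow> openin Y W \<longrightarrow> W \<subseteq> V \<longrightarrow>
        (\<forall>f \<in> carrier (sec \<P> V).
          \<psi> W (res \<P> V W f) =
            res \<O> {x \<in> topspace M. \<phi> x \<in> V} {x \<in> topspace M. \<phi> x \<in> W} (\<psi> V f))))"

section \<open>Formal manifolds\<close>

text \<open>
  \<open>\<real>\<^sup>n\<close> is \<open>Euclidean_space n\<close>, i.e. the sequences vanishing from index \<open>n\<close> on.
  In the definition of the functions of class \<open>C\<^sup>r\<close> on an open set \<open>U\<close> of it, \<open>g\<close> is the \<open>i\<close>-th partial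
  derivative of \<open>f\<close>.
\<close>

primrec class_C :: "nat \<Rightarrow> nat \<Rightarrow> (nat \<Rightarrow> real) set \<Rightarrow> ((nat \<Rightarrow> real) \<Rightarrow> complex) \<Rightarrow> bool"
  where
    "class_C 0 n U f \<longleftrightarrow> continuous_map (subtopology (Euclidean_space n) U) euclidean f"
  | "class_C (Suc r) n U f \<longleftrightarrow>
      continuous_map (subtopology (Euclidean_space n) U) euclidean f \<and>
      (\<forall>i<n. \<exists>g. (\<forall>x\<in>U. ((\<lambda>t. f (x(i := t))) has_vector_derivative g x) (at (x i))) \<and>
        class_C r n U g)"

definition smooth_functions :: "nat \<Rightarrow> (nat \<Rightarrow> real) set \<Rightarrow> ((nat \<Rightarrow> real) \<Rightarrow> complex) set"
  where "smooth_functions n U = {f \<in> extensional U. \<forall>r. class_C r n U f}"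

text \<open>A multiset \<open>m\<close> over \<open>{..<k}\<close> stands for the monomial in which \<open>y\<^sub>i\<close> has exponent \<open>count m i\<close>.\<close>

definition monomials :: "nat \<Rightarrow> nat multiset set"
  where "monomials k = {m. set_mset m \<subseteq> {..<k}}"

definition euclidean_formal ::
    "nat \<Rightarrow> nat \<Rightarrow> (nat \<Rightarrow> real, nat multiset \<Rightarrow> (nat \<Rightarrow> real) \<Rightarrow> complex,
       (complex, nat multiset \<Rightarrow> (nat \<Rightarrow> real) \<Rightarrow> complex) module) presheaf"
  where "euclidean_formal n k =
    \<lparr>sec = (\<lambda>U.
      \<lparr>carrier = monomials k \<rightarrow>\<^sub>E smooth_functions n U,
       mult = (\<lambda>f g. \<lambda>m\<in>monomials k. \<lambda>x\<in>U. \<Sum>l | l \<subseteq># m. f l x * g (m - l) x),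
       one = (\<lambda>m\<in>monomials k. \<lambda>x\<in>U. if m = {#} then 1 else 0),
       zero = (\<lambda>m\<in>monomials k. \<lambda>x\<in>U. 0),
       add = (\<lambda>f g. \<lambda>m\<in>monomials k. \<lambda>x\<in>U. f m x + g m x),
       smult = (\<lambda>c f. \<lambda>m\<in>monomials k. \<lambda>x\<in>U. c * f m x)\<rparr>),
     res = (\<lambda>U V f. \<lambda>m\<in>monomials k. restrict (f m) V)\<rparr>"

definition paracompact_space :: "'a topology \<Rightarrow> bool"
  where "paracompact_space M \<longleftrightarrow>
    (\<forall>\<U>. (\<forall>U\<in>\<U>. openin M U) \<and> \<Union>\<U> = topspace M \<longrightarrow>
      (\<exists>\<V>. (\<forall>V\<in>\<V>. openin M V) \<and> \<Union>\<V> = topspace M \<and>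
        (\<forall>V\<in>\<V>. \<exists>U\<in>\<U>. V \<subseteq> U) \<and> locally_finite_in M \<V>))"

locale formal_manifold = locally_ringed_space_over_complex M \<O> for M \<O> +
  assumes paracompact: "paracompact_space M"
    and Hausdorff: "Hausdorff_space M"
    and locally_euclidean_formal:
      "a \<in> topspace M \<Longrightarrow> \<exists>U n k. openin M U \<and> a \<in> U \<and>
        isomorphic_ringed (subtopology M U) \<O> (Euclidean_space n) (euclidean_formal n k)"

text \<open>
  The quotient of \<open>\<O>\<close> by the ideal sheaf \<open>\<I>\<close> of the sections all of whose values vanish, realised as a
  sheaf of complex functions: the class of \<open>f\<close> in the presheaf quotient \<open>\<O>(U)/\<I>(U)\<close> is the function
  \<open>a \<mapsto> f(a)\<close>, and sheafification of this presheaf of functions gives the functions that are locally of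
  this form. In other words, \<open>f \<mapsto> (a \<mapsto> f(a))\<close> is an epimorphism of sheaves with kernel \<open>\<I>\<close>.
  Scalars are sections of \<open>\<O>\<close>, which makes this a sheaf of \<open>\<O>\<close>-modules.
\<close>

definition reduced_sheaf ::
    "'a topology \<Rightarrow> ('a, 'o, (complex, 'o) module) presheaf
      \<Rightarrow> ('a, 'a \<Rightarrow> complex, ('o, 'a \<Rightarrow> complex) module) presheaf"
  where "reduced_sheaf M \<O> =
    \<lparr>sec = (\<lambda>U.
      \<lparr>carrier = {g \<in> extensional U. \<forall>a\<in>U. \<exists>W f. openin M W \<and> a \<in> W \<and> W \<subseteq> U \<and>
          f \<in> carrier (sec \<O> W) \<and> (\<forall>b\<in>W. g b = sec_value M \<O> W f b)},
       mult = (\<lambda>g h. \<lambda>a\<in>U. g a * h a),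
       one = (\<lambda>a\<in>U. 1),
       zero = (\<lambda>a\<in>U. 0),
       add = (\<lambda>g h. \<lambda>a\<in>U. g a + h a),
       smult = (\<lambda>f g. \<lambda>a\<in>U. sec_value M \<O> U f a * g a)\<rparr>),
     res = (\<lambda>U V g. restrict g V)\<rparr>"

section \<open>Differential operators\<close>

definition complex_smult ::
    "('a, 'o, (complex, 'o) module) presheaf \<Rightarrow> ('a, 'f, ('o, 'f) module) presheaf
      \<Rightarrow> 'a set \<Rightarrow> complex \<Rightarrow> 'f \<Rightarrow> 'f"
  where "complex_smult \<O> \<F> U c u = (c \<odot>\<^bsub>sec \<O> U\<^esub> \<one>\<^bsub>sec \<O> U\<^esub>) \<odot>\<^bsub>sec \<F> U\<^esub> u"

definition sheaf_hom ::
    "'a topology \<Rightarrow> ('a, 'o, (complex, 'o) module) presheaf \<Rightarrow> ('a, 'f, ('o, 'f) module) presheaf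
      \<Rightarrow> ('a, 'g, ('o, 'g) module) presheaf \<Rightarrow> 'a set \<Rightarrow> ('a set \<Rightarrow> 'f \<Rightarrow> 'g) \<Rightarrow> bool"
  where "sheaf_hom M \<O> \<F> \<G> U D \<longleftrightarrow>
    (\<forall>V. openin M V \<and> V \<subseteq> U \<longrightarrow>
      (\<forall>u \<in> carrier (sec \<F> V). D V u \<in> carrier (sec \<G> V)) \<and>
      (\<forall>u \<in> carrier (sec \<F> V). \<forall>v \<in> carrier (sec \<F> V).
        D V (u \<oplus>\<^bsub>sec \<F> V\<^esub> v) = D V u \<oplus>\<^bsub>sec \<G> V\<^esub> D V v) \<and>
      (\<forall>c. \<forall>u \<in> carrier (sec \<F> V).
        D V (complex_smult \<O> \<F> V c u) = complex_smult \<O> \<G> V c (D V u)) \<and>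
      (\<forall>W. openin M W \<and> W \<subseteq> V \<longrightarrow>
        (\<forall>u \<in> carrier (sec \<F> V). D W (res \<F> V W u) = res \<G> V W (D V u))))"

text \<open>The commutator \<open>[D|\<^sub>W, f] = D|\<^sub>W \<circ> f - f \<circ> D|\<^sub>W\<close> for \<open>f \<in> \<O>(W)\<close>.\<close>

definition commutator ::
    "('a, 'o, (complex, 'o) module) presheaf \<Rightarrow> ('a, 'f, ('o, 'f) module) presheaf
      \<Rightarrow> ('a, 'g, ('o, 'g) module) presheaf \<Rightarrow> 'a set
      \<Rightarrow> ('a set \<Rightarrow> 'f \<Rightarrow> 'g) \<Rightarrow> 'o \<Rightarrow> 'a set \<Rightarrow> 'f \<Rightarrow> 'g"
  where "commutator \<O> \<F> \<G> W D f = (\<lambda>V u.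
    D V (res \<O> W V f \<odot>\<^bsub>sec \<F> V\<^esub> u) \<ominus>\<^bsub>sec \<G> V\<^esub> (res \<O> W V f \<odot>\<^bsub>sec \<G> V\<^esub> D V u))"

definition zero_hom_on ::
    "'a topology \<Rightarrow> ('a, 'f, ('o, 'f) module) presheaf \<Rightarrow> ('a, 'g, ('o, 'g) module) presheaf
      \<Rightarrow> 'a set \<Rightarrow> ('a set \<Rightarrow> 'f \<Rightarrow> 'g) \<Rightarrow> bool"
  where "zero_hom_on M \<F> \<G> W D \<longleftrightarrow>
    (\<forall>V. openin M V \<and> V \<subseteq> W \<longrightarrow> (\<forall>u \<in> carrier (sec \<F> V). D V u = \<zero>\<^bsub>sec \<G> V\<^esub>))"

definition has_order_le ::
    "'a topology \<Rightarrow> ('a, 'o, (complex, 'o) module) presheaf \<Rightarrow> ('a, 'f, ('o, 'f) module) presheaf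
      \<Rightarrow> ('a, 'g, ('o, 'g) module) presheaf \<Rightarrow> 'a set \<Rightarrow> nat \<Rightarrow> ('a set \<Rightarrow> 'f \<Rightarrow> 'g) \<Rightarrow> bool"
  where "has_order_le M \<O> \<F> \<G> U r D \<longleftrightarrow>
    (\<forall>W fs. openin M W \<and> W \<subseteq> U \<and> length fs = Suc r \<and> set fs \<subseteq> carrier (sec \<O> W) \<longrightarrow>
      zero_hom_on M \<F> \<G> W (foldl (commutator \<O> \<F> \<G> W) D fs))"

definition differential_operator ::
    "'a topology \<Rightarrow> ('a, 'o, (complex, 'o) module) presheaf \<Rightarrow> ('a, 'f, ('o, 'f) module) presheaf
      \<Rightarrow> ('a, 'g, ('o, 'g) module) presheaf \<Rightarrow> 'a set \<Rightarrow> ('a set \<Rightarrow> 'f \<Rightarrow> 'g) \<Rightarrow> bool"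
  where "differential_operator M \<O> \<F> \<G> U D \<longleftrightarrow>
    sheaf_hom M \<O> \<F> \<G> U D \<and>
    (\<forall>a\<in>U. \<exists>W r. openin M W \<and> a \<in> W \<and> W \<subseteq> U \<and> has_order_le M \<O> \<F> \<G> W r D)"

definition hom_support ::
    "'a topology \<Rightarrow> ('a, 'f, ('o, 'f) module) presheaf \<Rightarrow> ('a, 'g, ('o, 'g) module) presheaf
      \<Rightarrow> 'a set \<Rightarrow> ('a set \<Rightarrow> 'f \<Rightarrow> 'g) \<Rightarrow> 'a set"
  where "hom_support M \<F> \<G> U D =
    U - \<Union>{W. openin M W \<and> W \<subseteq> U \<and> zero_hom_on M \<F> \<G> W D}"

definition Diff_c ::
    "'a topology \<Rightarrow> ('a, 'o, (complex, 'o) module) presheaf \<Rightarrow> ('a, 'f, ('o, 'f) module) presheaf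
      \<Rightarrow> ('a, 'g, ('o, 'g) module) presheaf \<Rightarrow> 'a set \<Rightarrow> ('a set \<Rightarrow> 'f \<Rightarrow> 'g) set"
  where "Diff_c M \<O> \<F> \<G> U =
    {D. differential_operator M \<O> \<F> \<G> U D \<and> compactin M (hom_support M \<F> \<G> U D)}"

section \<open>Locally convex spaces\<close>

record 'v tvs = "(complex, 'v) module" +
  topo :: "'v topology"

locale LCS =
  fixes E :: "('v, 'z) tvs_scheme" (structure)
  assumes vector_space: "Module.module complex_ring E"
    and topspace_topo: "topspace (topo E) = carrier E"
    and continuous_add:
      "continuous_map (prod_topology (topo E) (topo E)) (topo E) (\<lambda>(x, y). x \<oplus> y)"
    and continuous_smult:
      "continuous_map (prod_topology euclidean (topo E)) (topo E) (\<lambda>(c, x). c \<odot> x)"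
    and locally_convex:
      "\<lbrakk>openin (topo E) N; \<zero> \<in> N\<rbrakk> \<Longrightarrow>
        \<exists>C. openin (topo E) C \<and> \<zero> \<in> C \<and> C \<subseteq> N \<and>
          (\<forall>x\<in>C. \<forall>y\<in>C. \<forall>t\<in>{0..1}. (complex_of_real t \<odot> x) \<oplus> (complex_of_real (1 - t) \<odot> y) \<in> C)"

definition bounded_in :: "('v, 'z) tvs_scheme \<Rightarrow> 'v set \<Rightarrow> bool"
  where "bounded_in E B \<longleftrightarrow> B \<subseteq> carrier E \<and>
    (\<forall>N. openin (topo E) N \<and> \<zero>\<^bsub>E\<^esub> \<in> N \<longrightarrow>
      (\<exists>r>0. \<forall>t\<ge>r. B \<subseteq> (\<lambda>y. complex_of_real t \<odot>\<^bsub>E\<^esub> y) ` N))"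

definition Cauchy_filter_in :: "('v, 'z) tvs_scheme \<Rightarrow> 'v filter \<Rightarrow> bool"
  where "Cauchy_filter_in E \<Phi> \<longleftrightarrow>
    (\<forall>N. openin (topo E) N \<and> \<zero>\<^bsub>E\<^esub> \<in> N \<longrightarrow>
      (\<exists>A \<subseteq> carrier E. eventually (\<lambda>x. x \<in> A) \<Phi> \<and> (\<forall>x\<in>A. \<forall>y\<in>A. x \<ominus>\<^bsub>E\<^esub> y \<in> N)))"

definition complete_in :: "('v, 'z) tvs_scheme \<Rightarrow> 'v set \<Rightarrow> bool"
  where "complete_in E B \<longleftrightarrow>
    (\<forall>\<Phi>. \<Phi> \<noteq> bot \<and> eventually (\<lambda>x. x \<in> B) \<Phi> \<and> Cauchy_filter_in E \<Phi> \<longrightarrow>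
      (\<exists>l\<in>B. limitin (topo E) (\<lambda>x. x) l \<Phi>))"

locale quasi_complete_LCS = LCS E for E (structure) +
  assumes Hausdorff: "Hausdorff_space (topo E)"
    and quasi_complete: "\<lbrakk>closedin (topo E) B; bounded_in E B\<rbrakk> \<Longrightarrow> complete_in E B"

definition linear_map :: "(complex, 'v, 'y) module_scheme \<Rightarrow> (complex, 'w, 'z) module_scheme \<Rightarrow> ('v \<Rightarrow> 'w) \<Rightarrow> bool"
  where "linear_map V W h \<longleftrightarrow>
    (\<forall>x \<in> carrier V. h x \<in> carrier W) \<and>
    (\<forall>x \<in> carrier V. \<forall>y \<in> carrier V. h (x \<oplus>\<^bsub>V\<^esub> y) = h x \<oplus>\<^bsub>W\<^esub> h y) \<and>
    (\<forall>c. \<forall>x \<in> carrier V. h (c \<odot>\<^bsub>V\<^esub> x) = c \<odot>\<^bsub>W\<^esub> h x)"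

definition continuous_linear_map :: "('v, 'y) tvs_scheme \<Rightarrow> ('w, 'z) tvs_scheme \<Rightarrow> ('v \<Rightarrow> 'w) \<Rightarrow> bool"
  where "continuous_linear_map V W h \<longleftrightarrow> linear_map V W h \<and> continuous_map (topo V) (topo W) h"

definition seminorm_topology :: "(complex, 'v, 'z) module_scheme \<Rightarrow> ('v \<Rightarrow> real) set \<Rightarrow> 'v topology"
  where "seminorm_topology V \<P> = topology (\<lambda>W. W \<subseteq> carrier V \<and>
    (\<forall>x\<in>W. \<exists>\<Q> \<epsilon>. finite \<Q> \<and> \<Q> \<subseteq> \<P> \<and> 0 < \<epsilon> \<and>
      {y \<in> carrier V. \<forall>p\<in>\<Q>. p (y \<ominus>\<^bsub>V\<^esub> x) < \<epsilon>} \<subseteq> W))"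

lemma openin_seminorm_topology:
  "openin (seminorm_topology V \<P>) W \<longleftrightarrow> W \<subseteq> carrier V \<and>
    (\<forall>x\<in>W. \<exists>\<Q> \<epsilon>. finite \<Q> \<and> \<Q> \<subseteq> \<P> \<and> 0 < \<epsilon> \<and>
      {y \<in> carrier V. \<forall>p\<in>\<Q>. p (y \<ominus>\<^bsub>V\<^esub> x) < \<epsilon>} \<subseteq> W)"
proof -
  define B where "B \<Q> \<epsilon> x = {y \<in> carrier V. \<forall>p\<in>\<Q>. p (y \<ominus>\<^bsub>V\<^esub> x) < \<epsilon>}"
    for \<Q> :: "('a \<Rightarrow> real) set" and \<epsilon> :: real and x :: 'a
  define N where "N W x \<longleftrightarrow> (\<exists>\<Q> \<epsilon>. finite \<Q> \<and> \<Q> \<subseteq> \<P> \<and> 0 < \<epsilon> \<and> B \<Q> \<epsilon> x \<subseteq> W)" for W x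
  have mono: "N T x" if "N S x" "S \<subseteq> T" for S T x
    using that unfolding N_def by blast
  have Int: "N (S \<inter> T) x" if S: "N S x" and T: "N T x" for S T x
  proof -
    obtain \<Q> \<epsilon> where 1: "finite \<Q>" "\<Q> \<subseteq> \<P>" "0 < \<epsilon>" "B \<Q> \<epsilon> x \<subseteq> S"
      using S unfolding N_def by blast
    obtain \<Q>' \<epsilon>' where 2: "finite \<Q>'" "\<Q>' \<subseteq> \<P>" "0 < \<epsilon>'" "B \<Q>' \<epsilon>' x \<subseteq> T"
      using T unfolding N_def by blast
    have "B (\<Q> \<union> \<Q>') (min \<epsilon> \<epsilon>') x \<subseteq> B \<Q> \<epsilon> x \<inter> B \<Q>' \<epsilon>' x"
      by (auto simp: B_def)
    also have "\<dots> \<subseteq> S \<inter> T" using 1(4) 2(4) by (rule Int_mono)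
    finally have "B (\<Q> \<union> \<Q>') (min \<epsilon> \<epsilon>') x \<subseteq> S \<inter> T" .
    moreover have "finite (\<Q> \<union> \<Q>')" "\<Q> \<union> \<Q>' \<subseteq> \<P>" "0 < min \<epsilon> \<epsilon>'" using 1 2 by simp_all
    ultimately show ?thesis unfolding N_def by (intro exI conjI)
  qed
  have "istopology (\<lambda>W. W \<subseteq> carrier V \<and> (\<forall>x\<in>W. N W x))"
    unfolding istopology_def
  proof (intro conjI allI impI ballI)
    fix S T x
    assume "S \<subseteq> carrier V \<and> (\<forall>x\<in>S. N S x)" "T \<subseteq> carrier V \<and> (\<forall>x\<in>T. N T x)"
    then show "S \<inter> T \<subseteq> carrier V" and "x \<in> S \<inter> T \<Longrightarrow> N (S \<inter> T) x"
      using Int by auto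
  next
    fix \<K> x
    assume *: "\<forall>K\<in>\<K>. K \<subseteq> carrier V \<and> (\<forall>x\<in>K. N K x)"
    then show "\<Union>\<K> \<subseteq> carrier V" by auto
    assume "x \<in> \<Union>\<K>"
    then obtain K where "K \<in> \<K>" "x \<in> K" by (rule UnionE)
    with * show "N (\<Union>\<K>) x" by (metis Union_upper mono)
  qed
  then show ?thesis
    unfolding seminorm_topology_def N_def B_def by (simp only: topology_inverse')
qed

text \<open>
  The inductive limit in the category of LCS of a directed family \<open>\<S>\<close> of subspaces with union \<open>V\<close>:
  the finest locally convex topology for which all the inclusions are continuous.
\<close>

definition inductive_limit :: "(complex, 'v) module \<Rightarrow> 'v tvs set \<Rightarrow> 'v tvs"
  where "inductive_limit V \<S> = module.extend V \<lparr>topo = topology_generated_by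
    {W. \<exists>T. LCS (module.extend V \<lparr>topo = T\<rparr>) \<and>
      (\<forall>S\<in>\<S>. continuous_map (topo S) T (\<lambda>x. x)) \<and> openin T W}\<rparr>"

definition strong_topology :: "('v, 'y) tvs_scheme \<Rightarrow> ('w, 'z) tvs_scheme \<Rightarrow> ('v \<Rightarrow> 'w) set \<Rightarrow> ('v \<Rightarrow> 'w) topology"
  where "strong_topology V E L = topology (\<lambda>W. W \<subseteq> L \<and>
    (\<forall>\<eta>\<in>W. \<exists>B N. bounded_in V B \<and> openin (topo E) N \<and> \<zero>\<^bsub>E\<^esub> \<in> N \<and>
      {\<zeta> \<in> L. \<forall>x\<in>B. \<zeta> x \<ominus>\<^bsub>E\<^esub> \<eta> x \<in> N} \<subseteq> W))"

text \<open>Records extending \<open>module\<close> carry ring operations, which play no role for a vector space.\<close>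

definition L_b :: "('v, 'y) tvs_scheme \<Rightarrow> ('w, 'z) tvs_scheme \<Rightarrow> ('v \<Rightarrow> 'w) tvs"
  where "L_b V E =
    \<lparr>carrier = {\<eta> \<in> extensional (carrier V). continuous_linear_map V E \<eta>},
     mult = undefined,
     one = undefined,
     zero = (\<lambda>x\<in>carrier V. \<zero>\<^bsub>E\<^esub>),
     add = (\<lambda>\<eta> \<zeta>. \<lambda>x\<in>carrier V. \<eta> x \<oplus>\<^bsub>E\<^esub> \<zeta> x),
     smult = (\<lambda>c \<eta>. \<lambda>x\<in>carrier V. c \<odot>\<^bsub>E\<^esub> \<eta> x),
     topo = strong_topology V E {\<eta> \<in> extensional (carrier V). continuous_linear_map V E \<eta>}\<rparr>"

section \<open>Generalised functions with values in a locally convex space\<close>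

text \<open>Inserting \<open>0\<close> makes the supremum over the empty set equal to \<open>0\<close>.\<close>

definition diff_seminorm :: "'a set \<Rightarrow> ('a set \<Rightarrow> 'f \<Rightarrow> 'a \<Rightarrow> complex) \<Rightarrow> 'f \<Rightarrow> real"
  where "diff_seminorm U D u = Sup (insert 0 ((\<lambda>a. cmod (D U u a)) ` U))"

definition sections_on ::
    "('a, 'o, (complex, 'o) module) presheaf \<Rightarrow> ('a, 'f, ('o, 'f) module) presheaf
      \<Rightarrow> 'a set \<Rightarrow> 'f set \<Rightarrow> (complex, 'f) module"
  where "sections_on \<O> \<F> U S =
    \<lparr>carrier = S, mult = mult (sec \<F> U), one = one (sec \<F> U), zero = zero (sec \<F> U),
     add = add (sec \<F> U), smult = complex_smult \<O> \<F> U\<rparr>"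

definition smooth_topology ::
    "'a topology \<Rightarrow> ('a, 'o, (complex, 'o) module) presheaf \<Rightarrow> ('a, 'f, ('o, 'f) module) presheaf
      \<Rightarrow> 'a set \<Rightarrow> 'f topology"
  where "smooth_topology M \<O> \<F> U =
    seminorm_topology (sections_on \<O> \<F> U (carrier (sec \<F> U)))
      (diff_seminorm U ` Diff_c M \<O> \<F> (reduced_sheaf M \<O>) U)"

definition sec_support ::
    "'a topology \<Rightarrow> ('a, 'f, ('o, 'f) module) presheaf \<Rightarrow> 'a set \<Rightarrow> 'f \<Rightarrow> 'a set"
  where "sec_support M \<F> U u =
    U - \<Union>{W. openin M W \<and> W \<subseteq> U \<and> res \<F> U W u = \<zero>\<^bsub>sec \<F> W\<^esub>}"

definition supported_in ::
    "'a topology \<Rightarrow> ('a, 'f, ('o, 'f) module) presheaf \<Rightarrow> 'a set \<Rightarrow> 'a set \<Rightarrow> 'f set"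
  where "supported_in M \<F> U K = {u \<in> carrier (sec \<F> U). sec_support M \<F> U u \<subseteq> K}"

definition sections_supported ::
    "'a topology \<Rightarrow> ('a, 'o, (complex, 'o) module) presheaf \<Rightarrow> ('a, 'f, ('o, 'f) module) presheaf
      \<Rightarrow> 'a set \<Rightarrow> 'a set \<Rightarrow> 'f tvs"
  where "sections_supported M \<O> \<F> U K =
    module.extend (sections_on \<O> \<F> U (supported_in M \<F> U K))
      \<lparr>topo = subtopology (smooth_topology M \<O> \<F> U) (supported_in M \<F> U K)\<rparr>"

definition sections_compact ::
    "'a topology \<Rightarrow> ('a, 'o, (complex, 'o) module) presheaf \<Rightarrow> ('a, 'f, ('o, 'f) module) presheaf
      \<Rightarrow> 'a set \<Rightarrow> 'f tvs"
  where "sections_compact M \<O> \<F> U =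
    inductive_limit
      (sections_on \<O> \<F> U (\<Union>K \<in> {K. compactin M K \<and> K \<subseteq> U}. supported_in M \<F> U K))
      (sections_supported M \<O> \<F> U ` {K. compactin M K \<and> K \<subseteq> U})"

definition ext_zero ::
    "'a topology \<Rightarrow> ('a, 'f, ('o, 'f) module) presheaf \<Rightarrow> 'a set \<Rightarrow> 'a set \<Rightarrow> 'f \<Rightarrow> 'f"
  where "ext_zero M \<F> U V u =
    (THE s. s \<in> carrier (sec \<F> U) \<and> res \<F> U V s = u \<and>
      res \<F> U (U - sec_support M \<F> V u) s = \<zero>\<^bsub>sec \<F> (U - sec_support M \<F> V u)\<^esub>)"

definition generalized_functions ::
    "'a topology \<Rightarrow> ('a, 'o, (complex, 'o) module) presheaf \<Rightarrow> ('a, 'f, ('o, 'f) module) presheaf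
      \<Rightarrow> 'e tvs \<Rightarrow> ('a, 'f \<Rightarrow> 'e, ('f \<Rightarrow> 'e) tvs) presheaf"
  where "generalized_functions M \<O> \<F> E =
    \<lparr>sec = (\<lambda>U. L_b (sections_compact M \<O> \<F> U) E),
     res = (\<lambda>U V \<eta>. \<lambda>u\<in>carrier (sections_compact M \<O> \<F> V). \<eta> (ext_zero M \<F> U V u))\<rparr>"

locale presheaf_of_LCS = presheaf_on M P
  for M :: "'a topology" and P :: "('a, 's, 's tvs) presheaf" +
  assumes LCS_sec: "openin M U \<Longrightarrow> LCS (sec P U)"
    and res_continuous_linear:
      "\<lbrakk>openin M U; openin M V; V \<subseteq> U\<rbrakk> \<Longrightarrow> continuous_linear_map (sec P U) (sec P V) (res P U V)"

end

theory Submission imports Defs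
begin

text \<open>
  The key construction is the following transport of differential operators. If \<open>\<rho> \<in> \<O>(M)\<close> has
  compact support in \<open>A \<inter> B\<close> and \<open>D\<close> is a compactly supported differential operator on \<open>A\<close>, then
  \<open>u \<mapsto> D(\<rho>u)\<close>, extended by zero, is one on \<open>B\<close>, because \<open>[D \<circ> \<rho>, f] = [D, f] \<circ> \<rho>\<close>. Hence multiplying by
  \<open>\<rho>\<close> and extending by zero pulls the defining seminorms of \<open>\<F>(A)\<close> back to defining seminorms of
  \<open>\<F>(B)\<close>, and is continuous. This gives both the continuity of extension by zero and, for a cover
  \<open>\<C>\<close> of \<open>U\<close> and a finite partition of unity \<open>(\<rho>\<^sub>i)\<close> subordinate to \<open>\<C>\<close> near a compact set \<open>K\<close>, the continuity of
  \<open>u \<mapsto> (\<rho>\<^sub>i u)\<^sub>i\<close> on \<open>\<F>\<^sub>K(U)\<close>. A compatible family \<open>(\<sigma>\<^sub>V)\<close> is therefore glued by \<open>u \<mapsto> \<Sum>\<^sub>i \<sigma>\<^bsub>V\<^sub>i\<^esub>(\<rho>\<^sub>i u)\<close>.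
  Compatibility makes this independent of the partition of unity, and the universal property of
  the inductive limit makes it continuous.
\<close>

section \<open>Locally convex spaces\<close>

text \<open>Continuity of extension by zero from \<open>V\<close> to \<open>U\<close> is not formal:
  an operator with compact support in \<open>U\<close> need not keep compact support when restricted
  to \<open>V\<close>, so its seminorm is not one of those that define the topology of \<F>(V). On
  sections supported in a fixed compact set the extension agrees with multiplication by a cutoff
  followed by extension, and the cutoff restores compact support.

  As \<F> is an arbitrary sheaf of modules, its sections are not functions. Supports are controlled
  only through restriction to open sets, and equalities of sections are checked on open covers.
  Pointwise arguments are confined to the reduced sheaf, the target of the operators.

  The weights of a partition sum to 1 only near a given compact set. Independence of the partition
  is therefore derived from an identity that needs no normalisation:
  \<open>pairing ps (act (weight_sum qs) U u)\<close> is symmetric in \<open>ps\<close> and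
  \<open>qs\<close>. When both sums fix \<open>u\<close>, the two values agree.

  The bumps come from charts: a smooth box bump on Euclidean space is placed in the degree zero
  coefficient of the power series.\<close>

abbreviation with_topo :: "(complex, 'v) module \<Rightarrow> 'v topology \<Rightarrow> 'v tvs"
  where "with_topo V T \<equiv> module.extend V \<lparr>topo = T\<rparr>"

lemma with_topo_simps [simp]:
  "carrier (with_topo V T) = carrier V" "add (with_topo V T) = add V"
  "zero (with_topo V T) = zero V" "smult (with_topo V T) = smult V"
  "topo (with_topo V T) = T"
  by (simp_all add: module.defs)

lemma complex_ring_simps [simp]:
  "carrier complex_ring = UNIV" "mult complex_ring = (*)" "one complex_ring = 1"
  "zero complex_ring = 0" "add complex_ring = (+)"
  by (simp_all add: ring_of_type_algebra_def)

text \<open>Attaching a topology changes the record type but none of the four fields on which the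
  module axioms for \<open>V\<close> depend; this carries the axioms across.\<close>

lemma module_cong:
  assumes "carrier V = carrier W" "add V = add W" "zero V = zero W" "smult V = smult W"
    and "Module.module R V"
  shows "Module.module R W"
proof -
  interpret V: Module.module R V by fact
  note eqs = assms(1-4)[symmetric]
  have "abelian_group W"
    by (rule abelian_groupI) (auto simp: eqs V.M.a_ac intro!: bexI[of _ "\<ominus>\<^bsub>V\<^esub> _"] V.M.l_neg)
  then show ?thesis
    using V.smult_l_distr V.smult_r_distr V.smult_assoc1 V.smult_closed V.R.is_cring
    by (intro moduleI) (simp_all add: eqs)
qed

lemma module_with_topo: "Module.module R (with_topo V T) \<longleftrightarrow> Module.module R V"
  by (auto intro: module_cong[of V "with_topo V T"] module_cong[of "with_topo V T" V])

text \<open>Negation in these records is a definite description. Rewriting it as a scalar multiple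
  lets differences in \<open>L_b\<close> be computed pointwise.\<close>

lemma complex_module_neg:
  assumes "Module.module complex_ring V" "x \<in> carrier V"
  shows "\<ominus>\<^bsub>V\<^esub> x = (- 1) \<odot>\<^bsub>V\<^esub> x"
proof -
  interpret V: Module.module complex_ring V by fact
  have "(- 1) \<odot>\<^bsub>V\<^esub> x \<oplus>\<^bsub>V\<^esub> x = \<zero>\<^bsub>V\<^esub>"
    using V.smult_l_distr[of "- 1" 1 x] V.smult_one[of x] V.smult_l_null[of x] assms(2) by simp
  then show ?thesis
    using V.M.minus_equality[of "(- 1) \<odot>\<^bsub>V\<^esub> x" x] V.smult_closed[of "- 1" x] assms(2) by simp
qed

abbreviation convex_in :: "(complex, 'v, 'z) module_scheme \<Rightarrow> 'v set \<Rightarrow> bool"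
  where "convex_in E C \<equiv> (\<forall>x\<in>C. \<forall>y\<in>C. \<forall>t\<in>{0..1}.
    (complex_of_real t \<odot>\<^bsub>E\<^esub> x) \<oplus>\<^bsub>E\<^esub> (complex_of_real (1 - t) \<odot>\<^bsub>E\<^esub> y) \<in> C)"

text \<open>Continuity of the two operations is asked for at single points, with the product
  topologies unfolded. This form suits topologies given by preimages or by a base of
  neighbourhoods.\<close>

lemma LCSI:
  fixes E (structure)
  assumes module: "Module.module complex_ring E"
    and topspace: "topspace (topo E) = carrier E"
    and add: "\<And>x y N. \<lbrakk>x \<in> carrier E; y \<in> carrier E; openin (topo E) N; x \<oplus> y \<in> N\<rbrakk> \<Longrightarrow>
      \<exists>N1 N2. openin (topo E) N1 \<and> openin (topo E) N2 \<and> x \<in> N1 \<and> y \<in> N2 \<and>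
        (\<forall>a\<in>N1. \<forall>b\<in>N2. a \<oplus> b \<in> N)"
    and smult: "\<And>c x N. \<lbrakk>x \<in> carrier E; openin (topo E) N; c \<odot> x \<in> N\<rbrakk> \<Longrightarrow>
      \<exists>\<delta>>0. \<exists>N1. openin (topo E) N1 \<and> x \<in> N1 \<and> (\<forall>d. cmod (d - c) < \<delta> \<longrightarrow> (\<forall>y\<in>N1. d \<odot> y \<in> N))"
    and convex: "\<And>N. \<lbrakk>openin (topo E) N; \<zero> \<in> N\<rbrakk> \<Longrightarrow>
      \<exists>C. openin (topo E) C \<and> \<zero> \<in> C \<and> C \<subseteq> N \<and> convex_in E C"
  shows "LCS E"
proof (rule LCS.intro)
  interpret Module.module complex_ring E by fact
  show "continuous_map (prod_topology (topo E) (topo E)) (topo E) (\<lambda>(x, y). x \<oplus> y)"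
    unfolding continuous_map_def
  proof (intro conjI allI impI)
    show "(\<lambda>(x, y). x \<oplus> y) \<in> topspace (prod_topology (topo E) (topo E)) \<rightarrow> topspace (topo E)"
      by (auto simp: topspace)
    fix N assume N: "openin (topo E) N"
    let ?S = "{p \<in> topspace (prod_topology (topo E) (topo E)). (case p of (x, y) \<Rightarrow> x \<oplus> y) \<in> N}"
    show "openin (prod_topology (topo E) (topo E)) ?S"
      unfolding openin_prod_topology_alt
    proof (intro allI impI)
      fix x y assume "(x, y) \<in> ?S"
      then obtain N1 N2 where "openin (topo E) N1" "openin (topo E) N2" "x \<in> N1" "y \<in> N2"
        "\<forall>a\<in>N1. \<forall>b\<in>N2. a \<oplus> b \<in> N"
        using add[of x y N] N topspace by auto
      then show "\<exists>U V. openin (topo E) U \<and> openin (topo E) V \<and> x \<in> U \<and> y \<in> V \<and> U \<times> V \<subseteq> ?S"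
        by (intro exI[of _ N1] exI[of _ N2]) (auto dest: openin_subset)
    qed
  qed
  show "continuous_map (prod_topology euclidean (topo E)) (topo E) (\<lambda>(c, x). c \<odot> x)"
    unfolding continuous_map_def
  proof (intro conjI allI impI)
    show "(\<lambda>(c, x). c \<odot> x) \<in> topspace (prod_topology euclidean (topo E)) \<rightarrow> topspace (topo E)"
      by (auto simp: topspace)
    fix N assume N: "openin (topo E) N"
    let ?S = "{p \<in> topspace (prod_topology euclidean (topo E)). (case p of (c, x) \<Rightarrow> c \<odot> x) \<in> N}"
    show "openin (prod_topology euclidean (topo E)) ?S"
      unfolding openin_prod_topology_alt
    proof (intro allI impI)
      fix c x assume "(c, x) \<in> ?S"
      then obtain \<delta> N1 where "\<delta> > 0" "openin (topo E) N1" "x \<in> N1"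
        "\<forall>d. cmod (d - c) < \<delta> \<longrightarrow> (\<forall>y\<in>N1. d \<odot> y \<in> N)"
        using smult[of x N c] N topspace by auto
      then show "\<exists>U V. openin euclidean U \<and> openin (topo E) V \<and> c \<in> U \<and> x \<in> V \<and> U \<times> V \<subseteq> ?S"
        by (intro exI[of _ "ball c \<delta>"] exI[of _ N1])
          (auto dest: openin_subset simp: dist_norm norm_minus_commute)
    qed
  qed
qed (use assms in auto)

context LCS
begin

interpretation Module.module complex_ring E
  by (rule vector_space)

lemma add_nhd:
  assumes "x \<in> carrier E" "y \<in> carrier E" "openin (topo E) N" "x \<oplus> y \<in> N"
  shows "\<exists>N1 N2. openin (topo E) N1 \<and> openin (topo E) N2 \<and> x \<in> N1 \<and> y \<in> N2 \<and>
    (\<forall>a\<in>N1. \<forall>b\<in>N2. a \<oplus> b \<in> N)"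
proof -
  have "openin (prod_topology (topo E) (topo E))
    {p \<in> topspace (prod_topology (topo E) (topo E)). (case p of (x, y) \<Rightarrow> x \<oplus> y) \<in> N}"
    using continuous_add assms(3) by (rule openin_continuous_map_preimage)
  note this[unfolded openin_prod_topology_alt, rule_format, of x y]
  then obtain U V where "openin (topo E) U" "openin (topo E) V" "x \<in> U" "y \<in> V"
    "U \<times> V \<subseteq> {p \<in> topspace (prod_topology (topo E) (topo E)). (case p of (x, y) \<Rightarrow> x \<oplus> y) \<in> N}"
    using assms topspace_topo by auto
  then show ?thesis by (intro exI[of _ U] exI[of _ V]) auto
qed

lemma smult_nhd:
  assumes "x \<in> carrier E" "openin (topo E) N" "c \<odot> x \<in> N"
  shows "\<exists>\<delta>>0. \<exists>N1. openin (topo E) N1 \<and> x \<in> N1 \<and>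
    (\<forall>d. cmod (d - c) < \<delta> \<longrightarrow> (\<forall>y\<in>N1. d \<odot> y \<in> N))"
proof -
  have "openin (prod_topology euclidean (topo E))
    {p \<in> topspace (prod_topology euclidean (topo E)). (case p of (c, x) \<Rightarrow> c \<odot> x) \<in> N}"
    using continuous_smult assms(2) by (rule openin_continuous_map_preimage)
  note this[unfolded openin_prod_topology_alt, rule_format, of c x]
  then obtain U V where UV: "openin euclidean U" "openin (topo E) V" "c \<in> U" "x \<in> V"
    "U \<times> V \<subseteq> {p \<in> topspace (prod_topology euclidean (topo E)). (case p of (c, x) \<Rightarrow> c \<odot> x) \<in> N}"
    using assms topspace_topo by auto
  then obtain \<delta> where "\<delta> > 0" "ball c \<delta> \<subseteq> U"
    using open_contains_ball by (metis open_openin)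
  then show ?thesis using UV
    by (intro exI[of _ \<delta>] exI[of _ V]) (auto simp: subset_iff dist_norm norm_minus_commute)
qed

lemma continuous_map_plus:
  assumes "continuous_map Y (topo E) f" "continuous_map Y (topo E) g"
  shows "continuous_map Y (topo E) (\<lambda>x. f x \<oplus> g x)"
  using continuous_map_compose[OF _ continuous_add, of Y "\<lambda>x. (f x, g x)"] assms
  by (simp add: continuous_map_pairedI o_def)

lemma continuous_map_scale:
  assumes "continuous_map Y (topo E) f"
  shows "continuous_map Y (topo E) (\<lambda>x. c \<odot> f x)"
  using continuous_map_compose[OF _ continuous_smult, of Y "\<lambda>x. (c, f x)"] assms
  by (simp add: continuous_map_pairedI o_def)

end

text \<open>The coarsest candidate: every map into the carrier is continuous for it, so the set of
  topologies competing in \<open>inductive_limit\<close> is never empty.\<close>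

lemma LCS_indiscrete:
  assumes "Module.module complex_ring V"
  shows "LCS (with_topo V (topology_generated_by {carrier V}))"
proof -
  interpret Module.module complex_ring V by fact
  have op: "N = {} \<or> N = carrier V" if "openin (topology_generated_by {carrier V}) N" for N
    using that unfolding openin_topology_generated_by_iff
    by (induction rule: generate_topology_on.induct) auto
  have car: "openin (topology_generated_by {carrier V}) (carrier V)"
    by (simp add: topology_generated_by_Basis)
  show ?thesis
  proof (rule LCSI, goal_cases)
    case 3 with op car show ?case by (metis with_topo_simps(1,2,5) a_closed empty_iff)
  next
    case (4 c x N)
    with op have "N = carrier V" by fastforce
    with 4 car show ?case by (intro exI[of _ 1]) auto
  next
    case (5 N)
    with op have "N = carrier V" by fastforce
    with car show ?case by auto
  qed (use assms in \<open>auto simp: module_with_topo topology_generated_by_topspace\<close>)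
qed

text \<open>A map into the supremum is continuous once it is continuous into every member
  (\<open>gen\<close>), and the identity from the supremum to a member is continuous
  (\<open>finer\<close>). Composing the operations of each member with this identity gives those of
  the supremum.\<close>

lemma LCS_Sup:
  assumes V: "Module.module complex_ring V" and ne: "\<T> \<noteq> {}"
    and LCS: "\<And>T. T \<in> \<T> \<Longrightarrow> LCS (with_topo V T)"
  shows "LCS (with_topo V (topology_generated_by {W. \<exists>T\<in>\<T>. openin T W}))"
    (is "LCS (with_topo V ?T)")
proof (rule LCS.intro)
  interpret Module.module complex_ring V by fact
  have top: "topspace T = carrier V" if "T \<in> \<T>" for T
    using LCS.topspace_topo[OF LCS[OF that]] by simp
  then have "openin T (carrier V)" if "T \<in> \<T>" for T
    using that by (metis openin_topspace)
  then have "\<Union>{W. \<exists>T\<in>\<T>. openin T W} = carrier V"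
    using ne top openin_subset by blast
  then show topspace: "topspace (topo (with_topo V ?T)) = carrier (with_topo V ?T)"
    by (simp add: topology_generated_by_topspace)
  have finer: "continuous_map ?T T (\<lambda>x. x)" if "T \<in> \<T>" for T
  proof (subst continuous_map_def, intro conjI allI impI)
    show "(\<lambda>x. x) \<in> topspace ?T \<rightarrow> topspace T"
      using topspace top[OF that] by simp
    fix U assume U: "openin T U"
    then have "{x \<in> topspace ?T. x \<in> U} = U"
      using topspace top[OF that] openin_subset[OF U] by auto
    then show "openin ?T {x \<in> topspace ?T. x \<in> U}"
      using U that by (auto intro: topology_generated_by_Basis)
  qed
  have gen: "continuous_map Y ?T f" if "\<And>T. T \<in> \<T> \<Longrightarrow> continuous_map Y T f" for Y and f :: "'y \<Rightarrow> _"
  proof (rule continuous_on_generated_topo)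
    fix U assume "U \<in> {W. \<exists>T\<in>\<T>. openin T W}"
    then obtain T where "T \<in> \<T>" "openin T U" by blast
    then have "openin Y {x \<in> topspace Y. f x \<in> U}"
      using that openin_continuous_map_preimage by blast
    then show "openin Y (f -` U \<inter> topspace Y)"
      by (simp add: vimage_def Int_def conj_commute)
  next
    obtain T where "T \<in> \<T>" using ne by blast
    then show "f ` topspace Y \<subseteq> \<Union>{W. \<exists>T\<in>\<T>. openin T W}"
      using that[of T] openin_topspace[of T] continuous_map_image_subset_topspace by blast
  qed
  show "continuous_map (prod_topology (topo (with_topo V ?T)) (topo (with_topo V ?T)))
     (topo (with_topo V ?T)) (\<lambda>(x, y). x \<oplus>\<^bsub>with_topo V ?T\<^esub> y)"
  proof (simp, rule gen)
    fix T assume T: "T \<in> \<T>"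
    have "continuous_map (prod_topology ?T ?T) (prod_topology T T) (\<lambda>(x, y). (x, y))"
      by (rule continuous_map_prod_top[THEN iffD2, OF disjI2, OF conjI[OF finer[OF T] finer[OF T]]])
    from continuous_map_compose[OF this] LCS.continuous_add[OF LCS[OF T]]
    show "continuous_map (prod_topology ?T ?T) T (\<lambda>(x, y). x \<oplus>\<^bsub>V\<^esub> y)"
      by (simp add: o_def case_prod_unfold)
  qed
  show "continuous_map (prod_topology euclidean (topo (with_topo V ?T)))
     (topo (with_topo V ?T)) (\<lambda>(c, x). c \<odot>\<^bsub>with_topo V ?T\<^esub> x)"
  proof (simp, rule gen)
    fix T assume T: "T \<in> \<T>"
    have "continuous_map (prod_topology euclidean ?T) (prod_topology euclidean T) (\<lambda>(x, y). (x, y))"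
      by (rule continuous_map_prod_top[THEN iffD2, OF disjI2, OF conjI[OF _ finer[OF T]]]) simp
    from continuous_map_compose[OF this] LCS.continuous_smult[OF LCS[OF T]]
    show "continuous_map (prod_topology euclidean ?T) T (\<lambda>(c, x). c \<odot>\<^bsub>V\<^esub> x)"
      by (simp add: o_def case_prod_unfold)
  qed
  show "\<exists>C. openin (topo (with_topo V ?T)) C \<and> \<zero>\<^bsub>with_topo V ?T\<^esub> \<in> C \<and> C \<subseteq> N \<and>
      convex_in (with_topo V ?T) C"
    if "openin (topo (with_topo V ?T)) N" "\<zero>\<^bsub>with_topo V ?T\<^esub> \<in> N" for N
  proof -
    have "\<zero>\<^bsub>V\<^esub> \<in> N \<Longrightarrow> \<exists>C. openin ?T C \<and> \<zero>\<^bsub>V\<^esub> \<in> C \<and> C \<subseteq> N \<and> convex_in V C"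
      using that(1) unfolding with_topo_simps openin_topology_generated_by_iff
    \<comment> \<open>Open sets of the supremum arise from members by finite intersections and
      unions; only the intersection step has to combine two convex neighbourhoods.\<close>
    proof (induction rule: generate_topology_on.induct)
      case (Int a b)
      then obtain C D where "generate_topology_on {W. \<exists>T\<in>\<T>. openin T W} C"
        "\<zero>\<^bsub>V\<^esub> \<in> C" "C \<subseteq> a" "convex_in V C"
        "generate_topology_on {W. \<exists>T\<in>\<T>. openin T W} D" "\<zero>\<^bsub>V\<^esub> \<in> D" "D \<subseteq> b" "convex_in V D"
        by blast
      then show ?case
        by (intro exI[of _ "C \<inter> D"]) (auto intro: generate_topology_on.Int)
    next
      case (UN K)
      then show ?case by (meson UnionE Union_upper subset_trans)
    next
      case (Basis W)
      then obtain T where T: "T \<in> \<T>" "openin T W" by blast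
      then obtain C where "openin T C" "\<zero>\<^bsub>V\<^esub> \<in> C" "C \<subseteq> W" "convex_in V C"
        using LCS.locally_convex[OF LCS[OF T(1)], of W] Basis(2) by auto
      with T show ?case by (blast intro: generate_topology_on.Basis)
    qed auto
    then show ?thesis using that by simp
  qed
qed (use V in \<open>simp add: module_with_topo\<close>)

text \<open>Preimages under a linear map inherit all the neighbourhood properties. The lemma
  provides a topology on the source for which \<open>h\<close> is continuous and which may compete
  in an inductive limit.\<close>

lemma LCS_pullback:
  assumes V: "Module.module complex_ring V" and E: "LCS E" and h: "linear_map V E h"
  shows "LCS (with_topo V (pullback_topology (carrier V) h (topo E)))" (is "LCS (with_topo V ?T)")
proof -
  interpret V: Module.module complex_ring V by fact
  interpret E: LCS E by fact
  interpret EM: Module.module complex_ring E by (rule E.vector_space)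
  have h_closed: "h x \<in> carrier E" if "x \<in> carrier V" for x
    using h that by (simp add: linear_map_def)
  have h_add: "h (x \<oplus>\<^bsub>V\<^esub> y) = h x \<oplus>\<^bsub>E\<^esub> h y" if "x \<in> carrier V" "y \<in> carrier V" for x y
    using h that by (simp add: linear_map_def)
  have h_smult: "h (c \<odot>\<^bsub>V\<^esub> x) = c \<odot>\<^bsub>E\<^esub> h x" if "x \<in> carrier V" for c x
    using h that by (simp add: linear_map_def)
  have h_zero: "h \<zero>\<^bsub>V\<^esub> = \<zero>\<^bsub>E\<^esub>"
    using h_smult[of "\<zero>\<^bsub>V\<^esub>" 0] EM.smult_l_null[of "h \<zero>\<^bsub>V\<^esub>"] h_closed[of "\<zero>\<^bsub>V\<^esub>"] V.smult_l_null[of "\<zero>\<^bsub>V\<^esub>"]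
    by simp
  have smult_closed: "c \<odot>\<^bsub>V\<^esub> x \<in> carrier V" if "x \<in> carrier V" for c x
    using that V.smult_closed by simp
  have open_pb: "openin ?T (h -` U \<inter> carrier V)" if "openin (topo E) U" for U
    using that unfolding openin_pullback_topology by blast
  show ?thesis
  proof (rule LCSI, goal_cases)
    case (3 x y N)
    then obtain U where "openin (topo E) U" "N = h -` U \<inter> carrier V"
      unfolding with_topo_simps openin_pullback_topology by blast
    with 3 obtain N1 N2 where "openin (topo E) N1" "openin (topo E) N2" "h x \<in> N1" "h y \<in> N2"
      "\<forall>a\<in>N1. \<forall>b\<in>N2. a \<oplus>\<^bsub>E\<^esub> b \<in> U"
      using E.add_nhd[of "h x" "h y" U] h_closed h_add by auto
    with 3 \<open>N = _\<close> open_pb show ?case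
      by (intro exI[of _ "h -` N1 \<inter> carrier V"] exI[of _ "h -` N2 \<inter> carrier V"]) (auto simp: h_add)
  next
    case (4 c x N)
    then obtain U where "openin (topo E) U" "N = h -` U \<inter> carrier V"
      unfolding with_topo_simps openin_pullback_topology by blast
    with 4 obtain \<delta> N1 where "\<delta> > 0" "openin (topo E) N1" "h x \<in> N1"
      "\<forall>d. cmod (d - c) < \<delta> \<longrightarrow> (\<forall>y\<in>N1. d \<odot>\<^bsub>E\<^esub> y \<in> U)"
      using E.smult_nhd[of "h x" U c] h_closed h_smult by auto
    with 4 \<open>N = _\<close> open_pb show ?case
      by (intro exI[of _ \<delta>] conjI exI[of _ "h -` N1 \<inter> carrier V"]) (auto simp: h_smult smult_closed)
  next
    case (5 N)
    then obtain U where U: "openin (topo E) U" "N = h -` U \<inter> carrier V"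
      unfolding with_topo_simps openin_pullback_topology by blast
    with 5 obtain C where C: "openin (topo E) C" "\<zero>\<^bsub>E\<^esub> \<in> C" "C \<subseteq> U" "convex_in E C"
      using E.locally_convex[of U] h_zero by auto
    have "convex_in (with_topo V ?T) (h -` C \<inter> carrier V)"
      using C(4) by (auto simp: h_add h_smult smult_closed)
    with C U open_pb show ?case
      by (intro exI[of _ "h -` C \<inter> carrier V"]) (auto simp: h_zero)
  qed (use V h_closed E.topspace_topo in \<open>auto simp: module_with_topo topspace_pullback_topology\<close>)
qed

subsection \<open>Inductive limits\<close>

lemma inductive_limit_simps [simp]:
  "carrier (inductive_limit V \<S>) = carrier V" "add (inductive_limit V \<S>) = add V"
  "zero (inductive_limit V \<S>) = zero V" "smult (inductive_limit V \<S>) = smult V"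
  by (simp_all add: inductive_limit_def)

lemma inductive_limit_eq:
  "inductive_limit V \<S> = with_topo V (topology_generated_by {W. \<exists>T \<in> {T. LCS (with_topo V T) \<and>
     (\<forall>S\<in>\<S>. continuous_map (topo S) T (\<lambda>x. x))}. openin T W})"
  by (simp add: inductive_limit_def conj_assoc)

lemma LCS_inductive_limit:
  assumes "Module.module complex_ring V" and "\<And>S. S \<in> \<S> \<Longrightarrow> topspace (topo S) \<subseteq> carrier V"
  shows "LCS (inductive_limit V \<S>)"
  unfolding inductive_limit_eq
proof (rule LCS_Sup[OF assms(1)])
  have "continuous_map (topo S) (topology_generated_by {carrier V}) (\<lambda>x. x)" if "S \<in> \<S>" for S
    using assms(2)[OF that] openin_topspace[of "topo S"]
    by (intro continuous_on_generated_topo) (auto simp: Int_absorb1)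
  then show "{T. LCS (with_topo V T) \<and> (\<forall>S\<in>\<S>. continuous_map (topo S) T (\<lambda>x. x))} \<noteq> {}"
    using LCS_indiscrete[OF assms(1)] by blast
qed simp

text \<open>The inclusion of \<open>S\<close> is continuous into each competing topology by
  definition, hence into the topology that they generate together.\<close>

lemma continuous_map_into_inductive_limit:
  assumes "Module.module complex_ring V" and "S \<in> \<S>"
    and "\<And>S. S \<in> \<S> \<Longrightarrow> topspace (topo S) \<subseteq> carrier V"
  shows "continuous_map (topo S) (topo (inductive_limit V \<S>)) (\<lambda>x. x)"
  unfolding inductive_limit_eq with_topo_simps
proof (rule continuous_on_generated_topo)
  fix U assume "U \<in> {W. \<exists>T\<in>{T. LCS (with_topo V T) \<and> (\<forall>S\<in>\<S>. continuous_map (topo S) T (\<lambda>x. x))}. openin T W}"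
  then obtain T where "continuous_map (topo S) T (\<lambda>x. x)" "openin T U"
    using assms(2) by blast
  then have "openin (topo S) {x \<in> topspace (topo S). x \<in> U}"
    by (rule openin_continuous_map_preimage)
  then show "openin (topo S) ((\<lambda>x. x) -` U \<inter> topspace (topo S))"
    by (simp add: Int_def conj_commute)
next
  have "\<Union>{W. \<exists>T\<in>{T. LCS (with_topo V T) \<and> (\<forall>S\<in>\<S>. continuous_map (topo S) T (\<lambda>x. x))}. openin T W}
      = topspace (topo (inductive_limit V \<S>))"
    unfolding inductive_limit_eq with_topo_simps topology_generated_by_topspace ..
  also have "\<dots> = carrier V"
    using LCS.topspace_topo[OF LCS_inductive_limit, of V \<S>] assms by simp
  finally show "(\<lambda>x. x) ` topspace (topo S) \<subseteq>
      \<Union>{W. \<exists>T\<in>{T. LCS (with_topo V T) \<and> (\<forall>S\<in>\<S>. continuous_map (topo S) T (\<lambda>x. x))}. openin T W}"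
    using assms(3)[OF assms(2)] by simp
qed

text \<open>The topology of \<open>E\<close> pulled back along \<open>h\<close> is locally convex
  and makes every inclusion continuous. It is thus among the topologies that generate the limit, and
  preimages under \<open>h\<close> are open.\<close>

lemma continuous_map_from_inductive_limit:
  assumes V: "Module.module complex_ring V" and E: "LCS E" and h: "linear_map V E h"
    and cont: "\<And>S. S \<in> \<S> \<Longrightarrow> continuous_map (topo S) (topo E) h"
    and top: "\<And>S. S \<in> \<S> \<Longrightarrow> topspace (topo S) \<subseteq> carrier V"
  shows "continuous_map (topo (inductive_limit V \<S>)) (topo E) h"
  unfolding continuous_map_def
proof (intro conjI allI impI)
  have topspace: "topspace (topo (inductive_limit V \<S>)) = carrier V"
    using LCS.topspace_topo[OF LCS_inductive_limit, of V \<S>] V top by simp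
  show "h \<in> topspace (topo (inductive_limit V \<S>)) \<rightarrow> topspace (topo E)"
    using h unfolding topspace LCS.topspace_topo[OF E] linear_map_def by auto
  fix U assume "openin (topo E) U"
  moreover have "continuous_map (topo S) (pullback_topology (carrier V) h (topo E)) (\<lambda>x. x)" if "S \<in> \<S>" for S
    using cont[OF that] top[OF that] by (intro continuous_map_pullback') (auto simp: o_def)
  moreover have "{x \<in> carrier V. h x \<in> U} = h -` U \<inter> carrier V" by auto
  ultimately show "openin (topo (inductive_limit V \<S>)) {x \<in> topspace (topo (inductive_limit V \<S>)). h x \<in> U}"
    unfolding topspace unfolding inductive_limit_eq with_topo_simps
    using LCS_pullback[OF V E h]
    by (intro topology_generated_by_Basis CollectI bexI[of _ "pullback_topology (carrier V) h (topo E)"])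
      (auto simp: openin_pullback_topology)
qed

subsection \<open>The strong topology\<close>

text \<open>The members of \<open>\<B>\<close> are neighbourhoods of zero that need not be open, as
  is the case for the sets that define the strong topology. The proof works with the interiors
  \<open>I x U\<close> of their translates, which are open because every member of
  \<open>\<B>\<close> can be halved.\<close>

lemma LCS_of_base:
  fixes L :: "('v, 'z) tvs_scheme" (structure) and \<B> :: "'v set set"
  assumes module: "Module.module complex_ring L"
    and openin: "\<And>W. openin (topo L) W \<longleftrightarrow>
      W \<subseteq> carrier L \<and> (\<forall>x\<in>W. \<exists>U\<in>\<B>. {y \<in> carrier L. y \<ominus> x \<in> U} \<subseteq> W)"
    and ne: "\<B> \<noteq> {}"
    and Int: "\<And>U V. \<lbrakk>U \<in> \<B>; V \<in> \<B>\<rbrakk> \<Longrightarrow> \<exists>W\<in>\<B>. W \<subseteq> U \<inter> V"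
    and sub: "\<And>U. U \<in> \<B> \<Longrightarrow> U \<subseteq> carrier L"
    and zero_mem: "\<And>U. U \<in> \<B> \<Longrightarrow> \<zero> \<in> U"
    and add: "\<And>U. U \<in> \<B> \<Longrightarrow> \<exists>V\<in>\<B>. \<forall>x\<in>V. \<forall>y\<in>V. x \<oplus> y \<in> U"
    and absorb: "\<And>U. U \<in> \<B> \<Longrightarrow> \<exists>V\<in>\<B>. \<exists>\<delta>>0. \<forall>c. cmod c < \<delta> \<longrightarrow> (\<forall>x\<in>V. c \<odot> x \<in> U)"
    and scale: "\<And>U c. U \<in> \<B> \<Longrightarrow> \<exists>V\<in>\<B>. \<forall>x\<in>V. c \<odot> x \<in> U"
    and absorbing: "\<And>U x. \<lbrakk>U \<in> \<B>; x \<in> carrier L\<rbrakk> \<Longrightarrow> \<exists>\<delta>>0. \<forall>c. cmod c < \<delta> \<longrightarrow> c \<odot> x \<in> U"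
    and convex: "\<And>U. U \<in> \<B> \<Longrightarrow> \<exists>V\<in>\<B>. V \<subseteq> U \<and> convex_in L V"
  shows "LCS L"
proof -
  interpret Module.module complex_ring L by fact
  have smult_closed' [simp]: "c \<odot> x \<in> carrier L" if "x \<in> carrier L" for c x
    using that smult_closed by simp
  have shift: "((p \<ominus> q) \<oplus> (r \<ominus> s)) \<oplus> q = (p \<oplus> r) \<ominus> s"
    if "p \<in> carrier L" "q \<in> carrier L" "r \<in> carrier L" "s \<in> carrier L" for p q r s
  proof -
    have "((p \<ominus> q) \<oplus> (r \<ominus> s)) \<oplus> q = ((p \<oplus> r) \<ominus> s) \<oplus> (\<ominus> q \<oplus> q)"
      using that by (simp add: a_minus_def a_ac del: l_neg r_neg)
    with that show ?thesis by (simp add: l_neg)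
  qed
  have add_diff: "a \<oplus> (b \<ominus> a) = b" if "a \<in> carrier L" "b \<in> carrier L" for a b
    using that by (simp add: a_minus_def a_lcomm[of a b] r_neg)
  \<comment> \<open>The interior of \<open>x + U\<close>: some translate \<open>y + V\<close> has to
    lie in \<open>x + U\<close>.\<close>
  define I where "I x U = {y \<in> carrier L. \<exists>V\<in>\<B>. \<forall>z\<in>carrier L. z \<ominus> y \<in> V \<longrightarrow> z \<ominus> x \<in> U}" for x U
  have I_self: "x \<in> I x U" if "x \<in> carrier L" "U \<in> \<B>" for x U
    using that by (auto simp: I_def)
  have I_sub: "y \<ominus> x \<in> U" "y \<in> carrier L" if "y \<in> I x U" for x y U
    using that zero_mem by (auto simp: I_def a_minus_def r_neg)
  have I_open: "openin (topo L) (I x U)" if "U \<in> \<B>" for x U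
    unfolding openin
  proof (intro conjI ballI)
    show "I x U \<subseteq> carrier L" by (auto simp: I_def)
    fix y assume "y \<in> I x U"
    then obtain V where y: "y \<in> carrier L" and V: "V \<in> \<B>" "\<forall>z\<in>carrier L. z \<ominus> y \<in> V \<longrightarrow> z \<ominus> x \<in> U"
      by (auto simp: I_def)
    from add[OF V(1)] obtain V' where V': "V' \<in> \<B>" "\<forall>x\<in>V'. \<forall>y\<in>V'. x \<oplus> y \<in> V" by blast
    have "w \<in> I x U" if w: "w \<in> carrier L" "w \<ominus> y \<in> V'" for w
    proof -
      have "z \<ominus> x \<in> U" if z: "z \<in> carrier L" "z \<ominus> w \<in> V'" for z
      proof -
        have "(z \<ominus> w) \<oplus> (w \<ominus> y) = z \<ominus> y"
          using y w z by (simp add: a_minus_def a_ac r_neg1 r_neg2)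
        with V' V(2) z w show ?thesis by (metis (no_types))
      qed
      with V'(1) w show ?thesis by (auto simp: I_def)
    qed
    with V'(1) show "\<exists>U'\<in>\<B>. {z \<in> carrier L. z \<ominus> y \<in> U'} \<subseteq> I x U" by auto
  qed
  show ?thesis
  proof (rule LCSI)
    show "topspace (topo L) = carrier L"
    proof
      have "openin (topo L) (carrier L)" unfolding openin using ne by auto
      then show "carrier L \<subseteq> topspace (topo L)" by (rule openin_subset)
      show "topspace (topo L) \<subseteq> carrier L" using openin[of "topspace (topo L)"] by simp
    qed
  next
    fix x y N assume x: "x \<in> carrier L" and y: "y \<in> carrier L"
      and N: "openin (topo L) N" "x \<oplus> y \<in> N"
    then obtain U where U: "U \<in> \<B>" "{z \<in> carrier L. z \<ominus> (x \<oplus> y) \<in> U} \<subseteq> N"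
      unfolding openin by blast
    from add[OF U(1)] obtain V where V: "V \<in> \<B>" "\<forall>x\<in>V. \<forall>y\<in>V. x \<oplus> y \<in> U" by blast
    have "a \<oplus> b \<in> N" if "a \<in> I x V" "b \<in> I y V" for a b
    proof -
      have ab: "a \<in> carrier L" "b \<in> carrier L" "a \<ominus> x \<in> V" "b \<ominus> y \<in> V"
        using that I_sub by auto
      have "(a \<oplus> b) \<ominus> (x \<oplus> y) = (a \<ominus> x) \<oplus> (b \<ominus> y)"
        using ab x y by (simp add: a_minus_def a_ac minus_add)
      with V ab U show ?thesis by auto
    qed
    with I_open[OF V(1)] I_self[OF _ V(1)] x y
    show "\<exists>N1 N2. openin (topo L) N1 \<and> openin (topo L) N2 \<and> x \<in> N1 \<and> y \<in> N2 \<and>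
        (\<forall>a\<in>N1. \<forall>b\<in>N2. a \<oplus> b \<in> N)"
      by (intro exI[of _ "I x V"] exI[of _ "I y V"] conjI) auto
  next
    fix c x N assume x: "x \<in> carrier L" and N: "openin (topo L) N" "c \<odot> x \<in> N"
    then obtain U where U: "U \<in> \<B>" "{z \<in> carrier L. z \<ominus> c \<odot> x \<in> U} \<subseteq> N"
      unfolding openin by blast
    from add[OF U(1)] obtain V where V: "V \<in> \<B>" "\<forall>x\<in>V. \<forall>y\<in>V. x \<oplus> y \<in> U" by blast
    from add[OF V(1)] obtain V' where V': "V' \<in> \<B>" "\<forall>x\<in>V'. \<forall>y\<in>V'. x \<oplus> y \<in> V" by blast
    from absorb[OF V'(1)] obtain V1 \<delta>1 where V1: "V1 \<in> \<B>" "\<delta>1 > 0" "\<forall>c. cmod c < \<delta>1 \<longrightarrow> (\<forall>x\<in>V1. c \<odot> x \<in> V')"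
      by blast
    from scale[OF V'(1)] obtain V2 where V2: "V2 \<in> \<B>" "\<forall>x\<in>V2. c \<odot> x \<in> V'" by blast
    from absorbing[OF V(1) x] obtain \<delta>2 where \<delta>2: "\<delta>2 > 0" "\<forall>c. cmod c < \<delta>2 \<longrightarrow> c \<odot> x \<in> V" by blast
    from Int[OF V1(1) V2(1)] obtain V3 where V3: "V3 \<in> \<B>" "V3 \<subseteq> V1" "V3 \<subseteq> V2" by blast
    \<comment> \<open>The difference \<open>d y - c x\<close> splits as
      \<open>(d - c)(y - x) + c (y - x) + (d - c) x\<close>. The three terms are controlled by
      \<open>absorb\<close>, \<open>scale\<close> and \<open>absorbing\<close>; two halvings of
      \<open>U\<close> leave room for their sum.\<close>
    have "d \<odot> y \<in> N" if d: "cmod (d - c) < min \<delta>1 \<delta>2" and y: "y \<in> I x V3" for d y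
    proof -
      have y': "y \<in> carrier L" "y \<ominus> x \<in> V3" using y I_sub by auto
      have 1: "d \<odot> z = (d - c) \<odot> z \<oplus> c \<odot> z" if "z \<in> carrier L" for z
        using smult_l_distr[of "d - c" c z] that by simp
      have 2: "c \<odot> (y \<ominus> x) = c \<odot> y \<ominus> c \<odot> x"
        using x y' smult_r_distr[of c y "\<ominus> x"] smult_r_minus[of c x] by (simp add: a_minus_def)
      have 3: "(d - c) \<odot> (y \<ominus> x) = (d - c) \<odot> y \<ominus> (d - c) \<odot> x"
        using x y' smult_r_distr[of "d - c" y "\<ominus> x"] smult_r_minus[of "d - c" x] by (simp add: a_minus_def)
      have "((d - c) \<odot> (y \<ominus> x) \<oplus> c \<odot> (y \<ominus> x)) \<oplus> (d - c) \<odot> x = d \<odot> y \<ominus> c \<odot> x"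
        unfolding 1[OF y'(1)] 2 3 using x y' by (intro shift) simp_all
      moreover have "(d - c) \<odot> (y \<ominus> x) \<in> V'" "c \<odot> (y \<ominus> x) \<in> V'" "(d - c) \<odot> x \<in> V"
        using d y'(2) V1(3) V2(2) V3(2,3) \<delta>2(2) by auto
      then have "((d - c) \<odot> (y \<ominus> x) \<oplus> c \<odot> (y \<ominus> x)) \<oplus> (d - c) \<odot> x \<in> U"
        using V(2) V'(2) by blast
      ultimately have "d \<odot> y \<ominus> c \<odot> x \<in> U" by simp
      then show ?thesis using U(2) y'(1) by auto
    qed
    moreover have "min \<delta>1 \<delta>2 > 0" using V1 \<delta>2 by simp
    ultimately show "\<exists>\<delta>>0. \<exists>N1. openin (topo L) N1 \<and> x \<in> N1 \<and>
        (\<forall>d. cmod (d - c) < \<delta> \<longrightarrow> (\<forall>y\<in>N1. d \<odot> y \<in> N))"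
      using I_open[OF V3(1)] I_self[OF x V3(1)]
      by (intro exI[of _ "min \<delta>1 \<delta>2"] conjI exI[of _ "I x V3"]) auto
  next
    fix N assume "openin (topo L) N" "\<zero> \<in> N"
    then obtain U where U: "U \<in> \<B>" "{z \<in> carrier L. z \<ominus> \<zero> \<in> U} \<subseteq> N"
      unfolding openin by blast
    from convex[OF U(1)] obtain V where V: "V \<in> \<B>" "V \<subseteq> U" "convex_in L V" by blast
    have m0 [simp]: "x \<ominus> \<zero> = x" if "x \<in> carrier L" for x
      using that by (simp add: a_minus_def)
    have "I \<zero> V \<subseteq> N"
    proof
      fix y assume "y \<in> I \<zero> V"
      then have "y \<ominus> \<zero> \<in> U" "y \<in> carrier L" using I_sub[of y \<zero> V] V by auto
      then show "y \<in> N" using U by blast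
    qed
    moreover have "convex_in L (I \<zero> V)"
    proof (intro ballI)
      fix x y and t :: real assume x: "x \<in> I \<zero> V" and y: "y \<in> I \<zero> V" and t: "t \<in> {0..1}"
      let ?v = "complex_of_real t \<odot> x \<oplus> complex_of_real (1 - t) \<odot> y"
      have xy: "x \<in> carrier L" "y \<in> carrier L" using x y I_sub by auto
      obtain A B where A: "A \<in> \<B>" "\<forall>z\<in>carrier L. z \<ominus> x \<in> A \<longrightarrow> z \<ominus> \<zero> \<in> V"
        and B: "B \<in> \<B>" "\<forall>z\<in>carrier L. z \<ominus> y \<in> B \<longrightarrow> z \<ominus> \<zero> \<in> V"
        using x y by (auto simp: I_def)
      from Int[OF A(1) B(1)] obtain C where C: "C \<in> \<B>" "C \<subseteq> A" "C \<subseteq> B" by blast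
      \<comment> \<open>Convexity passes to the interior by moving both end points by the same small
        \<open>w\<close>, since \<open>z = t (x + w) + (1 - t) (y + w)\<close>. The set
        \<open>C\<close> is small enough for both end points.\<close>
      have "z \<in> V" if z: "z \<in> carrier L" "z \<ominus> ?v \<in> C" for z
      proof -
        define w where "w = z \<ominus> ?v"
        have w: "w \<in> carrier L" "w \<in> C" using z xy by (auto simp: w_def)
        have "(x \<oplus> w) \<ominus> x = w" "(y \<oplus> w) \<ominus> y = w"
          using xy w by (simp_all add: a_minus_def a_ac r_neg r_neg1 r_neg2)
        then have "(x \<oplus> w) \<ominus> x \<in> A" "(y \<oplus> w) \<ominus> y \<in> B" using C w by auto
        then have "(x \<oplus> w) \<ominus> \<zero> \<in> V" "(y \<oplus> w) \<ominus> \<zero> \<in> V"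
          using A(2) B(2) a_closed[OF xy(1) w(1)] a_closed[OF xy(2) w(1)] by blast+
        then have "x \<oplus> w \<in> V" "y \<oplus> w \<in> V" using w xy by simp_all
        then have "complex_of_real t \<odot> (x \<oplus> w) \<oplus> complex_of_real (1 - t) \<odot> (y \<oplus> w) \<in> V"
          using V(3) t by blast
        also have "complex_of_real t \<odot> (x \<oplus> w) \<oplus> complex_of_real (1 - t) \<odot> (y \<oplus> w) =
          ?v \<oplus> (complex_of_real t \<odot> w \<oplus> complex_of_real (1 - t) \<odot> w)"
          using xy w by (simp add: smult_r_distr a_ac)
        also have "complex_of_real t \<odot> w \<oplus> complex_of_real (1 - t) \<odot> w = w"
          using smult_l_distr[of "complex_of_real t" "complex_of_real (1 - t)" w] w smult_one[of w] by simp
        also have "?v \<oplus> w = z"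
          unfolding w_def by (rule add_diff) (use z xy in simp_all)
        finally show ?thesis .
      qed
      with C(1) xy show "?v \<in> I \<zero> V" by (auto simp: I_def)
    qed
    ultimately show "\<exists>C. openin (topo L) C \<and> \<zero> \<in> C \<and> C \<subseteq> N \<and> convex_in L C"
      using I_open[OF V(1)] I_self[OF _ V(1)] by (intro exI[of _ "I \<zero> V"] conjI) simp_all
  qed fact
qed

section \<open>Bounded sets and spaces of continuous linear maps\<close>

lemma bounded_in_Un:
  assumes "bounded_in V A" "bounded_in V B"
  shows "bounded_in V (A \<union> B)"
  unfolding bounded_in_def
proof (intro conjI allI impI)
  show "A \<union> B \<subseteq> carrier V" using assms by (auto simp: bounded_in_def)
  fix N assume "openin (topo V) N \<and> \<zero>\<^bsub>V\<^esub> \<in> N"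
  then obtain r s where "r > 0" "\<forall>t\<ge>r. A \<subseteq> (\<lambda>y. complex_of_real t \<odot>\<^bsub>V\<^esub> y) ` N"
    "s > 0" "\<forall>t\<ge>s. B \<subseteq> (\<lambda>y. complex_of_real t \<odot>\<^bsub>V\<^esub> y) ` N"
    using assms unfolding bounded_in_def by metis
  then show "\<exists>r>0. \<forall>t\<ge>r. A \<union> B \<subseteq> (\<lambda>y. complex_of_real t \<odot>\<^bsub>V\<^esub> y) ` N"
    by (intro exI[of _ "max r s"]) auto
qed

lemma linear_map_zero:
  assumes "Module.module complex_ring V" "Module.module complex_ring W" "linear_map V W h"
  shows "h \<zero>\<^bsub>V\<^esub> = \<zero>\<^bsub>W\<^esub>"
proof -
  interpret V: Module.module complex_ring V by fact
  interpret W: Module.module complex_ring W by fact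
  have "h (0 \<odot>\<^bsub>V\<^esub> \<zero>\<^bsub>V\<^esub>) = 0 \<odot>\<^bsub>W\<^esub> h \<zero>\<^bsub>V\<^esub>" "h \<zero>\<^bsub>V\<^esub> \<in> carrier W"
    using assms(3) V.M.zero_closed unfolding linear_map_def by blast+
  then show ?thesis
    using V.smult_r_null[of 0] W.smult_l_null[of "h \<zero>\<^bsub>V\<^esub>", unfolded complex_ring_simps] by simp
qed

lemma bounded_in_image:
  assumes V: "LCS V" and W: "LCS W" and h: "continuous_linear_map V W h" and B: "bounded_in V B"
  shows "bounded_in W (h ` B)"
  unfolding bounded_in_def
proof (intro conjI allI impI)
  have lin: "linear_map V W h" and cont: "continuous_map (topo V) (topo W) h"
    using h by (auto simp: continuous_linear_map_def)
  show "h ` B \<subseteq> carrier W" using B lin by (auto simp: bounded_in_def linear_map_def)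
  fix N assume N: "openin (topo W) N \<and> \<zero>\<^bsub>W\<^esub> \<in> N"
  interpret V: Module.module complex_ring V using V by (rule LCS.vector_space)
  let ?N = "{x \<in> topspace (topo V). h x \<in> N}"
  have "openin (topo V) ?N" using cont N by (auto intro: openin_continuous_map_preimage)
  moreover have "\<zero>\<^bsub>V\<^esub> \<in> ?N"
    using N linear_map_zero[OF LCS.vector_space[OF V] LCS.vector_space[OF W] lin] LCS.topspace_topo[OF V] by simp
  ultimately obtain r where r: "r > 0" "\<forall>t\<ge>r. B \<subseteq> (\<lambda>y. complex_of_real t \<odot>\<^bsub>V\<^esub> y) ` ?N"
    using B unfolding bounded_in_def by metis
  have "h ` B \<subseteq> (\<lambda>y. complex_of_real t \<odot>\<^bsub>W\<^esub> y) ` N" if "t \<ge> r" for t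
  proof
    fix y assume "y \<in> h ` B"
    then obtain x where "x \<in> B" "y = h x" by blast
    moreover have "B \<subseteq> (\<lambda>y. complex_of_real t \<odot>\<^bsub>V\<^esub> y) ` ?N" using r(2) that by blast
    ultimately obtain z where "z \<in> ?N" "y = h (complex_of_real t \<odot>\<^bsub>V\<^esub> z)" by blast
    then show "y \<in> (\<lambda>y. complex_of_real t \<odot>\<^bsub>W\<^esub> y) ` N"
      using lin LCS.topspace_topo[OF V] by (auto simp: linear_map_def)
  qed
  with r(1) show "\<exists>r>0. \<forall>t\<ge>r. h ` B \<subseteq> (\<lambda>y. complex_of_real t \<odot>\<^bsub>W\<^esub> y) ` N" by blast
qed

text \<open>That the defining predicate is a topology rests on finite unions of bounded sets being
  bounded, which settles the intersection of two open sets.\<close>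

lemma openin_strong_topology:
  "openin (strong_topology V E L) W \<longleftrightarrow> W \<subseteq> L \<and>
    (\<forall>\<eta>\<in>W. \<exists>B N. bounded_in V B \<and> openin (topo E) N \<and> \<zero>\<^bsub>E\<^esub> \<in> N \<and>
      {\<zeta> \<in> L. \<forall>x\<in>B. \<zeta> x \<ominus>\<^bsub>E\<^esub> \<eta> x \<in> N} \<subseteq> W)"
proof -
  define P where "P W \<eta> \<longleftrightarrow> (\<exists>B N. bounded_in V B \<and> openin (topo E) N \<and> \<zero>\<^bsub>E\<^esub> \<in> N \<and>
      {\<zeta> \<in> L. \<forall>x\<in>B. \<zeta> x \<ominus>\<^bsub>E\<^esub> \<eta> x \<in> N} \<subseteq> W)" for W \<eta>
  have mono: "P T \<eta>" if "P S \<eta>" "S \<subseteq> T" for S T \<eta>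
    using that unfolding P_def by (meson order_trans)
  have Int: "P (S \<inter> T) \<eta>" if S: "P S \<eta>" and T: "P T \<eta>" for S T \<eta>
  proof -
    obtain B N where 1: "bounded_in V B" "openin (topo E) N" "\<zero>\<^bsub>E\<^esub> \<in> N"
      "{\<zeta> \<in> L. \<forall>x\<in>B. \<zeta> x \<ominus>\<^bsub>E\<^esub> \<eta> x \<in> N} \<subseteq> S" using S unfolding P_def by blast
    obtain B' N' where 2: "bounded_in V B'" "openin (topo E) N'" "\<zero>\<^bsub>E\<^esub> \<in> N'"
      "{\<zeta> \<in> L. \<forall>x\<in>B'. \<zeta> x \<ominus>\<^bsub>E\<^esub> \<eta> x \<in> N'} \<subseteq> T" using T unfolding P_def by blast
    have "{\<zeta> \<in> L. \<forall>x\<in>B \<union> B'. \<zeta> x \<ominus>\<^bsub>E\<^esub> \<eta> x \<in> N \<inter> N'} \<subseteq> S \<inter> T"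
      using 1(4) 2(4) by blast
    with 1 2 show ?thesis unfolding P_def
      by (intro exI[of _ "B \<union> B'"] exI[of _ "N \<inter> N'"]) (simp add: bounded_in_Un openin_Int)
  qed
  have "istopology (\<lambda>W. W \<subseteq> L \<and> (\<forall>\<eta>\<in>W. P W \<eta>))"
    unfolding istopology_def
  proof (intro conjI allI impI ballI)
    fix S T \<eta>
    assume "S \<subseteq> L \<and> (\<forall>\<eta>\<in>S. P S \<eta>)" "T \<subseteq> L \<and> (\<forall>\<eta>\<in>T. P T \<eta>)"
    then show "S \<inter> T \<subseteq> L" and "\<eta> \<in> S \<inter> T \<Longrightarrow> P (S \<inter> T) \<eta>"
      using Int by auto
  next
    fix \<K> \<eta>
    assume *: "\<forall>K\<in>\<K>. K \<subseteq> L \<and> (\<forall>\<eta>\<in>K. P K \<eta>)"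
    then show "\<Union>\<K> \<subseteq> L" by auto
    assume "\<eta> \<in> \<Union>\<K>"
    then obtain K where "K \<in> \<K>" "\<eta> \<in> K" by (rule UnionE)
    with * show "P (\<Union>\<K>) \<eta>" by (metis Union_upper mono)
  qed
  then show ?thesis
    unfolding strong_topology_def P_def by (simp only: topology_inverse')
qed

lemma L_b_simps [simp]:
  "carrier (L_b V E) = {\<eta> \<in> extensional (carrier V). continuous_linear_map V E \<eta>}"
  "zero (L_b V E) = (\<lambda>x\<in>carrier V. \<zero>\<^bsub>E\<^esub>)"
  "add (L_b V E) = (\<lambda>\<eta> \<zeta>. \<lambda>x\<in>carrier V. \<eta> x \<oplus>\<^bsub>E\<^esub> \<zeta> x)"
  "smult (L_b V E) = (\<lambda>c \<eta>. \<lambda>x\<in>carrier V. c \<odot>\<^bsub>E\<^esub> \<eta> x)"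
  "topo (L_b V E) = strong_topology V E (carrier (L_b V E))"
  by (simp_all add: L_b_def)

lemma continuous_linear_map_sum:
  assumes V: "LCS V" and E: "LCS E" and "continuous_linear_map V E h" "continuous_linear_map V E k"
  shows "continuous_linear_map V E (\<lambda>x\<in>carrier V. h x \<oplus>\<^bsub>E\<^esub> k x)"
proof -
  interpret V: Module.module complex_ring V using V by (rule LCS.vector_space)
  interpret E: Module.module complex_ring E using E by (rule LCS.vector_space)
  have "continuous_map (topo V) (topo E) (\<lambda>x\<in>carrier V. h x \<oplus>\<^bsub>E\<^esub> k x)"
    using LCS.continuous_map_plus[OF E, of "topo V" h k] assms(3,4)
    by (simp add: continuous_linear_map_def continuous_map_eq LCS.topspace_topo[OF V])
  moreover have "linear_map V E h" "linear_map V E k"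
    using assms by (auto simp: continuous_linear_map_def)
  ultimately show ?thesis
    using V.smult_closed E.smult_r_distr
    by (auto simp: continuous_linear_map_def linear_map_def E.M.a_ac)
qed

lemma continuous_linear_map_scale:
  assumes V: "LCS V" and E: "LCS E" and "continuous_linear_map V E h"
  shows "continuous_linear_map V E (\<lambda>x\<in>carrier V. c \<odot>\<^bsub>E\<^esub> h x)"
proof -
  interpret V: Module.module complex_ring V using V by (rule LCS.vector_space)
  interpret E: Module.module complex_ring E using E by (rule LCS.vector_space)
  have "continuous_map (topo V) (topo E) (\<lambda>x\<in>carrier V. c \<odot>\<^bsub>E\<^esub> h x)"
    using LCS.continuous_map_scale[OF E, of "topo V" h] assms(3)
    by (simp add: continuous_linear_map_def continuous_map_eq LCS.topspace_topo[OF V])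
  moreover have "linear_map V E h"
    using assms by (auto simp: continuous_linear_map_def)
  moreover have "c \<odot>\<^bsub>E\<^esub> (d \<odot>\<^bsub>E\<^esub> x) = d \<odot>\<^bsub>E\<^esub> (c \<odot>\<^bsub>E\<^esub> x)" if "x \<in> carrier E" for d x
    using that E.smult_assoc1[of c d x] E.smult_assoc1[of d c x] by (simp add: mult.commute)
  ultimately show ?thesis
    using V.smult_closed E.smult_closed E.smult_r_distr
    by (auto simp: continuous_linear_map_def linear_map_def)
qed

lemma continuous_linear_map_zero:
  assumes V: "LCS V" and E: "LCS E"
  shows "continuous_linear_map V E (\<lambda>x\<in>carrier V. \<zero>\<^bsub>E\<^esub>)"
proof -
  interpret V: Module.module complex_ring V using V by (rule LCS.vector_space)
  interpret E: Module.module complex_ring E using E by (rule LCS.vector_space)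
  have "continuous_map (topo V) (topo E) (\<lambda>x\<in>carrier V. \<zero>\<^bsub>E\<^esub>)"
    by (rule continuous_map_eq[of _ _ "\<lambda>x. \<zero>\<^bsub>E\<^esub>"])
      (simp_all add: LCS.topspace_topo[OF V] LCS.topspace_topo[OF E])
  then show ?thesis
    using V.smult_closed E.smult_r_null
    by (auto simp: continuous_linear_map_def linear_map_def)
qed

lemma module_L_b:
  assumes V: "LCS V" and E: "LCS E"
  shows "Module.module complex_ring (L_b V E)"
proof -
  interpret V: Module.module complex_ring V using V by (rule LCS.vector_space)
  interpret E: Module.module complex_ring E using E by (rule LCS.vector_space)
  have closed: "h x \<in> carrier E" if "continuous_linear_map V E h" "x \<in> carrier V" for h x
    using that by (simp add: continuous_linear_map_def linear_map_def)
  have smult_closed: "c \<odot>\<^bsub>E\<^esub> x \<in> carrier E" if "x \<in> carrier E" for c x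
    using that E.smult_closed by simp
  have eqI: "f = g" if "f \<in> extensional (carrier V)" "g \<in> extensional (carrier V)"
    "\<And>x. x \<in> carrier V \<Longrightarrow> f x = g x" for f g :: "'a \<Rightarrow> 'c"
    using that by (rule extensionalityI)
  show ?thesis
  proof (rule moduleI, goal_cases)
    case 1 then show ?case by (rule V.R.is_cring)
  next
    case 2
    show ?case
    proof (rule abelian_groupI, goal_cases)
      case (6 h)
      then have "continuous_linear_map V E (\<lambda>x\<in>carrier V. (- 1) \<odot>\<^bsub>E\<^esub> h x)"
        using continuous_linear_map_scale[OF V E] by simp
      moreover have "(- 1) \<odot>\<^bsub>E\<^esub> x \<oplus>\<^bsub>E\<^esub> x = \<zero>\<^bsub>E\<^esub>" if "x \<in> carrier E" for x
        using complex_module_neg[OF E.module_axioms that] that by (simp flip: E.M.l_neg)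
      ultimately show ?case using 6
        by (intro bexI[of _ "\<lambda>x\<in>carrier V. (- 1) \<odot>\<^bsub>E\<^esub> h x"]) (auto simp: closed intro!: restrict_ext)
    qed (auto simp: closed E.M.a_ac continuous_linear_map_sum[OF V E] continuous_linear_map_zero[OF V E]
        intro!: restrict_ext eqI)
  qed (use E.smult_l_distr E.smult_r_distr E.smult_assoc1 E.smult_one in
      \<open>auto simp: closed smult_closed continuous_linear_map_scale[OF V E] intro!: restrict_ext eqI\<close>)
qed

lemma L_b_minus:
  assumes V: "LCS V" and E: "LCS E" and "\<eta> \<in> carrier (L_b V E)" "\<zeta> \<in> carrier (L_b V E)" "x \<in> carrier V"
  shows "(\<eta> \<ominus>\<^bsub>L_b V E\<^esub> \<zeta>) x = \<eta> x \<ominus>\<^bsub>E\<^esub> \<zeta> x"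
  using assms complex_module_neg[OF module_L_b[OF V E], of \<zeta>]
    complex_module_neg[OF LCS.vector_space[OF E], of "\<zeta> x"]
  by (simp add: a_minus_def continuous_linear_map_def linear_map_def)

text \<open>The sets \<open>U B N\<close> form a base at zero, and most of their properties are
  inherited pointwise from \<open>E\<close>. Absorbing a single \<open>\<eta>\<close> is different:
  there \<open>\<eta>\<close> has to be continuous and \<open>B\<close> bounded, so that the image
  of \<open>B\<close> under \<open>\<eta>\<close> is bounded and lies in \<open>r\<close> times a
  small neighbourhood.\<close>

lemma LCS_L_b:
  fixes V :: "('v, 'y) tvs_scheme" and E :: "('w, 'z) tvs_scheme"
  assumes V: "LCS V" and E: "LCS E"
  shows "LCS (L_b V E)"
proof -
  interpret V: LCS V by fact
  interpret E: LCS E by fact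
  interpret VM: Module.module complex_ring V by (rule V.vector_space)
  interpret EM: Module.module complex_ring E by (rule E.vector_space)
  define L where "L = carrier (L_b V E)"
  define U where "U B N = {\<zeta> \<in> L. \<forall>x\<in>B. \<zeta> x \<in> N}" for B N
  define \<B> where "\<B> = {U B N | B N. bounded_in V B \<and> openin (topo E) N \<and> \<zero>\<^bsub>E\<^esub> \<in> N}"
  have UI: "U B N \<in> \<B>" if "bounded_in V B" "openin (topo E) N" "\<zero>\<^bsub>E\<^esub> \<in> N" for B N
    using that unfolding \<B>_def by blast
  have lin: "linear_map V E \<eta>" and cont: "continuous_map (topo V) (topo E) \<eta>" if "\<eta> \<in> L" for \<eta>
    using that by (auto simp: L_def continuous_linear_map_def)
  have B_sub: "x \<in> carrier V" if "bounded_in V B" "x \<in> B" for B x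
    using that by (auto simp: bounded_in_def)
  have scale0: "\<exists>\<delta>>0. \<exists>N1. openin (topo E) N1 \<and> \<zero>\<^bsub>E\<^esub> \<in> N1 \<and>
      (\<forall>d. cmod d < \<delta> \<longrightarrow> (\<forall>y\<in>N1. d \<odot>\<^bsub>E\<^esub> y \<in> N))" if "openin (topo E) N" "\<zero>\<^bsub>E\<^esub> \<in> N" for N
    using E.smult_nhd[of "\<zero>\<^bsub>E\<^esub>" N 0] that EM.smult_r_null[of 0] by simp
  have add_L: "\<eta> \<oplus>\<^bsub>L_b V E\<^esub> \<zeta> \<in> L" if "\<eta> \<in> L" "\<zeta> \<in> L" for \<eta> \<zeta>
    using that continuous_linear_map_sum[OF V E] by (simp add: L_def)
  have smult_L: "c \<odot>\<^bsub>L_b V E\<^esub> \<eta> \<in> L" if "\<eta> \<in> L" for c \<eta>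
    using that continuous_linear_map_scale[OF V E] by (simp add: L_def)
  show ?thesis
  proof (rule LCS_of_base[where \<B> = \<B>])
    show "Module.module complex_ring (L_b V E)" by (rule module_L_b[OF V E])
    show "openin (topo (L_b V E)) W \<longleftrightarrow> W \<subseteq> carrier (L_b V E) \<and>
        (\<forall>x\<in>W. \<exists>U\<in>\<B>. {y \<in> carrier (L_b V E). y \<ominus>\<^bsub>L_b V E\<^esub> x \<in> U} \<subseteq> W)" for W
    proof -
      interpret LM: Module.module complex_ring "L_b V E" by (rule module_L_b[OF V E])
      have eq: "{\<zeta> \<in> L. \<forall>x\<in>B. \<zeta> x \<ominus>\<^bsub>E\<^esub> \<eta> x \<in> N} = {\<zeta> \<in> L. \<zeta> \<ominus>\<^bsub>L_b V E\<^esub> \<eta> \<in> U B N}"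
        if "\<eta> \<in> L" "bounded_in V B" for \<eta> B N
        using that LM.M.minus_closed[of _ \<eta>]
        by (auto simp del: L_b_simps simp: U_def L_def L_b_minus[OF V E] B_sub)
      have "topo (L_b V E) = strong_topology V E L" by (simp add: L_def)
      then have "openin (topo (L_b V E)) W \<longleftrightarrow> W \<subseteq> L \<and>
        (\<forall>\<eta>\<in>W. \<exists>B N. bounded_in V B \<and> openin (topo E) N \<and> \<zero>\<^bsub>E\<^esub> \<in> N \<and>
          {\<zeta> \<in> L. \<forall>x\<in>B. \<zeta> x \<ominus>\<^bsub>E\<^esub> \<eta> x \<in> N} \<subseteq> W)"
        by (simp only: openin_strong_topology)
      also have "\<dots> \<longleftrightarrow> W \<subseteq> L \<and> (\<forall>\<eta>\<in>W. \<exists>B N. bounded_in V B \<and> openin (topo E) N \<and> \<zero>\<^bsub>E\<^esub> \<in> N \<and>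
          {\<zeta> \<in> L. \<zeta> \<ominus>\<^bsub>L_b V E\<^esub> \<eta> \<in> U B N} \<subseteq> W)"
        by (intro conj_cong ball_cong ex_cong1 refl arg_cong2[of _ _ W W "(\<subseteq>)"] eq)
          (assumption | erule subsetD)+
      finally show ?thesis unfolding L_def[symmetric] \<B>_def by blast
    qed
    have "bounded_in V {}" by (auto simp: bounded_in_def intro: exI[of _ 1])
    moreover have "openin (topo E) (carrier E)" using openin_topspace[of "topo E"] E.topspace_topo by simp
    ultimately show "\<B> \<noteq> {}" using UI[of "{}" "carrier E"] by auto
  next
    fix S T assume "S \<in> \<B>" "T \<in> \<B>"
    then obtain B N B' N' where "bounded_in V B" "openin (topo E) N" "\<zero>\<^bsub>E\<^esub> \<in> N" "S = U B N"
      "bounded_in V B'" "openin (topo E) N'" "\<zero>\<^bsub>E\<^esub> \<in> N'" "T = U B' N'"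
      unfolding \<B>_def by blast
    then show "\<exists>W\<in>\<B>. W \<subseteq> S \<inter> T"
      by (intro bexI[of _ "U (B \<union> B') (N \<inter> N')"] UI) (auto simp: U_def bounded_in_Un)
  next
    fix S assume "S \<in> \<B>"
    then obtain B N where S: "bounded_in V B" "openin (topo E) N" "\<zero>\<^bsub>E\<^esub> \<in> N" "S = U B N"
      unfolding \<B>_def by blast
    show "S \<subseteq> carrier (L_b V E)" by (auto simp: S U_def L_def)
    show "\<zero>\<^bsub>L_b V E\<^esub> \<in> S"
      using S continuous_linear_map_zero[OF V E] by (auto simp: U_def L_def B_sub)
    show "\<exists>W\<in>\<B>. \<forall>x\<in>W. \<forall>y\<in>W. x \<oplus>\<^bsub>L_b V E\<^esub> y \<in> S"
    proof -
      obtain N1 N2 where N12: "openin (topo E) N1" "openin (topo E) N2" "\<zero>\<^bsub>E\<^esub> \<in> N1" "\<zero>\<^bsub>E\<^esub> \<in> N2"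
        "\<forall>a\<in>N1. \<forall>b\<in>N2. a \<oplus>\<^bsub>E\<^esub> b \<in> N"
        using E.add_nhd[of "\<zero>\<^bsub>E\<^esub>" "\<zero>\<^bsub>E\<^esub>" N] S by auto
      have "x \<oplus>\<^bsub>L_b V E\<^esub> y \<in> S" if "x \<in> U B (N1 \<inter> N2)" "y \<in> U B (N1 \<inter> N2)" for x y
        using that N12 add_L[of x y] S B_sub by (auto simp: U_def)
      with S N12 show ?thesis by (intro bexI[of _ "U B (N1 \<inter> N2)"] UI) auto
    qed
    show "\<exists>W\<in>\<B>. \<exists>\<delta>>0. \<forall>c. cmod c < \<delta> \<longrightarrow> (\<forall>x\<in>W. c \<odot>\<^bsub>L_b V E\<^esub> x \<in> S)"
    proof -
      obtain \<delta> N1 where N1: "\<delta> > 0" "openin (topo E) N1" "\<zero>\<^bsub>E\<^esub> \<in> N1"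
        "\<forall>d. cmod d < \<delta> \<longrightarrow> (\<forall>y\<in>N1. d \<odot>\<^bsub>E\<^esub> y \<in> N)" using scale0 S by metis
      have "c \<odot>\<^bsub>L_b V E\<^esub> x \<in> S" if "cmod c < \<delta>" "x \<in> U B N1" for c x
        using that N1 smult_L[of x c] S B_sub by (auto simp: U_def)
      with S N1 show ?thesis by (intro bexI[of _ "U B N1"] UI exI[of _ \<delta>]) auto
    qed
    show "\<exists>W\<in>\<B>. \<forall>x\<in>W. c \<odot>\<^bsub>L_b V E\<^esub> x \<in> S" for c
    proof -
      obtain N1 where N1: "openin (topo E) N1" "\<zero>\<^bsub>E\<^esub> \<in> N1" "\<forall>y\<in>N1. c \<odot>\<^bsub>E\<^esub> y \<in> N"
        using E.smult_nhd[of "\<zero>\<^bsub>E\<^esub>" N c] S EM.smult_r_null[of c] by fastforce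
      have "c \<odot>\<^bsub>L_b V E\<^esub> x \<in> S" if "x \<in> U B N1" for x
        using that N1 smult_L[of x c] S B_sub by (auto simp: U_def)
      with S N1 show ?thesis by (intro bexI[of _ "U B N1"] UI) auto
    qed
    show "\<exists>\<delta>>0. \<forall>c. cmod c < \<delta> \<longrightarrow> c \<odot>\<^bsub>L_b V E\<^esub> \<eta> \<in> S" if "\<eta> \<in> carrier (L_b V E)" for \<eta>
    proof -
      have \<eta>: "\<eta> \<in> L" using that by (simp add: L_def)
      obtain \<delta> N1 where N1: "\<delta> > 0" "openin (topo E) N1" "\<zero>\<^bsub>E\<^esub> \<in> N1"
        "\<forall>d. cmod d < \<delta> \<longrightarrow> (\<forall>y\<in>N1. d \<odot>\<^bsub>E\<^esub> y \<in> N)" using scale0 S by metis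
      have "\<exists>r>0. \<forall>t\<ge>r. \<eta> ` B \<subseteq> (\<lambda>y. complex_of_real t \<odot>\<^bsub>E\<^esub> y) ` N1"
        using bounded_in_image[OF V E _ S(1), of \<eta>] N1 \<eta> lin cont
        unfolding bounded_in_def[of E] continuous_linear_map_def by blast
      then obtain r where r: "r > 0" "\<eta> ` B \<subseteq> (\<lambda>y. complex_of_real r \<odot>\<^bsub>E\<^esub> y) ` N1" by auto
      have "c \<odot>\<^bsub>L_b V E\<^esub> \<eta> \<in> S" if c: "cmod c < \<delta> / r" for c
      proof -
        have "c \<odot>\<^bsub>E\<^esub> \<eta> x \<in> N" if x: "x \<in> B" for x
        proof -
          obtain y where y: "y \<in> N1" "\<eta> x = complex_of_real r \<odot>\<^bsub>E\<^esub> y"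
            using subsetD[OF r(2) imageI[OF x]] by auto
          then have "y \<in> carrier E" using openin_subset[OF N1(2)] E.topspace_topo by auto
          then have "c \<odot>\<^bsub>E\<^esub> \<eta> x = (c * complex_of_real r) \<odot>\<^bsub>E\<^esub> y"
            using EM.smult_assoc1[of c "complex_of_real r" y] y by simp
          moreover have "cmod (c * complex_of_real r) < \<delta>"
            using c r by (simp add: norm_mult pos_less_divide_eq)
          ultimately show ?thesis using N1(4) y(1) by simp
        qed
        then show ?thesis using smult_L[OF \<eta>, of c] B_sub[OF S(1)] by (simp add: U_def S(4))
      qed
      moreover have "\<delta> / r > 0" using r(1) N1(1) by simp
      ultimately show ?thesis by blast
    qed
    show "\<exists>W\<in>\<B>. W \<subseteq> S \<and> convex_in (L_b V E) W"
    proof -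
      obtain C where C: "openin (topo E) C" "\<zero>\<^bsub>E\<^esub> \<in> C" "C \<subseteq> N" "convex_in E C"
        using E.locally_convex S by metis
      have "convex_in (L_b V E) (U B C)"
      proof (intro ballI)
        fix \<eta> \<zeta> and t :: real assume *: "\<eta> \<in> U B C" "\<zeta> \<in> U B C" "t \<in> {0..1}"
        then have "complex_of_real t \<odot>\<^bsub>L_b V E\<^esub> \<eta> \<oplus>\<^bsub>L_b V E\<^esub> complex_of_real (1 - t) \<odot>\<^bsub>L_b V E\<^esub> \<zeta> \<in> L"
          by (intro add_L smult_L) (auto simp: U_def)
        with * C(4) S(1) B_sub
        show "complex_of_real t \<odot>\<^bsub>L_b V E\<^esub> \<eta> \<oplus>\<^bsub>L_b V E\<^esub> complex_of_real (1 - t) \<odot>\<^bsub>L_b V E\<^esub> \<zeta> \<in> U B C"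
          unfolding U_def by simp
      qed
      moreover have "U B C \<subseteq> S" using C by (auto simp: U_def S)
      ultimately show ?thesis using UI[OF S(1) C(1,2)] by blast
    qed
  qed
qed

lemma continuous_linear_map_compose:
  assumes "continuous_linear_map V W h" "continuous_linear_map W E k"
  shows "continuous_linear_map V E (k \<circ> h)"
  using assms continuous_map_compose by (fastforce simp: continuous_linear_map_def linear_map_def)

lemma continuous_linear_map_restrict:
  assumes "LCS V" "continuous_linear_map V W h"
  shows "continuous_linear_map V W (restrict h (carrier V))"
proof -
  interpret V: Module.module complex_ring V using assms(1) by (rule LCS.vector_space)
  show ?thesis
    using assms(2) V.smult_closed
    by (auto simp: continuous_linear_map_def linear_map_def LCS.topspace_topo[OF assms(1)]
        intro: continuous_map_eq)
qed

text \<open>Continuous linear maps preserve bounded sets, so the neighbourhood given by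
  \<open>B\<close> and \<open>N\<close> contains the image of the one given by \<open>h\<close>
  applied to \<open>B\<close> and the same \<open>N\<close>. With an extension by zero as
  \<open>h\<close>, this is the restriction map of the presheaf.\<close>

lemma L_b_precompose:
  assumes V: "LCS V" and W: "LCS W" and E: "LCS E" and h: "continuous_linear_map V W h"
  shows "continuous_linear_map (L_b W E) (L_b V E) (\<lambda>\<eta>. \<lambda>x\<in>carrier V. \<eta> (h x))"
    (is "continuous_linear_map _ _ ?H")
proof -
  have closed: "?H \<eta> \<in> carrier (L_b V E)" if "\<eta> \<in> carrier (L_b W E)" for \<eta>
    using continuous_linear_map_restrict[OF V continuous_linear_map_compose[OF h, of E \<eta>]] that
    by (simp add: comp_def)
  have hx: "h x \<in> carrier W" if "x \<in> carrier V" for x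
    using h that by (simp add: continuous_linear_map_def linear_map_def)
  have "linear_map (L_b W E) (L_b V E) ?H"
    using closed hx by (auto simp: linear_map_def intro!: restrict_ext)
  moreover have "continuous_map (topo (L_b W E)) (topo (L_b V E)) ?H"
    unfolding continuous_map_def
  proof (intro conjI allI impI)
    show "?H \<in> topspace (topo (L_b W E)) \<rightarrow> topspace (topo (L_b V E))"
      using closed unfolding LCS.topspace_topo[OF LCS_L_b[OF W E]] LCS.topspace_topo[OF LCS_L_b[OF V E]] by blast
    fix U assume U: "openin (topo (L_b V E)) U"
    show "openin (topo (L_b W E)) {\<eta> \<in> topspace (topo (L_b W E)). ?H \<eta> \<in> U}"
      unfolding LCS.topspace_topo[OF LCS_L_b[OF W E]]
      unfolding L_b_simps(5) openin_strong_topology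
    proof (intro conjI ballI)
      fix \<eta> assume "\<eta> \<in> {\<eta> \<in> carrier (L_b W E). ?H \<eta> \<in> U}"
      then obtain B N where B: "bounded_in V B" "openin (topo E) N" "\<zero>\<^bsub>E\<^esub> \<in> N"
        "{\<zeta> \<in> carrier (L_b V E). \<forall>x\<in>B. \<zeta> x \<ominus>\<^bsub>E\<^esub> ?H \<eta> x \<in> N} \<subseteq> U"
        using U unfolding L_b_simps(5) openin_strong_topology by blast
      have "{\<zeta> \<in> carrier (L_b W E). \<forall>x\<in>h ` B. \<zeta> x \<ominus>\<^bsub>E\<^esub> \<eta> x \<in> N} \<subseteq> {\<eta> \<in> carrier (L_b W E). ?H \<eta> \<in> U}"
      proof
        fix \<zeta> assume \<zeta>: "\<zeta> \<in> {\<zeta> \<in> carrier (L_b W E). \<forall>x\<in>h ` B. \<zeta> x \<ominus>\<^bsub>E\<^esub> \<eta> x \<in> N}"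
        have "\<forall>x\<in>B. ?H \<zeta> x \<ominus>\<^bsub>E\<^esub> ?H \<eta> x \<in> N"
          using \<zeta> B(1) by (auto simp: bounded_in_def)
        then have "?H \<zeta> \<in> U" using B(4) closed[of \<zeta>] \<zeta> by blast
        with \<zeta> show "\<zeta> \<in> {\<eta> \<in> carrier (L_b W E). ?H \<eta> \<in> U}" by blast
      qed
      with B bounded_in_image[OF V W h B(1)]
      show "\<exists>B N. bounded_in W B \<and> openin (topo E) N \<and> \<zero>\<^bsub>E\<^esub> \<in> N \<and>
          {\<zeta> \<in> carrier (L_b W E). \<forall>x\<in>B. \<zeta> x \<ominus>\<^bsub>E\<^esub> \<eta> x \<in> N} \<subseteq> {\<eta> \<in> carrier (L_b W E). ?H \<eta> \<in> U}"
        by blast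
    qed blast
  qed
  ultimately show ?thesis by (simp add: continuous_linear_map_def)
qed

section \<open>Bump functions\<close>

primrec differentiable_upto :: "nat \<Rightarrow> (real \<Rightarrow> real) \<Rightarrow> bool"
  where
    "differentiable_upto 0 f \<longleftrightarrow> True"
  | "differentiable_upto (Suc k) f \<longleftrightarrow>
      (\<exists>g. (\<forall>x. (f has_real_derivative g x) (at x)) \<and> differentiable_upto k g)"

lemma differentiable_upto_SucD: "differentiable_upto (Suc k) f \<Longrightarrow> differentiable_upto k f"
  by (induction k arbitrary: f) (simp, metis differentiable_upto.simps(2))

lemma differentiable_upto_const: "differentiable_upto k (\<lambda>x. c)"
  by (induction k arbitrary: c) (auto intro!: exI[of _ "\<lambda>x. 0"])

lemma differentiable_upto_add:
  "\<lbrakk>differentiable_upto k f; differentiable_upto k g\<rbrakk> \<Longrightarrow> differentiable_upto k (\<lambda>x. f x + g x)"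
proof (induction k arbitrary: f g)
  case (Suc k)
  then obtain f' g' where "\<forall>x. (f has_real_derivative f' x) (at x)" "differentiable_upto k f'"
    "\<forall>x. (g has_real_derivative g' x) (at x)" "differentiable_upto k g'" by auto
  with Suc.IH show ?case
    by (auto intro!: exI[of _ "\<lambda>x. f' x + g' x"] DERIV_add)
qed simp

lemma differentiable_upto_mult:
  "\<lbrakk>differentiable_upto k f; differentiable_upto k g\<rbrakk> \<Longrightarrow> differentiable_upto k (\<lambda>x. f x * g x)"
proof (induction k arbitrary: f g)
  case (Suc k)
  then obtain f' g' where *: "\<forall>x. (f has_real_derivative f' x) (at x)" "differentiable_upto k f'"
    "\<forall>x. (g has_real_derivative g' x) (at x)" "differentiable_upto k g'" by auto
  have "differentiable_upto k (\<lambda>x. f' x * g x + g' x * f x)"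
    using * Suc.prems[THEN differentiable_upto_SucD] by (intro differentiable_upto_add Suc.IH)
  with * show ?case
    by (auto intro!: exI[of _ "\<lambda>x. f' x * g x + g' x * f x"] DERIV_mult)
qed simp

lemma differentiable_upto_inverse:
  "\<lbrakk>differentiable_upto k f; \<And>x. f x \<noteq> 0\<rbrakk> \<Longrightarrow> differentiable_upto k (\<lambda>x. inverse (f x))"
proof (induction k arbitrary: f)
  case (Suc k)
  then obtain f' where *: "\<forall>x. (f has_real_derivative f' x) (at x)" "differentiable_upto k f'" by auto
  have "differentiable_upto k (\<lambda>x. inverse (f x))"
    using Suc.prems(1)[THEN differentiable_upto_SucD] Suc.prems(2) by (rule Suc.IH)
  note inv = this
  have "differentiable_upto k (\<lambda>x. (- 1) * (inverse (f x) * f' x * inverse (f x)))"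
    by (rule differentiable_upto_mult[OF differentiable_upto_const
          differentiable_upto_mult[OF differentiable_upto_mult[OF inv *(2)] inv]])
  with * Suc.prems(2) show ?case
    by (auto intro!: exI[of _ "\<lambda>x. - (inverse (f x) * f' x * inverse (f x))"] DERIV_inverse')
qed simp

lemma differentiable_upto_affine:
  "differentiable_upto k f \<Longrightarrow> differentiable_upto k (\<lambda>x. f (a * x + b))"
proof (induction k arbitrary: f)
  case (Suc k)
  then obtain f' where *: "\<And>x. (f has_real_derivative f' x) (at x)" "differentiable_upto k f'" by auto
  have "((\<lambda>x. f (a * x + b)) has_real_derivative f' (a * x + b) * a) (at x)" for x
    by (rule DERIV_chain2[where f = f]) (auto intro!: derivative_eq_intros *)
  moreover have "differentiable_upto k (\<lambda>x. f' (a * x + b) * a)"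
    by (rule differentiable_upto_mult[OF Suc.IH[OF *(2)] differentiable_upto_const])
  ultimately show ?case by (auto intro!: exI[of _ "\<lambda>x. f' (a * x + b) * a"])
qed simp

text \<open>The classical function exp(-1/x), extended by zero, with a polynomial in 1/x as an extra
  factor. The factor makes the family closed under differentiation, so smoothness follows by
  induction on the order.\<close>

definition flat :: "real poly \<Rightarrow> real \<Rightarrow> real"
  where "flat p x = (if x > 0 then poly p (1 / x) * exp (- (1 / x)) else 0)"

text \<open>The power \<open>y ^ k\<close> is there for the induction on coefficients: it absorbs
  the factor \<open>y\<close> in front of the tail of the polynomial.\<close>

lemma poly_times_exp_tendsto_0:
  "((\<lambda>y. y ^ k * poly p y * exp (- y)) \<longlongrightarrow> 0) at_top" for p :: "real poly"
proof (induction p arbitrary: k)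
  case (pCons a p)
  have "((\<lambda>y. y ^ k / exp y :: real) \<longlongrightarrow> 0) at_top"
    by (rule tendsto_power_div_exp_0)
  from tendsto_add[OF tendsto_mult_right_zero[OF this, of a] pCons.IH[of "Suc k"]]
  show ?case by (simp add: exp_minus divide_inverse algebra_simps)
qed simp

text \<open>With \<open>y = 1/x\<close> one has \<open>dy/dx = - y^2\<close>, so
  \<open>p(y) exp(- y)\<close> has derivative \<open>y^2 (p - p')(y) exp(- y)\<close>; the
  polynomial \<open>[:0, 0, 1:]\<close> is \<open>y^2\<close>. Only the origin requires a
  limit.\<close>

lemma flat_has_derivative:
  "(flat p has_real_derivative flat ([:0, 0, 1:] * (p - pderiv p)) x) (at x)"
proof -
  consider "x > 0" | "x < 0" | "x = 0" by linarith
  then show ?thesis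
  proof cases
    case 1
    have "((\<lambda>x. 1 / x) has_real_derivative - (1 / x\<^sup>2)) (at x)"
      using 1 by (auto intro!: derivative_eq_intros simp: power2_eq_square)
    note inv = this
    have "((\<lambda>x. poly p (1 / x) * exp (- (1 / x))) has_real_derivative
        (poly (pderiv p) (1 / x) * - (1 / x\<^sup>2)) * exp (- (1 / x)) +
        (exp (- (1 / x)) * - (- (1 / x\<^sup>2))) * poly p (1 / x)) (at x)"
      by (intro DERIV_mult DERIV_chain2[OF poly_DERIV] DERIV_chain2[OF DERIV_exp] DERIV_minus inv)
    then have "((\<lambda>x. poly p (1 / x) * exp (- (1 / x))) has_real_derivative
        flat ([:0, 0, 1:] * (p - pderiv p)) x) (at x)"
      using 1 by (simp add: flat_def power2_eq_square algebra_simps)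
    then show ?thesis
      by (rule has_field_derivative_transform_within_open[of _ _ _ "{0<..}"])
        (use 1 in \<open>auto simp: flat_def\<close>)
  next
    case 2
    have "((\<lambda>x. 0) has_real_derivative flat ([:0, 0, 1:] * (p - pderiv p)) x) (at x)"
      using 2 by (simp add: flat_def)
    then show ?thesis
      by (rule has_field_derivative_transform_within_open[of _ _ _ "{..<0}"])
        (use 2 in \<open>auto simp: flat_def\<close>)
  next
    case 3
    have "((\<lambda>h. flat p h / h) \<longlongrightarrow> 0) (at 0)"
    proof (rule filterlim_split_at)
      show "((\<lambda>h. flat p h / h) \<longlongrightarrow> 0) (at_left 0)"
        by (rule tendsto_eventually) (auto simp: eventually_at_filter flat_def)
      \<comment> \<open>The exponent 1 is the factor \<open>1 / h\<close> of the difference quotient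
        at 0.\<close>
      have "((\<lambda>h. inverse h ^ 1 * poly p (inverse h) * exp (- inverse h)) \<longlongrightarrow> 0) (at_right 0)"
        by (rule filterlim_compose[OF poly_times_exp_tendsto_0 filterlim_inverse_at_top_right])
      then show "((\<lambda>h. flat p h / h) \<longlongrightarrow> 0) (at_right 0)"
        by (rule filterlim_cong[THEN iffD1, rotated -1])
          (auto simp: eventually_at_filter flat_def divide_inverse)
    qed
    then show ?thesis
      using 3 by (simp add: DERIV_def flat_def)
  qed
qed

lemma differentiable_upto_flat: "differentiable_upto k (flat p)"
  by (induction k arbitrary: p) (auto intro!: exI[of _ "flat ([:0, 0, 1:] * (_ - pderiv _))"] flat_has_derivative
    simp del: mult_pCons_left)

lemma smooth_cutoff_exists:
  "\<exists>h. (\<forall>k. differentiable_upto k h) \<and> (\<forall>x. \<bar>x\<bar> \<le> 1 \<longrightarrow> h x = 1) \<and> (\<forall>x. \<bar>x\<bar> \<ge> 2 \<longrightarrow> h x = 0)"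
proof -
  define e where "e = flat 1"
  \<comment> \<open>A smooth step from 0 on \<open>x \<le> 0\<close> to 1 on
    \<open>x \<ge> 1\<close>; the denominator is positive because \<open>x\<close> or
    \<open>1 - x\<close> is. The product of a rising and a falling step is the plateau
    \<open>h\<close>. The arguments are written as \<open>a * x + b\<close> to fit
    \<open>differentiable_upto_affine\<close>.\<close>
  define s where "s x = e x * inverse (e x + e ((- 1) * x + 1))" for x
  define h where "h x = s (1 * x + 2) * s ((- 1) * x + 2)" for x
  have e0: "e x = 0" if "x \<le> 0" for x using that by (simp add: e_def flat_def)
  have e1: "e x > 0" if "x > 0" for x using that by (simp add: e_def flat_def)
  have pos: "e x + e ((- 1) * x + 1) > 0" for x
    using e0[of x] e1[of x] e0[of "1 - x"] e1[of "1 - x"] by (cases "x > 0"; cases "1 - x > 0") auto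
  have e: "differentiable_upto k e" for k
    unfolding e_def by (rule differentiable_upto_flat)
  have "differentiable_upto k s" for k
    unfolding s_def
    by (rule differentiable_upto_mult[OF e differentiable_upto_inverse[OF
          differentiable_upto_add[OF e differentiable_upto_affine[OF e]] less_imp_neq[OF pos, symmetric]]])
  then have "differentiable_upto k h" for k
    unfolding h_def by (blast intro: differentiable_upto_mult[OF differentiable_upto_affine differentiable_upto_affine])
  moreover have "s x = 0" if "x \<le> 0" for x using that e0 by (simp add: s_def)
  moreover have "s x = 1" if "x \<ge> 1" for x
    using that e0[of "1 - x"] e1[of x] by (simp add: s_def)
  ultimately show ?thesis
    by (intro exI[of _ h]) (auto simp: h_def abs_if split: if_splits)
qed

text \<open>Products of functions of one coordinate are closed under partial derivatives: the
  \<open>j\<close>-th one only replaces the factor \<open>g j\<close> by its derivative, so the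
  induction varies \<open>g\<close>. With \<open>c = 0\<close> the same statement covers the
  vanishing higher coefficients of a bump.\<close>

lemma class_C_prod:
  fixes g :: "nat \<Rightarrow> real \<Rightarrow> real"
  assumes "\<And>i k. i < n \<Longrightarrow> differentiable_upto k (g i)"
  defines "R \<equiv> topspace (Euclidean_space n)"
  shows "class_C r n R (\<lambda>x\<in>R. complex_of_real (c * (\<Prod>i<n. g i (x i))))"
proof -
  let ?f = "\<lambda>g. \<lambda>x\<in>R. complex_of_real (c * (\<Prod>i<n. g i (x i)))"
  have class_C_0: "class_C 0 n R (?f g)" if g: "\<And>i. i < n \<Longrightarrow> differentiable_upto (Suc 0) (g i)"
    for g :: "nat \<Rightarrow> real \<Rightarrow> real"
  proof -
    have "continuous_on UNIV (g i)" if "i < n" for i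
      using g[OF that] by (auto intro!: continuous_at_imp_continuous_on dest: DERIV_isCont)
    then have "continuous_on R (\<lambda>x. g i (x i))" if "i < n" for i
      using that by (intro continuous_on_compose2[of UNIV "g i" R "\<lambda>x. x i"])
        (auto intro: continuous_on_subset[OF continuous_on_product_coordinates])
    then have "continuous_on R (\<lambda>x. complex_of_real (c * (\<Prod>i<n. g i (x i))))"
      by (intro continuous_intros) auto
    then have "continuous_on R (?f g)"
      by (simp cong: continuous_on_cong)
    then show ?thesis
      by (simp add: R_def continuous_map_Euclidean_space_iff)
  qed
  show ?thesis
    using assms(1)
  proof (induction r arbitrary: g)
    case 0
    then show ?case by (intro class_C_0)
  next
    case (Suc r)
    have "class_C 0 n R (?f g)"
      using Suc.prems by (intro class_C_0)
    moreover have "\<exists>f'. (\<forall>x\<in>R. ((\<lambda>t. ?f g (x(j := t))) has_vector_derivative f' x) (at (x j))) \<and> class_C r n R f'"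
      if j: "j < n" for j
    proof -
      obtain g' where g': "\<And>x. (g j has_real_derivative g' x) (at x)"
        using Suc.prems[OF j, of "Suc 0"] by auto
      \<comment> \<open>Every order \<open>k\<close> comes with its own derivative of
        \<open>g j\<close>; uniqueness of derivatives identifies them all with
        \<open>g'\<close>.\<close>
      have "differentiable_upto k g'" for k
      proof -
        obtain g'' where "\<And>x. (g j has_real_derivative g'' x) (at x)" "differentiable_upto k g''"
          using Suc.prems[OF j, of "Suc k"] by auto
        moreover from this g' have "g'' = g'" by (intro ext DERIV_unique)
        ultimately show ?thesis by simp
      qed
      then have "class_C r n R (?f (g(j := g')))"
        using Suc.prems by (intro Suc.IH) auto
      moreover have "((\<lambda>t. ?f g (x(j := t))) has_vector_derivative ?f (g(j := g')) x) (at (x j))"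
        if x: "x \<in> R" for x
      proof -
        let ?P = "\<Prod>i\<in>{..<n} - {j}. g i (x i)"
        have "x(j := t) \<in> R" for t
          using x j by (auto simp: R_def topspace_Euclidean_space)
        moreover have "(\<Prod>i<n. (g(j := k)) i ((x(j := t)) i)) = k t * ?P" for k t
          using j by (subst prod.remove[of _ j]) (auto intro!: prod.cong)
        from this[of "g j"] this[of g' "x j"]
        have "(\<Prod>i<n. g i ((x(j := t)) i)) = g j t * ?P"
          "(\<Prod>i<n. (g(j := g')) i (x i)) = g' (x j) * ?P" for t by simp_all
        ultimately have eq: "?f g (x(j := t)) = complex_of_real (c * (g j t * ?P))"
          "?f (g(j := g')) x = complex_of_real (c * (g' (x j) * ?P))" for t
          using x by (simp_all only: restrict_apply')
        have "((\<lambda>t. c * (g j t * ?P)) has_real_derivative c * (g' (x j) * ?P)) (at (x j))"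
          using g'[of "x j"] by (auto intro!: derivative_eq_intros)
        then show ?thesis
          unfolding eq by (rule has_vector_derivative_of_real)
      qed
      ultimately show ?thesis by blast
    qed
    ultimately show ?case unfolding class_C.simps by blast
  qed
qed

text \<open>A neighbourhood of \<open>p\<close> contains a box, and coordinates from
  \<open>n\<close> on vanish on \<open>R\<close>, so a product of \<open>n\<close> plateaus
  suffices. It is placed in the coefficient of the monomial 1, with all other coefficients zero; the
  plateau values 1 and 0 thereby become the unit and the zero of the power series ring.\<close>

lemma euclidean_bump:
  assumes W: "openin (Euclidean_space n) W" and p: "p \<in> W"
  defines "R \<equiv> topspace (Euclidean_space n)"
  shows "\<exists>B N K. B \<in> carrier (sec (euclidean_formal n k) R) \<and>
    openin (Euclidean_space n) N \<and> p \<in> N \<and> compactin (Euclidean_space n) K \<and> K \<subseteq> W \<and>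
    res (euclidean_formal n k) R N B = \<one>\<^bsub>sec (euclidean_formal n k) N\<^esub> \<and>
    res (euclidean_formal n k) R (R - K) B = \<zero>\<^bsub>sec (euclidean_formal n k) (R - K)\<^esub>"
proof -
  obtain O' where O': "openin (powertop_real UNIV) O'" "W = O' \<inter> {x. \<forall>i\<ge>n. x i = 0}"
    using W unfolding Euclidean_space_def openin_subtopology by blast
  have pR: "p \<in> R" using openin_subset[OF W] p by (auto simp: R_def)
  obtain A where A: "p \<in> (\<Pi>\<^sub>E i\<in>UNIV. A i)" "\<And>i. open (A i)" "(\<Pi>\<^sub>E i\<in>UNIV. A i) \<subseteq> O'"
    using product_topology_open_contains_basis[OF O'(1), of p] p O'(2) by auto
  have "\<exists>d>0. cball (p i) d \<subseteq> A i" for i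
    using A(1,2) open_contains_cball_eq by (metis PiE_mem UNIV_I)
  then obtain d where d: "\<And>i. d i > 0" "\<And>i. cball (p i) (d i) \<subseteq> A i" by metis
  \<comment> \<open>The bump falls from 1 to 0 between the distances \<open>\<delta>\<close> and
    \<open>2 * \<delta>\<close>, so the box of radius \<open>2 * \<delta>\<close> has to fit into
    all \<open>A i\<close> with \<open>i < n\<close>. Inserting 1 keeps the minimum meaningful for
    \<open>n = 0\<close>.\<close>
  define \<delta> where "\<delta> = Min (insert 1 (d ` {..<n})) / 2"
  have \<delta>: "\<delta> > 0" using d(1) by (auto simp: \<delta>_def)
  have \<delta>_le: "2 * \<delta> \<le> d i" if "i < n" for i using that by (simp add: \<delta>_def)
  obtain h where h: "\<And>k. differentiable_upto k h" "\<And>x. \<bar>x\<bar> \<le> 1 \<Longrightarrow> h x = 1" "\<And>x. \<bar>x\<bar> \<ge> 2 \<Longrightarrow> h x = 0"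
    using smooth_cutoff_exists by blast
  define g where "g i x = h ((1 / \<delta>) * x + - (p i / \<delta>))" for i x
  have g: "differentiable_upto k (g i)" for i k
    unfolding g_def by (rule differentiable_upto_affine[OF h(1)])
  have g_arg: "(1 / \<delta>) * x + - (p i / \<delta>) = (x - p i) / \<delta>" for x i
    by (simp add: diff_divide_distrib)
  have g1: "g i x = 1" if "\<bar>x - p i\<bar> < \<delta>" for i x
    unfolding g_def g_arg using that \<delta> by (intro h(2)) (simp add: abs_divide)
  have g0: "g i x = 0" if "\<bar>x - p i\<bar> > 2 * \<delta>" for i x
    unfolding g_def g_arg using that \<delta> by (intro h(3)) (simp add: abs_divide field_simps)
  define B where "B = (\<lambda>m\<in>monomials k. \<lambda>x\<in>R. complex_of_real ((if m = {#} then 1 else 0) * (\<Prod>i<n. g i (x i))))"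
  define N where "N = R \<inter> (\<Pi>\<^sub>E i\<in>UNIV. if i < n then {p i - \<delta> <..< p i + \<delta>} else UNIV)"
  define K where "K = (\<Pi>\<^sub>E i\<in>UNIV. if i < n then {p i - 2 * \<delta> .. p i + 2 * \<delta>} else {0})"
  have R_eq: "R = {x. \<forall>i\<ge>n. x i = 0}" by (simp add: R_def topspace_Euclidean_space)
  have K_iff: "x \<in> K \<longleftrightarrow> (\<forall>i. if i < n then \<bar>x i - p i\<bar> \<le> 2 * \<delta> else x i = 0)" for x
  proof -
    have "x i \<in> (if i < n then {p i - 2 * \<delta> .. p i + 2 * \<delta>} else {0}) \<longleftrightarrow>
        (if i < n then \<bar>x i - p i\<bar> \<le> 2 * \<delta> else x i = 0)" for i
      by auto
    then show ?thesis by (simp only: K_def PiE_UNIV_domain Pi_iff ball_UNIV)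
  qed
  have N_iff: "x \<in> N \<longleftrightarrow> x \<in> R \<and> (\<forall>i<n. \<bar>x i - p i\<bar> < \<delta>)" for x
  proof -
    have "x i \<in> (if i < n then {p i - \<delta> <..< p i + \<delta>} else UNIV) \<longleftrightarrow> (i < n \<longrightarrow> \<bar>x i - p i\<bar> < \<delta>)" for i
      by auto
    then show ?thesis by (simp only: N_def Int_iff PiE_UNIV_domain Pi_iff ball_UNIV)
  qed
  have "B \<in> carrier (sec (euclidean_formal n k) R)"
    using class_C_prod[of n g] g
    by (auto simp: euclidean_formal_def B_def smooth_functions_def R_def)
  moreover have "openin (Euclidean_space n) N"
  proof -
    have "finite {i. (if i < n then {p i - \<delta> <..< p i + \<delta>} else UNIV) \<noteq> UNIV}"
      by (rule finite_subset[of _ "{..<n}"]) auto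
    then have "openin (powertop_real UNIV) (\<Pi>\<^sub>E i\<in>UNIV. if i < n then {p i - \<delta> <..< p i + \<delta>} else UNIV)"
      by (subst openin_PiE_gen) simp
    then show ?thesis
      unfolding Euclidean_space_def openin_subtopology N_def R_eq by blast
  qed
  moreover have "p \<in> N" using pR \<delta> by (simp add: N_iff)
  moreover have "compactin (Euclidean_space n) K"
    unfolding Euclidean_space_def compactin_subtopology
  proof
    show "compactin (powertop_real UNIV) K"
      unfolding K_def compactin_PiE by simp
    show "K \<subseteq> {x. \<forall>i\<ge>n. x i = 0}"
      by (auto simp: K_iff split: if_splits)
  qed
  moreover have "K \<subseteq> W"
  proof
    fix x assume x: "x \<in> K"
    then have "x \<in> R" by (auto simp: K_iff R_eq)
    moreover have "x i \<in> A i" for i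
    proof (cases "i < n")
      case True
      then have "\<bar>x i - p i\<bar> \<le> 2 * \<delta>" using x unfolding K_iff by metis
      then have "x i \<in> cball (p i) (d i)" using \<delta>_le[OF True] by (simp add: dist_real_def abs_minus_commute)
      then show ?thesis using d(2) by blast
    next
      case False
      then have "x i = p i" using \<open>x \<in> R\<close> pR by (simp add: R_eq)
      then show ?thesis using A(1) by auto
    qed
    ultimately show "x \<in> W" using A(3) O'(2) R_eq by (auto simp: PiE_UNIV_domain)
  qed
  moreover have "res (euclidean_formal n k) R N B = \<one>\<^bsub>sec (euclidean_formal n k) N\<^esub>"
  proof -
    have "(\<Prod>i<n. g i (x i)) = 1" if "x \<in> N" for x
      using that by (intro prod.neutral ballI g1) (simp add: N_iff)
    then have "(\<lambda>m\<in>monomials k. restrict (B m) N) = (\<lambda>m\<in>monomials k. \<lambda>x\<in>N. if m = {#} then 1 else 0)"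
      using N_iff by (intro restrict_ext ext) (simp add: B_def restrict_def del: of_real_prod)
    then show ?thesis by (simp add: euclidean_formal_def)
  qed
  moreover have "res (euclidean_formal n k) R (R - K) B = \<zero>\<^bsub>sec (euclidean_formal n k) (R - K)\<^esub>"
  proof -
    have "(\<Prod>i<n. g i (x i)) = 0" if x: "x \<in> R - K" for x
    proof -
      obtain i where "\<not> (if i < n then \<bar>x i - p i\<bar> \<le> 2 * \<delta> else x i = 0)"
        using x unfolding Diff_iff K_iff by blast
      then have "i < n" "\<bar>x i - p i\<bar> > 2 * \<delta>"
        using x by (auto simp: R_eq split: if_splits)
      then show ?thesis using g0[of "x i" i] by (auto intro!: prod_zero bexI[of _ i])
    qed
    then have "(\<lambda>m\<in>monomials k. restrict (B m) (R - K)) = (\<lambda>m\<in>monomials k. \<lambda>x\<in>R - K. 0)"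
      by (intro restrict_ext ext) (simp add: B_def restrict_def del: of_real_prod)
    then show ?thesis by (simp add: euclidean_formal_def)
  qed
  ultimately show ?thesis by blast
qed

subsection \<open>Bump functions on a formal manifold\<close>

text \<open>The family in \<open>gluing\<close> is indexed by the open sets themselves, so two
  sections over one and the same set need the separate case \<open>A = B\<close>.\<close>

lemma (in sheaf_on) gluing_two:
  assumes "openin M A" "openin M B" "s \<in> carrier (sec P A)" "t \<in> carrier (sec P B)"
    and "res P A (A \<inter> B) s = res P B (A \<inter> B) t"
  shows "\<exists>u \<in> carrier (sec P (A \<union> B)). res P (A \<union> B) A u = s \<and> res P (A \<union> B) B u = t"
proof (cases "A = B")
  case True
  then have "s = t" using assms by (simp add: res_self)
  then show ?thesis using assms True by (auto simp: res_self intro!: bexI[of _ s])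
next
  case False
  have "\<exists>u \<in> carrier (sec P (A \<union> B)). \<forall>V \<in> {A, B}. res P (A \<union> B) V u = (if V = A then s else t)"
    by (rule gluing) (use assms False in \<open>auto simp: Int_commute\<close>)
  then show ?thesis using False by auto
qed

context sheaf_of_complex_algebras
begin

abbreviation msec :: "'o \<Rightarrow> 'a set \<Rightarrow> 'o"
  where "msec f U \<equiv> res \<O> (topspace M) U f"

lemma cring_sec: "openin M U \<Longrightarrow> cring (sec \<O> U)"
  by (rule algebra.M_cring[OF algebra_sec])

lemma ring_hom_res: "openin M U \<Longrightarrow> openin M V \<Longrightarrow> V \<subseteq> U \<Longrightarrow> ring_hom_cring (sec \<O> U) (sec \<O> V) (res \<O> U V)"
  by (intro ring_hom_cring.intro ring_hom_cring_axioms.intro cring_sec res_ring_hom)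

text \<open>Vanishing is expressed by restriction and not by values: formal variables have value
  zero everywhere, so values do not determine a section of \<O>.\<close>

definition compact_support :: "'o \<Rightarrow> 'a set \<Rightarrow> bool"
  where "compact_support \<theta> V \<longleftrightarrow> \<theta> \<in> carrier (sec \<O> (topspace M)) \<and>
    (\<exists>K. compactin M K \<and> K \<subseteq> V \<and> msec \<theta> (topspace M - K) = \<zero>\<^bsub>sec \<O> (topspace M - K)\<^esub>)"

text \<open>A list lets one member of the cover carry several weights and supports induction. The
  second components record where the weights live.\<close>

definition weight_sum :: "('o \<times> 'a set) list \<Rightarrow> 'o"
  where "weight_sum ps = foldr (\<lambda>p s. fst p \<oplus>\<^bsub>sec \<O> (topspace M)\<^esub> s) ps \<zero>\<^bsub>sec \<O> (topspace M)\<^esub>"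

lemma weight_sum_simps [simp]:
  "weight_sum [] = \<zero>\<^bsub>sec \<O> (topspace M)\<^esub>"
  "weight_sum (p # ps) = fst p \<oplus>\<^bsub>sec \<O> (topspace M)\<^esub> weight_sum ps"
  by (simp_all add: weight_sum_def)

lemma compact_support_carrier [intro]:
  "compact_support \<theta> V \<Longrightarrow> \<theta> \<in> carrier (sec \<O> (topspace M))"
  by (simp add: compact_support_def)

lemma weight_sum_closed:
  "(\<And>\<rho> V. (\<rho>, V) \<in> set ps \<Longrightarrow> \<rho> \<in> carrier (sec \<O> (topspace M))) \<Longrightarrow>
    weight_sum ps \<in> carrier (sec \<O> (topspace M))"
proof (induction ps)
  case (Cons p ps)
  interpret cring "sec \<O> (topspace M)" by (rule cring_sec) simp
  show ?case using Cons by (cases p) auto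
qed (use cring.cring_simprules(2)[OF cring_sec[OF openin_topspace]] in simp)

lemma weight_sum_mult:
  assumes "a \<in> carrier (sec \<O> (topspace M))"
    and "\<And>\<rho> V. (\<rho>, V) \<in> set ps \<Longrightarrow> \<rho> \<in> carrier (sec \<O> (topspace M))"
  shows "weight_sum (map (\<lambda>p. (a \<otimes>\<^bsub>sec \<O> (topspace M)\<^esub> fst p, snd p)) ps) =
    a \<otimes>\<^bsub>sec \<O> (topspace M)\<^esub> weight_sum ps"
  using assms(2)
proof (induction ps)
  case Nil
  interpret cring "sec \<O> (topspace M)" by (rule cring_sec) simp
  show ?case using assms(1) by simp
next
  case (Cons p ps)
  interpret cring "sec \<O> (topspace M)" by (rule cring_sec) simp
  have "weight_sum ps \<in> carrier (sec \<O> (topspace M))"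
    using Cons.prems by (intro weight_sum_closed) auto
  moreover have "fst p \<in> carrier (sec \<O> (topspace M))"
    using Cons.prems[of "fst p" "snd p"] by simp
  ultimately show ?case
    using assms(1) Cons.IH[OF Cons.prems[OF list.set_intros(2)]] by (simp add: r_distr)
qed

end

context formal_manifold
begin

lemma open_minus_compact: "openin M U \<Longrightarrow> compactin M K \<Longrightarrow> openin M (U - K)"
  using openin_diff[OF _ compactin_imp_closedin[OF Hausdorff]] .

text \<open>The Euclidean bump is carried to the chart domain \<open>U\<close> and glued with zero
  on the complement of the compact set \<open>K\<close>. This complement is open because compact
  sets are closed in a Hausdorff space.\<close>

lemma bump_exists:
  assumes V: "openin M V" and a: "a \<in> V"
  shows "\<exists>\<theta> N. compact_support \<theta> V \<and> openin M N \<and> a \<in> N \<and> msec \<theta> N = \<one>\<^bsub>sec \<O> N\<^esub>"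
proof -
  have "a \<in> topspace M" using openin_subset[OF V] a by blast
  then obtain U n k where U: "openin M U" "a \<in> U"
    and iso: "isomorphic_ringed (subtopology M U) \<O> (Euclidean_space n) (euclidean_formal n k)"
    using locally_euclidean_formal by blast
  have topU: "topspace (subtopology M U) = U" using openin_subset[OF U(1)] by auto
  define R where "R = topspace (Euclidean_space n)"
  let ?P = "euclidean_formal n k"
  obtain \<phi> \<psi> where \<phi>: "homeomorphic_map (subtopology M U) (Euclidean_space n) \<phi>"
    and *: "\<forall>W. openin (Euclidean_space n) W \<longrightarrow>
        \<psi> W \<in> ring_iso (sec ?P W) (sec \<O> {x \<in> U. \<phi> x \<in> W}) \<and>
        (\<forall>c. \<forall>f \<in> carrier (sec ?P W).
          \<psi> W (c \<odot>\<^bsub>sec ?P W\<^esub> f) = c \<odot>\<^bsub>sec \<O> {x \<in> U. \<phi> x \<in> W}\<^esub> \<psi> W f)"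
    and **: "\<forall>V W. openin (Euclidean_space n) V \<longrightarrow> openin (Euclidean_space n) W \<longrightarrow> W \<subseteq> V \<longrightarrow>
        (\<forall>f \<in> carrier (sec ?P V). \<psi> W (res ?P V W f) =
          res \<O> {x \<in> U. \<phi> x \<in> V} {x \<in> U. \<phi> x \<in> W} (\<psi> V f))"
    using iso unfolding isomorphic_ringed_def topU by (elim exE conjE) rule
  note \<psi> = *[rule_format, THEN conjunct1] and \<psi>_smult = *[rule_format, THEN conjunct2, rule_format]
    and \<psi>_res = **[rule_format]
  have inj: "inj_on \<phi> U" using homeomorphic_imp_injective_map[OF \<phi>] topU by simp
  have img: "\<phi> ` U = R" using homeomorphic_imp_surjective_map[OF \<phi>] topU by (simp add: R_def)
  have pre_open: "openin M {x \<in> U. \<phi> x \<in> W}" if "openin (Euclidean_space n) W" for W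
    using openin_continuous_map_preimage[OF homeomorphic_imp_continuous_map[OF \<phi>] that]
    unfolding topU openin_open_subtopology[OF U(1)] by blast
  have "openin (subtopology M U) (V \<inter> U)"
    using V U(1) by (simp add: openin_open_subtopology openin_Int)
  then have W: "openin (Euclidean_space n) (\<phi> ` (V \<inter> U))"
    using homeomorphic_imp_open_map[OF \<phi>] by (simp add: open_map_def)
  have "\<phi> a \<in> \<phi> ` (V \<inter> U)" using a U(2) by blast
  from euclidean_bump[OF W this, of k] obtain B N' K' where
    B: "B \<in> carrier (sec ?P R)" and N': "openin (Euclidean_space n) N'" "\<phi> a \<in> N'"
    and K': "compactin (Euclidean_space n) K'" "K' \<subseteq> \<phi> ` (V \<inter> U)"
    and one: "res ?P R N' B = \<one>\<^bsub>sec ?P N'\<^esub>"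
    and zero: "res ?P R (R - K') B = \<zero>\<^bsub>sec ?P (R - K')\<^esub>"
    unfolding R_def by blast
  define K where "K = {x \<in> U. \<phi> x \<in> K'}"
  define N where "N = {x \<in> U. \<phi> x \<in> N'}"
  have "\<phi> ` K = K'" using K'(2) by (auto simp: K_def)
  then have "compactin (subtopology M U) K"
    using homeomorphic_map_compactness[OF \<phi>, of K] K'(1) topU by (auto simp: K_def)
  then have K: "compactin M K" by (simp add: compactin_subtopology)
  have KV: "K \<subseteq> V" using K'(2) inj by (auto simp: K_def inj_on_def)
  have R_open: "openin (Euclidean_space n) R" by (simp add: R_def)
  have RK_open: "openin (Euclidean_space n) (R - K')"
    using R_open compactin_imp_closedin[OF _ K'(1)] Hausdorff_Euclidean_space by blast
  have preR: "{x \<in> U. \<phi> x \<in> R} = U" using img by auto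
  have preRK: "{x \<in> U. \<phi> x \<in> R - K'} = U - K" using img by (auto simp: K_def)
  define \<theta>0 where "\<theta>0 = \<psi> R B"
  have \<theta>0: "\<theta>0 \<in> carrier (sec \<O> U)"
    using \<psi>[OF R_open] B unfolding preR by (auto simp: \<theta>0_def ring_iso_def ring_hom_def)
  have "res \<O> U N \<theta>0 = \<psi> N' (res ?P R N' B)"
    using \<psi>_res[OF R_open N'(1) _ B] openin_subset[OF N'(1)] preR by (simp add: \<theta>0_def N_def R_def)
  also have "\<dots> = \<one>\<^bsub>sec \<O> N\<^esub>"
    using \<psi>[OF N'(1)] by (simp add: one ring_iso_def ring_hom_def N_def)
  finally have \<theta>0_one: "res \<O> U N \<theta>0 = \<one>\<^bsub>sec \<O> N\<^esub>" .
  have "res \<O> U (U - K) \<theta>0 = \<psi> (R - K') (res ?P R (R - K') B)"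
    using \<psi>_res[OF R_open RK_open _ B] preR preRK by (simp add: \<theta>0_def)
  also have "\<dots> = \<zero>\<^bsub>sec \<O> (U - K)\<^esub>"
  proof -
    interpret A: Module.algebra complex_ring "sec \<O> (U - K)"
      by (rule algebra_sec[OF open_minus_compact[OF U(1) K]])
    have bij: "bij_betw (\<psi> (R - K')) (carrier (sec ?P (R - K'))) (carrier (sec \<O> (U - K)))"
      using \<psi>[OF RK_open] unfolding preRK ring_iso_def by simp
    \<comment> \<open>Preservation of zero is not among the clauses of \<open>ring_iso\<close>. It
      is obtained from compatibility with scalars: a preimage \<open>z\<close> of zero, scaled by 0,
      is the zero section of the Euclidean model and is still sent to zero.\<close>
    obtain z where z: "z \<in> carrier (sec ?P (R - K'))" "\<psi> (R - K') z = \<zero>\<^bsub>sec \<O> (U - K)\<^esub>"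
      using A.M.zero_closed unfolding bij_betw_imp_surj_on[OF bij, symmetric] by (elim imageE) simp
    have "0 \<odot>\<^bsub>sec ?P (R - K')\<^esub> z = \<zero>\<^bsub>sec ?P (R - K')\<^esub>"
      by (simp add: euclidean_formal_def)
    then have "\<psi> (R - K') (res ?P R (R - K') B) = 0 \<odot>\<^bsub>sec \<O> (U - K)\<^esub> \<zero>\<^bsub>sec \<O> (U - K)\<^esub>"
      using \<psi>_smult[OF RK_open z(1), of 0] unfolding zero preRK z(2) by (simp only:)
    then show ?thesis
      using A.smult_r_null[of 0] by simp
  qed
  finally have \<theta>0_zero: "res \<O> U (U - K) \<theta>0 = \<zero>\<^bsub>sec \<O> (U - K)\<^esub>" .
  have MK: "openin M (topspace M - K)" using K by (intro open_minus_compact) auto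
  have Int: "U \<inter> (topspace M - K) = U - K" using topU by auto
  have Un: "U \<union> (topspace M - K) = topspace M" using topU KV openin_subset[OF V] by (auto simp: K_def)
  have "res \<O> (topspace M - K) (U - K) \<zero>\<^bsub>sec \<O> (topspace M - K)\<^esub> = \<zero>\<^bsub>sec \<O> (U - K)\<^esub>"
    using openin_subset[OF U(1)]
    by (intro ring_hom_cring.hom_zero[OF ring_hom_res[OF MK open_minus_compact[OF U(1) K]]]) auto
  moreover have "\<zero>\<^bsub>sec \<O> (topspace M - K)\<^esub> \<in> carrier (sec \<O> (topspace M - K))"
    using cring.cring_simprules(2)[OF cring_sec[OF MK]] .
  ultimately obtain \<theta> where \<theta>: "\<theta> \<in> carrier (sec \<O> (topspace M))" "msec \<theta> U = \<theta>0"
    "msec \<theta> (topspace M - K) = \<zero>\<^bsub>sec \<O> (topspace M - K)\<^esub>"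
    using gluing_two[OF U(1) MK \<theta>0, of "\<zero>\<^bsub>sec \<O> (topspace M - K)\<^esub>"] \<theta>0_zero unfolding Int Un by auto
  have N: "openin M N" "a \<in> N" using pre_open[OF N'(1)] N'(2) U(2) by (auto simp: N_def)
  have "msec \<theta> N = \<one>\<^bsub>sec \<O> N\<^esub>"
    using res_res[OF _ U(1) N(1), of "topspace M" \<theta>] openin_subset[OF U(1)] \<theta> \<theta>0_one
    by (auto simp: N_def)
  then show ?thesis
    using \<theta> K KV N unfolding compact_support_def by blast
qed

lemma compact_support_mult:
  assumes "compact_support \<theta> V" "\<rho> \<in> carrier (sec \<O> (topspace M))"
  shows "compact_support (\<rho> \<otimes>\<^bsub>sec \<O> (topspace M)\<^esub> \<theta>) V"
proof -
  obtain K where K: "compactin M K" "K \<subseteq> V"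
    "msec \<theta> (topspace M - K) = \<zero>\<^bsub>sec \<O> (topspace M - K)\<^esub>"
    using assms(1) by (auto simp: compact_support_def)
  have op: "openin M (topspace M - K)" using K by (intro open_minus_compact) auto
  interpret A: cring "sec \<O> (topspace M)" by (rule cring_sec) simp
  interpret B: cring "sec \<O> (topspace M - K)" by (rule cring_sec[OF op])
  have hom: "res \<O> (topspace M) (topspace M - K) \<in> ring_hom (sec \<O> (topspace M)) (sec \<O> (topspace M - K))"
    using op by (intro res_ring_hom) auto
  show ?thesis
    using assms K ring_hom_mult[OF hom assms(2)] ring_hom_closed[OF hom assms(2)]
    by (auto simp: compact_support_def)
qed

text \<open>A new weight \<theta> joins an old sum \<open>s\<close> as
  \<open>\<theta> + (1 - \<theta>) * s\<close>. This is 1 wherever \<theta> or \<open>s\<close> is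
  1, so the weights need not be normalised by division.\<close>

lemma partition_finite:
  assumes "finite \<N>"
    and "\<And>N. N \<in> \<N> \<Longrightarrow> openin M N \<and> (\<exists>\<theta>. \<exists>V\<in>\<C>. compact_support \<theta> V \<and> msec \<theta> N = \<one>\<^bsub>sec \<O> N\<^esub>)"
  shows "\<exists>ps. (\<forall>(\<rho>, V) \<in> set ps. V \<in> \<C> \<and> compact_support \<rho> V) \<and>
    (\<forall>N\<in>\<N>. msec (weight_sum ps) N = \<one>\<^bsub>sec \<O> N\<^esub>)"
  using assms
proof (induction \<N> rule: finite_induct)
  case empty
  show ?case by (rule exI[of _ "[]"]) simp
next
  case (insert N \<N>)
  interpret A: cring "sec \<O> (topspace M)" by (rule cring_sec) simp
  let ?A = "sec \<O> (topspace M)"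
  obtain ps where ps: "\<And>\<rho> V. (\<rho>, V) \<in> set ps \<Longrightarrow> V \<in> \<C> \<and> compact_support \<rho> V"
    "\<And>N. N \<in> \<N> \<Longrightarrow> msec (weight_sum ps) N = \<one>\<^bsub>sec \<O> N\<^esub>"
    using insert by (metis (mono_tags, lifting) case_prodD insertCI)
  obtain \<theta> V where \<theta>: "V \<in> \<C>" "compact_support \<theta> V" "msec \<theta> N = \<one>\<^bsub>sec \<O> N\<^esub>" and N: "openin M N"
    using insert.prems by blast
  have \<theta>_carrier: "\<theta> \<in> carrier ?A" using \<theta>(2) by (rule compact_support_carrier)
  define a where "a = \<one>\<^bsub>?A\<^esub> \<ominus>\<^bsub>?A\<^esub> \<theta>"
  define qs where "qs = (\<theta>, V) # map (\<lambda>p. (a \<otimes>\<^bsub>?A\<^esub> fst p, snd p)) ps"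
  have a: "a \<in> carrier ?A" using \<theta>_carrier by (simp add: a_def)
  have ps_carrier: "\<rho> \<in> carrier ?A" if "(\<rho>, V) \<in> set ps" for \<rho> V
    using ps(1)[OF that] by auto
  have ws: "weight_sum ps \<in> carrier ?A" by (rule weight_sum_closed[OF ps_carrier])
  have sum: "weight_sum qs = \<theta> \<oplus>\<^bsub>?A\<^esub> a \<otimes>\<^bsub>?A\<^esub> weight_sum ps"
    using weight_sum_mult[OF a ps_carrier] by (simp add: qs_def)
  have "V \<in> \<C> \<and> compact_support \<rho> V" if "(\<rho>, V) \<in> set qs" for \<rho> V
    using that \<theta> ps(1) compact_support_mult[OF _ a] by (auto simp: qs_def)
  moreover have "msec (weight_sum qs) N' = \<one>\<^bsub>sec \<O> N'\<^esub>" if N': "N' \<in> insert N \<N>" for N'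
  proof -
    have op: "openin M N'" using insert.prems N' by blast
    have "N' \<subseteq> topspace M" using op by (rule openin_subset)
    interpret h: ring_hom_cring ?A "sec \<O> N'" "res \<O> (topspace M) N'"
      by (rule ring_hom_res) (use op \<open>N' \<subseteq> topspace M\<close> in auto)
    have eq: "msec (weight_sum qs) N' = msec \<theta> N' \<oplus>\<^bsub>sec \<O> N'\<^esub>
        (\<one>\<^bsub>sec \<O> N'\<^esub> \<ominus>\<^bsub>sec \<O> N'\<^esub> msec \<theta> N') \<otimes>\<^bsub>sec \<O> N'\<^esub> msec (weight_sum ps) N'"
      using \<theta>_carrier ws a unfolding sum by (simp add: a_def a_minus_def)
    have car: "msec \<theta> N' \<in> carrier (sec \<O> N')" "msec (weight_sum ps) N' \<in> carrier (sec \<O> N')"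
      using \<theta>_carrier ws by auto
    show ?thesis
    proof (cases "N' = N")
      case True
      then have "msec \<theta> N' = \<one>\<^bsub>sec \<O> N'\<^esub>" using \<theta>(3) by simp
      then show ?thesis using car unfolding eq by (simp add: a_minus_def h.S.r_neg)
    next
      case False
      then have "msec (weight_sum ps) N' = \<one>\<^bsub>sec \<O> N'\<^esub>" using N' ps(2) by blast
      then show ?thesis using car unfolding eq
        by (simp add: a_minus_def h.S.a_lcomm[of "msec \<theta> N'"] h.S.r_neg)
    qed
  qed
  ultimately show ?case by blast
qed

text \<open>The open sets on which some bump is 1 cover \<open>K\<close>, and compactness leaves
  finitely many of them.\<close>

lemma partition_of_unity:
  assumes K: "compactin M K" "K \<subseteq> \<Union>\<C>" and \<C>: "\<And>V. V \<in> \<C> \<Longrightarrow> openin M V"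
  shows "\<exists>ps \<N>. (\<forall>(\<rho>, V) \<in> set ps. V \<in> \<C> \<and> compact_support \<rho> V) \<and> K \<subseteq> \<Union>\<N> \<and>
    (\<forall>N\<in>\<N>. openin M N \<and> msec (weight_sum ps) N = \<one>\<^bsub>sec \<O> N\<^esub>)"
proof -
  define \<B> where "\<B> = {N. openin M N \<and> (\<exists>\<theta>. \<exists>V\<in>\<C>. compact_support \<theta> V \<and> msec \<theta> N = \<one>\<^bsub>sec \<O> N\<^esub>)}"
  have "K \<subseteq> \<Union>\<B>"
  proof
    fix a assume "a \<in> K"
    then obtain V where V: "V \<in> \<C>" "a \<in> V" using K(2) by blast
    from bump_exists[OF \<C>[OF V(1)] V(2)] V(1) show "a \<in> \<Union>\<B>" unfolding \<B>_def by blast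
  qed
  then obtain \<N> where \<N>: "finite \<N>" "\<N> \<subseteq> \<B>" "K \<subseteq> \<Union>\<N>"
    using compactinD[OF K(1), of \<B>] unfolding \<B>_def by blast
  show ?thesis
    using partition_finite[OF \<N>(1), of \<C>] \<N>(2,3) unfolding \<B>_def by blast
qed

end

section \<open>Differential operators multiplied by bump functions\<close>

context sheaf_of_complex_algebras
begin

lemma germ_res:
  assumes U: "openin M U" and V: "openin M V" "V \<subseteq> U" "a \<in> V" and f: "f \<in> carrier (sec \<O> U)"
  shows "germ M \<O> a V (res \<O> U V f) = germ M \<O> a U f"
proof -
  have "(\<exists>W'. openin M W' \<and> a \<in> W' \<and> W' \<subseteq> V \<inter> W \<and> res \<O> V W' (res \<O> U V f) = res \<O> W W' t) \<longleftrightarrow>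
      (\<exists>W'. openin M W' \<and> a \<in> W' \<and> W' \<subseteq> U \<inter> W \<and> res \<O> U W' f = res \<O> W W' t)" (is "?l \<longleftrightarrow> ?r")
    if W: "openin M W" "t \<in> carrier (sec \<O> W)" for W t
  proof
    assume ?l
    then obtain W' where "openin M W'" "a \<in> W'" "W' \<subseteq> V \<inter> W" "res \<O> V W' (res \<O> U V f) = res \<O> W W' t"
      by blast
    with U V f show ?r by (intro exI[of _ W']) (auto simp: res_res)
  next
    assume ?r
    then obtain W' where W': "openin M W'" "a \<in> W'" "W' \<subseteq> U \<inter> W" "res \<O> U W' f = res \<O> W W' t"
      by blast
    have "res \<O> U (W' \<inter> V) f = res \<O> W' (W' \<inter> V) (res \<O> U W' f)"
      using U V f W' by (intro res_res[symmetric]) auto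
    also have "\<dots> = res \<O> W (W' \<inter> V) t"
      unfolding W'(4) using W V W' by (intro res_res) auto
    finally show ?l using U V f W'
      by (intro exI[of _ "W' \<inter> V"]) (auto simp: res_res openin_Int)
  qed
  then show ?thesis unfolding germ_def by blast
qed

text \<open>Values depend on the germ alone. For constants this makes the complex scalars of the
  reduced sheaf agree over \<open>W\<close> and over \<open>W \<inter> A\<close>, as linearity of
  \<open>cutoff\<close> requires.\<close>

lemma sec_value_res:
  "\<lbrakk>openin M U; openin M V; V \<subseteq> U; a \<in> V; f \<in> carrier (sec \<O> U)\<rbrakk> \<Longrightarrow>
    sec_value M \<O> V (res \<O> U V f) a = sec_value M \<O> U f a"
  by (simp add: sec_value_def germ_res)

lemma germ_self: "\<lbrakk>openin M U; a \<in> U; f \<in> carrier (sec \<O> U)\<rbrakk> \<Longrightarrow> (U, f) \<in> germ M \<O> a U f"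
  unfolding germ_def by blast

lemma germ_memD:
  assumes "(V, g) \<in> germ M \<O> a U f"
  shows "openin M V" "a \<in> V" "g \<in> carrier (sec \<O> V)"
    "\<exists>W. openin M W \<and> a \<in> W \<and> W \<subseteq> U \<inter> V \<and> res \<O> U W f = res \<O> V W g"
  using assms unfolding germ_def by auto

text \<open>All representatives of the germ agree on a smaller neighbourhood and yield the same
  germ. The union in \<open>stalk\<close> is thus over a constant family, which is nonempty by
  \<open>germ_self\<close>. The product is treated in the same way.\<close>

lemma stalk_smult_germ:
  assumes U: "openin M U" "a \<in> U" "f \<in> carrier (sec \<O> U)"
  shows "c \<odot>\<^bsub>stalk M \<O> a\<^esub> germ M \<O> a U f = germ M \<O> a U (c \<odot>\<^bsub>sec \<O> U\<^esub> f)"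
proof -
  have closed: "c \<odot>\<^bsub>sec \<O> V\<^esub> g \<in> carrier (sec \<O> V)" if "openin M V" "g \<in> carrier (sec \<O> V)" for V g
  proof -
    interpret Module.algebra complex_ring "sec \<O> V" by (rule algebra_sec[OF that(1)])
    show ?thesis using smult_closed[of c g] that by simp
  qed
  have "germ M \<O> a V (c \<odot>\<^bsub>sec \<O> V\<^esub> g) = germ M \<O> a U (c \<odot>\<^bsub>sec \<O> U\<^esub> f)"
    if mem: "(V, g) \<in> germ M \<O> a U f" for V g
  proof -
    note V = germ_memD(1-3)[OF mem]
    obtain W where W: "openin M W" "a \<in> W" "W \<subseteq> U" "W \<subseteq> V" "res \<O> U W f = res \<O> V W g"
      using germ_memD(4)[OF mem] by blast
    have "germ M \<O> a V (c \<odot>\<^bsub>sec \<O> V\<^esub> g) = germ M \<O> a W (res \<O> V W (c \<odot>\<^bsub>sec \<O> V\<^esub> g))"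
      using V W closed by (simp add: germ_res)
    also have "\<dots> = germ M \<O> a W (res \<O> U W (c \<odot>\<^bsub>sec \<O> U\<^esub> f))"
      using U V W by (simp add: res_smult_complex)
    also have "\<dots> = germ M \<O> a U (c \<odot>\<^bsub>sec \<O> U\<^esub> f)"
      using U W closed by (simp add: germ_res)
    finally show ?thesis .
  qed
  note * = this
  have "c \<odot>\<^bsub>stalk M \<O> a\<^esub> germ M \<O> a U f =
      (\<Union>(V, g)\<in>germ M \<O> a U f. germ M \<O> a V (c \<odot>\<^bsub>sec \<O> V\<^esub> g))"
    by (simp add: stalk_def)
  also have "\<dots> = (\<Union>(V, g)\<in>germ M \<O> a U f. germ M \<O> a U (c \<odot>\<^bsub>sec \<O> U\<^esub> f))"
    by (intro SUP_cong refl) (use * in auto)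
  also have "\<dots> = germ M \<O> a U (c \<odot>\<^bsub>sec \<O> U\<^esub> f)"
    using germ_self[OF U] by auto
  finally show ?thesis .
qed

lemma stalk_mult_germ:
  assumes U: "openin M U" "a \<in> U" "f \<in> carrier (sec \<O> U)" and g: "g \<in> carrier (sec \<O> U)"
  shows "germ M \<O> a U f \<otimes>\<^bsub>stalk M \<O> a\<^esub> germ M \<O> a U g = germ M \<O> a U (f \<otimes>\<^bsub>sec \<O> U\<^esub> g)"
proof -
  have mult_res: "res \<O> V W (h \<otimes>\<^bsub>sec \<O> V\<^esub> k) = res \<O> V W h \<otimes>\<^bsub>sec \<O> W\<^esub> res \<O> V W k"
    "h \<otimes>\<^bsub>sec \<O> V\<^esub> k \<in> carrier (sec \<O> V)"
    if "openin M V" "openin M W" "W \<subseteq> V" "h \<in> carrier (sec \<O> V)" "k \<in> carrier (sec \<O> V)" for V W h k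
  proof -
    show "res \<O> V W (h \<otimes>\<^bsub>sec \<O> V\<^esub> k) = res \<O> V W h \<otimes>\<^bsub>sec \<O> W\<^esub> res \<O> V W k"
      using ring_hom_mult[OF res_ring_hom] that by metis
    interpret cring "sec \<O> V" by (rule cring_sec[OF that(1)])
    show "h \<otimes>\<^bsub>sec \<O> V\<^esub> k \<in> carrier (sec \<O> V)" using that by simp
  qed
  have *: "germ M \<O> a (V1 \<inter> V2) (res \<O> V1 (V1 \<inter> V2) h \<otimes>\<^bsub>sec \<O> (V1 \<inter> V2)\<^esub> res \<O> V2 (V1 \<inter> V2) k) =
      germ M \<O> a U (f \<otimes>\<^bsub>sec \<O> U\<^esub> g)"
    if mem: "(V1, h) \<in> germ M \<O> a U f" "(V2, k) \<in> germ M \<O> a U g" for V1 h V2 k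
  proof -
    note V1 = germ_memD(1-3)[OF mem(1)] and V2 = germ_memD(1-3)[OF mem(2)]
    obtain W1 where W1: "openin M W1" "a \<in> W1" "W1 \<subseteq> U" "W1 \<subseteq> V1" "res \<O> U W1 f = res \<O> V1 W1 h"
      using germ_memD(4)[OF mem(1)] by blast
    obtain W2 where W2: "openin M W2" "a \<in> W2" "W2 \<subseteq> U" "W2 \<subseteq> V2" "res \<O> U W2 g = res \<O> V2 W2 k"
      using germ_memD(4)[OF mem(2)] by blast
    define W where "W = W1 \<inter> W2"
    have W: "openin M W" "a \<in> W" "W \<subseteq> W1" "W \<subseteq> W2" using W1 W2 by (auto simp: W_def)
    define V where "V = V1 \<inter> V2"
    have V: "openin M V" "a \<in> V" "V \<subseteq> V1" "V \<subseteq> V2" "W \<subseteq> V" using V1 V2 W1 W2 by (auto simp: V_def W_def)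
    have h: "res \<O> V1 W h = res \<O> U W f"
      using res_res[of V1 W1 W h] res_res[of U W1 W f] V1 U W1 W by auto
    have k: "res \<O> V2 W k = res \<O> U W g"
      using res_res[of V2 W2 W k] res_res[of U W2 W g] V2 U W2 W g by auto
    have car: "res \<O> V1 V h \<in> carrier (sec \<O> V)" "res \<O> V2 V k \<in> carrier (sec \<O> V)"
      using V V1 V2 by (auto intro: res_closed)
    have "germ M \<O> a V (res \<O> V1 V h \<otimes>\<^bsub>sec \<O> V\<^esub> res \<O> V2 V k) =
        germ M \<O> a W (res \<O> V W (res \<O> V1 V h \<otimes>\<^bsub>sec \<O> V\<^esub> res \<O> V2 V k))"
      using V W mult_res(2)[OF V(1) V(1) _ car] by (simp add: germ_res)
    also have "\<dots> = germ M \<O> a W (res \<O> U W f \<otimes>\<^bsub>sec \<O> W\<^esub> res \<O> U W g)"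
      using V V1 V2 W mult_res(1)[OF V(1) W(1) V(5) car] h k by (simp add: res_res)
    also have "\<dots> = germ M \<O> a W (res \<O> U W (f \<otimes>\<^bsub>sec \<O> U\<^esub> g))"
      using U g W W1 mult_res(1)[of U W f g] by simp
    also have "\<dots> = germ M \<O> a U (f \<otimes>\<^bsub>sec \<O> U\<^esub> g)"
      using U g W W1 mult_res(2)[of U U f g] by (intro germ_res) auto
    finally show ?thesis unfolding V_def .
  qed
  have "germ M \<O> a U f \<otimes>\<^bsub>stalk M \<O> a\<^esub> germ M \<O> a U g =
      (\<Union>(V1, h)\<in>germ M \<O> a U f. \<Union>(V2, k)\<in>germ M \<O> a U g. germ M \<O> a (V1 \<inter> V2)
        (res \<O> V1 (V1 \<inter> V2) h \<otimes>\<^bsub>sec \<O> (V1 \<inter> V2)\<^esub> res \<O> V2 (V1 \<inter> V2) k))"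
    by (simp add: stalk_def)
  also have "\<dots> = (\<Union>(V1, h)\<in>germ M \<O> a U f. \<Union>(V2, k)\<in>germ M \<O> a U g. germ M \<O> a U (f \<otimes>\<^bsub>sec \<O> U\<^esub> g))"
    by (intro SUP_cong refl) (use * in auto)
  also have "\<dots> = germ M \<O> a U (f \<otimes>\<^bsub>sec \<O> U\<^esub> g)"
    using germ_self[OF U] germ_self[OF U(1,2) g] by auto
  finally show ?thesis .
qed

end

section \<open>Values of sections and the reduced sheaf\<close>

context locally_ringed_space_over_complex
begin

text \<open>Since \<open>sec_value\<close> is a definite description, uniqueness of the constant has
  to be shown: a nonzero constant in the coset of zero would be a unit inside the maximal ideal. The
  lemma makes the zero function a section of the reduced sheaf.\<close>

lemma sec_value_zero:
  assumes U: "openin M U" "a \<in> U"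
  shows "sec_value M \<O> U \<zero>\<^bsub>sec \<O> U\<^esub> a = 0"
proof -
  define S where "S = stalk M \<O> a"
  let ?T = "topspace M"
  have T: "openin M ?T" "a \<in> ?T" "U \<subseteq> ?T" using openin_subset[OF U(1)] U(2) by auto
  have local: "local_ring S" using local_stalk[OF T(2)] by (simp add: S_def)
  then interpret S: cring S by (simp add: local_ring_def)
  interpret C: cring "sec \<O> ?T" by (rule cring_sec[OF T(1)])
  interpret A: Module.algebra complex_ring "sec \<O> ?T" by (rule algebra_sec[OF T(1)])
  define m where "m = max_ideal S"
  have "maximalideal m S"
    using local theI'[of "\<lambda>I. maximalideal I S"] unfolding local_ring_def m_def max_ideal_def by blast
  then interpret m: maximalideal m S .
  interpret h: ring_hom_cring "sec \<O> ?T" "sec \<O> U" "res \<O> ?T U"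
    by (rule ring_hom_res[OF T(1) U(1) T(3)])
  define g where "g c = germ M \<O> a ?T (c \<odot>\<^bsub>sec \<O> ?T\<^esub> \<one>\<^bsub>sec \<O> ?T\<^esub>)" for c
  have car: "c \<odot>\<^bsub>sec \<O> ?T\<^esub> \<one>\<^bsub>sec \<O> ?T\<^esub> \<in> carrier (sec \<O> ?T)" for c
    using A.smult_closed[of c "\<one>\<^bsub>sec \<O> ?T\<^esub>"] C.one_closed by simp
  have g_S: "g c \<in> carrier S" for c
  proof -
    have "carrier S = {germ M \<O> a U f | U f. openin M U \<and> a \<in> U \<and> f \<in> carrier (sec \<O> U)}"
      by (simp add: S_def stalk_def)
    moreover have "g c \<in> {germ M \<O> a U f | U f. openin M U \<and> a \<in> U \<and> f \<in> carrier (sec \<O> U)}"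
      unfolding g_def using T(1,2) car[of c]
      by (intro CollectI exI[of _ ?T] exI[of _ "c \<odot>\<^bsub>sec \<O> ?T\<^esub> \<one>\<^bsub>sec \<O> ?T\<^esub>"] conjI refl)
    ultimately show ?thesis by (simp only:)
  qed
  have one: "\<one>\<^bsub>S\<^esub> = germ M \<O> a ?T \<one>\<^bsub>sec \<O> ?T\<^esub>" by (simp add: S_def stalk_def)
  have zero: "\<zero>\<^bsub>S\<^esub> = germ M \<O> a ?T \<zero>\<^bsub>sec \<O> ?T\<^esub>" by (simp add: S_def stalk_def)
  have smult_one: "c \<odot>\<^bsub>S\<^esub> \<one>\<^bsub>S\<^esub> = g c" for c
    unfolding one g_def using stalk_smult_germ[OF T(1,2) C.one_closed] by (simp add: S_def)
  have g_zero: "g 0 = \<zero>\<^bsub>S\<^esub>"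
    unfolding g_def zero using A.smult_l_null[OF C.one_closed] by simp
  have g_one: "g 1 = \<one>\<^bsub>S\<^esub>"
    unfolding g_def one using A.smult_one[OF C.one_closed] by simp
  have g_mult: "g c \<otimes>\<^bsub>S\<^esub> g d = g (c * d)" for c d
  proof -
    have "(c \<odot>\<^bsub>sec \<O> ?T\<^esub> \<one>\<^bsub>sec \<O> ?T\<^esub>) \<otimes>\<^bsub>sec \<O> ?T\<^esub> (d \<odot>\<^bsub>sec \<O> ?T\<^esub> \<one>\<^bsub>sec \<O> ?T\<^esub>) =
        (c * d) \<odot>\<^bsub>sec \<O> ?T\<^esub> \<one>\<^bsub>sec \<O> ?T\<^esub>"
      using A.smult_assoc2[of c "\<one>\<^bsub>sec \<O> ?T\<^esub>" "d \<odot>\<^bsub>sec \<O> ?T\<^esub> \<one>\<^bsub>sec \<O> ?T\<^esub>"]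
        A.smult_assoc1[of c d "\<one>\<^bsub>sec \<O> ?T\<^esub>"] car[of d] C.one_closed by simp
    then show ?thesis
      unfolding g_def using stalk_mult_germ[OF T(1,2) car car] by (simp add: S_def)
  qed
  have germ_zero: "germ M \<O> a U \<zero>\<^bsub>sec \<O> U\<^esub> = \<zero>\<^bsub>S\<^esub>"
    unfolding zero using germ_res[OF T(1) U(1) T(3) U(2) C.zero_closed] by simp
  have coset_eq: "(m +>\<^bsub>S\<^esub> \<zero>\<^bsub>S\<^esub> = m +>\<^bsub>S\<^esub> g c) \<longleftrightarrow> c = 0" for c
  proof
    assume eq: "m +>\<^bsub>S\<^esub> \<zero>\<^bsub>S\<^esub> = m +>\<^bsub>S\<^esub> g c"
    have "g c \<in> m +>\<^bsub>S\<^esub> g c" by (rule m.a_rcos_self[OF g_S])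
    also have "m +>\<^bsub>S\<^esub> g c = m +>\<^bsub>S\<^esub> \<zero>\<^bsub>S\<^esub>" using eq by (rule sym)
    also have "\<dots> = m" by (rule S.a_coset_add_zero[OF m.a_subset])
    finally have "g c \<in> m" .
    show "c = 0"
    proof (rule ccontr)
      assume "c \<noteq> 0"
      have "g (inverse c) \<otimes>\<^bsub>S\<^esub> g c \<in> m"
        using \<open>g c \<in> m\<close> g_S by (rule m.I_l_closed)
      then have "\<one>\<^bsub>S\<^esub> \<in> m"
        unfolding g_mult using \<open>c \<noteq> 0\<close> g_one by simp
      from m.one_imp_carrier[OF this] m.I_notcarr show False by simp
    qed
  qed (simp add: g_zero)
  show ?thesis
    unfolding sec_value_def S_def[symmetric] m_def[symmetric] germ_zero smult_one
    by (simp only: coset_eq the_eq_trivial)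
qed

lemma reduced_simps [simp]:
  "zero (sec (reduced_sheaf M \<O>) U) = (\<lambda>a\<in>U. 0)"
  "add (sec (reduced_sheaf M \<O>) U) = (\<lambda>g h. \<lambda>a\<in>U. g a + h a)"
  "smult (sec (reduced_sheaf M \<O>) U) = (\<lambda>f g. \<lambda>a\<in>U. sec_value M \<O> U f a * g a)"
  "res (reduced_sheaf M \<O>) U V g = restrict g V"
  by (simp_all add: reduced_sheaf_def)

lemma reduced_carrier:
  "carrier (sec (reduced_sheaf M \<O>) U) = {g \<in> extensional U. \<forall>a\<in>U. \<exists>W f. openin M W \<and> a \<in> W \<and> W \<subseteq> U \<and>
    f \<in> carrier (sec \<O> W) \<and> (\<forall>b\<in>W. g b = sec_value M \<O> W f b)}"
  by (simp only: reduced_sheaf_def presheaf.simps partial_object.simps)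

lemma reduced_extensional: "g \<in> carrier (sec (reduced_sheaf M \<O>) U) \<Longrightarrow> g \<in> extensional U"
  unfolding reduced_carrier by blast

text \<open>Being given by values of \<O> is a local condition, so a function that is a section near
  every point is a section. This is how operators extended by zero are seen to land in the reduced
  sheaf.\<close>

lemma reduced_closedI:
  assumes "g \<in> extensional U"
    and "\<And>a. a \<in> U \<Longrightarrow> \<exists>W h. openin M W \<and> a \<in> W \<and> W \<subseteq> U \<and>
      h \<in> carrier (sec (reduced_sheaf M \<O>) W) \<and> (\<forall>b\<in>W. g b = h b)"
  shows "g \<in> carrier (sec (reduced_sheaf M \<O>) U)"
proof -
  have "\<exists>W f. openin M W \<and> a \<in> W \<and> W \<subseteq> U \<and> f \<in> carrier (sec \<O> W) \<and> (\<forall>b\<in>W. g b = sec_value M \<O> W f b)"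
    if a: "a \<in> U" for a
  proof -
    obtain W h where W: "a \<in> W" "W \<subseteq> U" "h \<in> carrier (sec (reduced_sheaf M \<O>) W)" "\<forall>b\<in>W. g b = h b"
      using assms(2)[OF a] by (elim exE conjE)
    then obtain W' f where "openin M W'" "a \<in> W'" "W' \<subseteq> W" "f \<in> carrier (sec \<O> W')"
      "\<forall>b\<in>W'. h b = sec_value M \<O> W' f b"
      unfolding reduced_carrier by blast
    with W show ?thesis by (intro exI[of _ W'] exI[of _ f]) auto
  qed
  with assms(1) show ?thesis unfolding reduced_carrier by blast
qed

lemma reduced_zero_closed:
  assumes "openin M U"
  shows "(\<lambda>a\<in>U. 0) \<in> carrier (sec (reduced_sheaf M \<O>) U)"
proof -
  have "\<zero>\<^bsub>sec \<O> U\<^esub> \<in> carrier (sec \<O> U)"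
    by (rule cring.cring_simprules(2)[OF cring_sec[OF assms]])
  moreover have "\<forall>b\<in>U. (\<lambda>a\<in>U. 0) b = sec_value M \<O> U \<zero>\<^bsub>sec \<O> U\<^esub> b"
    by (simp add: sec_value_zero[OF assms])
  ultimately have "\<exists>f. f \<in> carrier (sec \<O> U) \<and> (\<forall>b\<in>U. (\<lambda>a\<in>U. 0) b = sec_value M \<O> U f b)"
    by (intro exI conjI)
  with assms have "\<forall>a\<in>U. \<exists>W f. openin M W \<and> a \<in> W \<and> W \<subseteq> U \<and> f \<in> carrier (sec \<O> W) \<and>
      (\<forall>b\<in>W. (\<lambda>a\<in>U. 0) b = sec_value M \<O> W f b)"
    by (intro ballI exI[of _ U]) simp
  then show ?thesis
    unfolding reduced_carrier by (intro CollectI conjI restrict_extensional)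
qed

text \<open>Subtraction in the reduced sheaf goes through a definite description of the additive
  inverse. This instance is the one that occurs in the commutators of an operator that
  vanishes.\<close>

lemma reduced_zero_minus:
  assumes "openin M U"
  shows "(\<lambda>a\<in>U. 0) \<ominus>\<^bsub>sec (reduced_sheaf M \<O>) U\<^esub> (\<lambda>a\<in>U. 0) = (\<lambda>a\<in>U. 0)"
proof -
  have "\<ominus>\<^bsub>sec (reduced_sheaf M \<O>) U\<^esub> (\<lambda>a\<in>U. 0) = (\<lambda>a\<in>U. 0)"
    unfolding a_inv_def m_inv_def
  proof (rule the_equality)
    fix y assume y: "y \<in> carrier (add_monoid (sec (reduced_sheaf M \<O>) U)) \<and>
      (\<lambda>a\<in>U. 0) \<otimes>\<^bsub>add_monoid (sec (reduced_sheaf M \<O>) U)\<^esub> y = \<one>\<^bsub>add_monoid (sec (reduced_sheaf M \<O>) U)\<^esub> \<and>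
      y \<otimes>\<^bsub>add_monoid (sec (reduced_sheaf M \<O>) U)\<^esub> (\<lambda>a\<in>U. 0) = \<one>\<^bsub>add_monoid (sec (reduced_sheaf M \<O>) U)\<^esub>"
    then have "y \<in> extensional U" using reduced_extensional by simp
    moreover have "(\<lambda>a\<in>U. y a) = (\<lambda>a\<in>U. 0)" using y by (simp cong: restrict_cong)
    ultimately show "y = (\<lambda>a\<in>U. 0)" by (simp add: extensional_restrict)
  qed (simp add: reduced_zero_closed[OF assms] cong: restrict_cong)
  then show ?thesis by (simp add: a_minus_def cong: restrict_cong)
qed

end

section \<open>Global functions acting on a sheaf of modules\<close>

locale formal_manifold_module = formal_manifold M \<O> + F: sheaf_of_modules M \<O> \<F>
  for M :: "'a topology" and \<O> :: "('a, 'o, (complex, 'o) module) presheaf"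
    and \<F> :: "('a, 'f, ('o, 'f) module) presheaf"
begin

lemma abelian_group_F: "openin M U \<Longrightarrow> abelian_group (sec \<F> U)"
  using F.module_sec[of U] by (simp add: Module.module_def)

lemma F_zero_closed [simp]: "openin M U \<Longrightarrow> \<zero>\<^bsub>sec \<F> U\<^esub> \<in> carrier (sec \<F> U)"
  by (rule abelian_group.axioms(1)[OF abelian_group_F, THEN abelian_monoid.zero_closed])

lemma F_add_closed [simp]:
  "\<lbrakk>openin M U; u \<in> carrier (sec \<F> U); v \<in> carrier (sec \<F> U)\<rbrakk> \<Longrightarrow> u \<oplus>\<^bsub>sec \<F> U\<^esub> v \<in> carrier (sec \<F> U)"
  by (rule abelian_group.axioms(1)[OF abelian_group_F, THEN abelian_monoid.a_closed])

lemma F_minus_closed [simp]: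
  "\<lbrakk>openin M U; u \<in> carrier (sec \<F> U); v \<in> carrier (sec \<F> U)\<rbrakk> \<Longrightarrow> u \<ominus>\<^bsub>sec \<F> U\<^esub> v \<in> carrier (sec \<F> U)"
  by (rule abelian_group.minus_closed[OF abelian_group_F])

lemma F_smult_closed [simp]:
  "\<lbrakk>openin M U; f \<in> carrier (sec \<O> U); u \<in> carrier (sec \<F> U)\<rbrakk> \<Longrightarrow> f \<odot>\<^bsub>sec \<F> U\<^esub> u \<in> carrier (sec \<F> U)"
  by (rule module.smult_closed[OF F.module_sec])

lemma F_res_hom:
  assumes "openin M U" "openin M V" "V \<subseteq> U"
  shows "abelian_group_hom (sec \<F> U) (sec \<F> V) (res \<F> U V)"
proof (rule abelian_group_homI)
  show "group_hom (add_monoid (sec \<F> U)) (add_monoid (sec \<F> V)) (res \<F> U V)"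
    using assms abelian_group.a_group[OF abelian_group_F]
    by (auto simp: group_hom_def group_hom_axioms_def hom_def F.res_closed F.res_add)
qed (use assms abelian_group_F in auto)

lemma F_res_zero: "\<lbrakk>openin M U; openin M V; V \<subseteq> U\<rbrakk> \<Longrightarrow> res \<F> U V \<zero>\<^bsub>sec \<F> U\<^esub> = \<zero>\<^bsub>sec \<F> V\<^esub>"
  by (rule abelian_group_hom.hom_zero[OF F_res_hom])

lemma F_res_minus:
  assumes "openin M U" "openin M V" "V \<subseteq> U" "u \<in> carrier (sec \<F> U)" "v \<in> carrier (sec \<F> U)"
  shows "res \<F> U V (u \<ominus>\<^bsub>sec \<F> U\<^esub> v) = res \<F> U V u \<ominus>\<^bsub>sec \<F> V\<^esub> res \<F> U V v"
proof -
  interpret h: abelian_group_hom "sec \<F> U" "sec \<F> V" "res \<F> U V" by (rule F_res_hom[OF assms(1-3)])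
  show ?thesis using assms by (simp add: a_minus_def)
qed

abbreviation \<Gamma> :: "'o set"
  where "\<Gamma> \<equiv> carrier (sec \<O> (topspace M))"

text \<open>The weight is always a global section of \<O>, so one \<open>\<rho>\<close> acts on all
  the modules \<F>(U) at once and commutes with restriction.\<close>

definition act :: "'o \<Rightarrow> 'a set \<Rightarrow> 'f \<Rightarrow> 'f"
  where "act \<rho> U u = msec \<rho> U \<odot>\<^bsub>sec \<F> U\<^esub> u"

lemma msec_closed: "\<lbrakk>openin M U; \<rho> \<in> \<Gamma>\<rbrakk> \<Longrightarrow> msec \<rho> U \<in> carrier (sec \<O> U)"
  by (rule res_closed[OF openin_topspace _ openin_subset])

lemma act_closed [simp]:
  "\<lbrakk>openin M U; \<rho> \<in> \<Gamma>; u \<in> carrier (sec \<F> U)\<rbrakk> \<Longrightarrow> act \<rho> U u \<in> carrier (sec \<F> U)"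
  by (simp add: act_def msec_closed)

lemma act_res:
  assumes "openin M U" "openin M V" "V \<subseteq> U" "\<rho> \<in> \<Gamma>" "u \<in> carrier (sec \<F> U)"
  shows "res \<F> U V (act \<rho> U u) = act \<rho> V (res \<F> U V u)"
  using assms openin_subset[OF assms(1)] by (simp add: act_def F.res_smult msec_closed res_res)

lemma act_add:
  "\<lbrakk>openin M U; \<rho> \<in> \<Gamma>; u \<in> carrier (sec \<F> U); v \<in> carrier (sec \<F> U)\<rbrakk> \<Longrightarrow>
    act \<rho> U (u \<oplus>\<^bsub>sec \<F> U\<^esub> v) = act \<rho> U u \<oplus>\<^bsub>sec \<F> U\<^esub> act \<rho> U v"
  by (simp add: act_def msec_closed module.smult_r_distr[OF F.module_sec])

lemma act_zero: "\<lbrakk>openin M U; \<rho> \<in> \<Gamma>\<rbrakk> \<Longrightarrow> act \<rho> U \<zero>\<^bsub>sec \<F> U\<^esub> = \<zero>\<^bsub>sec \<F> U\<^esub>"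
  by (simp add: act_def msec_closed module.smult_r_null[OF F.module_sec])

lemma act_minus:
  assumes "openin M U" "\<rho> \<in> \<Gamma>" "u \<in> carrier (sec \<F> U)" "v \<in> carrier (sec \<F> U)"
  shows "act \<rho> U (u \<ominus>\<^bsub>sec \<F> U\<^esub> v) = act \<rho> U u \<ominus>\<^bsub>sec \<F> U\<^esub> act \<rho> U v"
proof -
  interpret Module.module "sec \<O> U" "sec \<F> U" by (rule F.module_sec[OF assms(1)])
  show ?thesis using assms
    by (simp add: act_def msec_closed a_minus_def smult_r_distr smult_r_minus)
qed

lemma act_smult:
  assumes "openin M U" "\<rho> \<in> \<Gamma>" "f \<in> carrier (sec \<O> U)" "u \<in> carrier (sec \<F> U)"
  shows "act \<rho> U (f \<odot>\<^bsub>sec \<F> U\<^esub> u) = f \<odot>\<^bsub>sec \<F> U\<^esub> act \<rho> U u"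
proof -
  interpret C: cring "sec \<O> U" by (rule cring_sec[OF assms(1)])
  interpret Module.module "sec \<O> U" "sec \<F> U" by (rule F.module_sec[OF assms(1)])
  show ?thesis using assms
    by (simp add: act_def msec_closed flip: smult_assoc1) (simp add: C.m_comm msec_closed)
qed

lemma act_act:
  assumes "openin M U" "\<rho> \<in> \<Gamma>" "\<sigma> \<in> \<Gamma>" "u \<in> carrier (sec \<F> U)"
  shows "act \<rho> U (act \<sigma> U u) = act \<sigma> U (act \<rho> U u)"
  using act_smult[OF assms(1,2) msec_closed[OF assms(1,3)] assms(4)] by (simp add: act_def)

lemma act_plus:
  assumes "openin M U" "\<rho> \<in> \<Gamma>" "\<sigma> \<in> \<Gamma>" "u \<in> carrier (sec \<F> U)"
  shows "act (\<rho> \<oplus>\<^bsub>sec \<O> (topspace M)\<^esub> \<sigma>) U u = act \<rho> U u \<oplus>\<^bsub>sec \<F> U\<^esub> act \<sigma> U u"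
proof -
  interpret h: ring_hom_cring "sec \<O> (topspace M)" "sec \<O> U" "res \<O> (topspace M) U"
    using assms(1) by (intro ring_hom_res openin_topspace openin_subset)
  show ?thesis using assms
    by (simp add: act_def msec_closed module.smult_l_distr[OF F.module_sec])
qed

lemma act_one: "\<lbrakk>openin M U; msec \<rho> U = \<one>\<^bsub>sec \<O> U\<^esub>; u \<in> carrier (sec \<F> U)\<rbrakk> \<Longrightarrow> act \<rho> U u = u"
  by (simp add: act_def module.smult_one[OF F.module_sec])

lemma act_null: "\<lbrakk>openin M U; msec \<rho> U = \<zero>\<^bsub>sec \<O> U\<^esub>; u \<in> carrier (sec \<F> U)\<rbrakk> \<Longrightarrow> act \<rho> U u = \<zero>\<^bsub>sec \<F> U\<^esub>"
  by (simp add: act_def module.smult_l_null[OF F.module_sec])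

lemma act_vanish:
  assumes "compactin M K" "\<rho> \<in> \<Gamma>" "msec \<rho> (topspace M - K) = \<zero>\<^bsub>sec \<O> (topspace M - K)\<^esub>"
    and "openin M U" "U \<inter> K = {}" "u \<in> carrier (sec \<F> U)"
  shows "act \<rho> U u = \<zero>\<^bsub>sec \<F> U\<^esub>"
proof -
  have op: "openin M (topspace M - K)" by (rule open_minus_compact[OF openin_topspace assms(1)])
  have sub: "U \<subseteq> topspace M - K" using openin_subset[OF assms(4)] assms(5) by blast
  interpret h: ring_hom_cring "sec \<O> (topspace M - K)" "sec \<O> U" "res \<O> (topspace M - K) U"
    by (rule ring_hom_res[OF op assms(4) sub])
  have "msec \<rho> U = res \<O> (topspace M - K) U (msec \<rho> (topspace M - K))"
    using op assms(2,4) sub by (intro res_res[symmetric]) auto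
  then show ?thesis using assms by (simp add: act_null)
qed

abbreviation csmult :: "'a set \<Rightarrow> complex \<Rightarrow> 'f \<Rightarrow> 'f"
  where "csmult \<equiv> complex_smult \<O> \<F>"

lemma const_closed: "openin M U \<Longrightarrow> c \<odot>\<^bsub>sec \<O> U\<^esub> \<one>\<^bsub>sec \<O> U\<^esub> \<in> carrier (sec \<O> U)"
  using module.smult_closed[OF algebra.module[OF algebra_sec], of U c "\<one>\<^bsub>sec \<O> U\<^esub>"]
    cring.cring_simprules(6)[OF cring_sec, of U] by simp

lemma const_res:
  assumes "openin M U" "openin M V" "V \<subseteq> U"
  shows "res \<O> U V (c \<odot>\<^bsub>sec \<O> U\<^esub> \<one>\<^bsub>sec \<O> U\<^esub>) = c \<odot>\<^bsub>sec \<O> V\<^esub> \<one>\<^bsub>sec \<O> V\<^esub>"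
proof -
  interpret h: ring_hom_cring "sec \<O> U" "sec \<O> V" "res \<O> U V" by (rule ring_hom_res[OF assms])
  show ?thesis using assms by (simp add: res_smult_complex)
qed

lemma csmult_closed [simp]: "\<lbrakk>openin M U; u \<in> carrier (sec \<F> U)\<rbrakk> \<Longrightarrow> csmult U c u \<in> carrier (sec \<F> U)"
  by (simp add: complex_smult_def const_closed)

lemma csmult_res:
  "\<lbrakk>openin M U; openin M V; V \<subseteq> U; u \<in> carrier (sec \<F> U)\<rbrakk> \<Longrightarrow>
    res \<F> U V (csmult U c u) = csmult V c (res \<F> U V u)"
  by (simp add: complex_smult_def F.res_smult const_closed const_res)

lemma act_csmult:
  "\<lbrakk>openin M U; \<rho> \<in> \<Gamma>; u \<in> carrier (sec \<F> U)\<rbrakk> \<Longrightarrow> act \<rho> U (csmult U c u) = csmult U c (act \<rho> U u)"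
  by (simp add: complex_smult_def act_smult const_closed)

section \<open>Transport of differential operators by a cutoff\<close>

abbreviation reduced :: "('a, 'a \<Rightarrow> complex, ('o, 'a \<Rightarrow> complex) module) presheaf"
  where "reduced \<equiv> reduced_sheaf M \<O>"

text \<open>Extension by zero can be written pointwise because the target consists of functions. The
  formula makes sense over every open \<open>W\<close>; it is later read over the open subsets of
  \<open>B\<close>.\<close>

definition cutoff :: "'a set \<Rightarrow> 'o \<Rightarrow> ('a set \<Rightarrow> 'f \<Rightarrow> 'a \<Rightarrow> complex) \<Rightarrow> 'a set \<Rightarrow> 'f \<Rightarrow> 'a \<Rightarrow> complex"
  where "cutoff A \<rho> D = (\<lambda>W u. \<lambda>a\<in>W. if a \<in> A then D (W \<inter> A) (act \<rho> (W \<inter> A) (res \<F> W (W \<inter> A) u)) a else 0)"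

context
  fixes A B K :: "'a set" and \<rho> :: 'o and D :: "'a set \<Rightarrow> 'f \<Rightarrow> 'a \<Rightarrow> complex"
  assumes A: "openin M A" and B: "openin M B" and K: "compactin M K" "K \<subseteq> A" "K \<subseteq> B"
    and \<rho>: "\<rho> \<in> \<Gamma>" "msec \<rho> (topspace M - K) = \<zero>\<^bsub>sec \<O> (topspace M - K)\<^esub>"
    and D: "D \<in> Diff_c M \<O> \<F> reduced A"
begin

lemma D_closed: "\<lbrakk>openin M V; V \<subseteq> A; u \<in> carrier (sec \<F> V)\<rbrakk> \<Longrightarrow> D V u \<in> carrier (sec reduced V)"
  and D_add: "\<lbrakk>openin M V; V \<subseteq> A; u \<in> carrier (sec \<F> V); v \<in> carrier (sec \<F> V)\<rbrakk> \<Longrightarrow>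
    D V (u \<oplus>\<^bsub>sec \<F> V\<^esub> v) = (\<lambda>a\<in>V. D V u a + D V v a)"
  and D_csmult: "\<lbrakk>openin M V; V \<subseteq> A; u \<in> carrier (sec \<F> V)\<rbrakk> \<Longrightarrow>
    D V (csmult V c u) = complex_smult \<O> reduced V c (D V u)"
  and D_res: "\<lbrakk>openin M V; V \<subseteq> A; u \<in> carrier (sec \<F> V); openin M W; W \<subseteq> V\<rbrakk> \<Longrightarrow>
    D W (res \<F> V W u) = restrict (D V u) W"
  using D unfolding Diff_c_def differential_operator_def sheaf_hom_def by simp_all

text \<open>Additivity gives \<open>D 0 = D 0 + D 0\<close>, which is solved pointwise in the
  complex numbers.\<close>

lemma D_zero:
  assumes "openin M V" "V \<subseteq> A"
  shows "D V \<zero>\<^bsub>sec \<F> V\<^esub> = (\<lambda>a\<in>V. 0)"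
proof -
  interpret abelian_group "sec \<F> V" by (rule abelian_group_F[OF assms(1)])
  have "D V \<zero>\<^bsub>sec \<F> V\<^esub> = (\<lambda>a\<in>V. D V \<zero>\<^bsub>sec \<F> V\<^esub> a + D V \<zero>\<^bsub>sec \<F> V\<^esub> a)"
    using D_add[OF assms zero_closed zero_closed] by simp
  note double = fun_cong[OF this]
  have "D V \<zero>\<^bsub>sec \<F> V\<^esub> a = 0" if "a \<in> V" for a
    using double[of a, unfolded restrict_apply'[OF that]] by (simp only: add_cancel_right_right)
  then show ?thesis
    using reduced_extensional[OF D_closed[OF assms zero_closed]]
    by (intro extensionalityI[of _ V]) auto
qed

lemma D_local:
  assumes "openin M V" "V \<subseteq> A" "u \<in> carrier (sec \<F> V)" "openin M W" "W \<subseteq> V" "a \<in> W"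
  shows "D V u a = D W (res \<F> V W u) a"
  using D_res[OF assms(1-5)] assms(6) by simp

text \<open>\<open>D\<close> is local, and \<rho> annihilates sections over open sets disjoint from
  \<open>K\<close>. As \<open>K \<subseteq> A\<close>, the sets \<open>W \<inter> A\<close> and
  \<open>W - K\<close> cover \<open>W\<close>; on the first the operator is \<open>D\<close> after
  \<rho>, on the second it is zero.\<close>

lemma cutoff_vanish:
  assumes W: "openin M W" and u: "u \<in> carrier (sec \<F> W)" and a: "a \<in> W - K"
  shows "cutoff A \<rho> D W u a = 0"
proof (cases "a \<in> A")
  case True
  let ?V = "W \<inter> A - K"
  have WA: "openin M (W \<inter> A)" using W A by blast
  have V: "openin M ?V" by (rule open_minus_compact[OF WA K(1)])
  have r: "res \<F> W (W \<inter> A) u \<in> carrier (sec \<F> (W \<inter> A))" using W WA u by (intro F.res_closed) auto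
  have "res \<F> (W \<inter> A) ?V (act \<rho> (W \<inter> A) (res \<F> W (W \<inter> A) u)) = act \<rho> ?V (res \<F> (W \<inter> A) ?V (res \<F> W (W \<inter> A) u))"
    using WA V \<rho> r by (intro act_res) auto
  also have "\<dots> = \<zero>\<^bsub>sec \<F> ?V\<^esub>"
    by (rule act_vanish[OF K(1) \<rho> V _ F.res_closed[OF WA V _ r]]) auto
  finally have "D (W \<inter> A) (act \<rho> (W \<inter> A) (res \<F> W (W \<inter> A) u)) a = D ?V \<zero>\<^bsub>sec \<F> ?V\<^esub> a"
    using D_local[OF WA _ act_closed[OF WA \<rho>(1) r] V, of a] a True by auto
  also have "\<dots> = 0" using D_zero[OF V Diff_subset[THEN order_trans, OF Int_lower2]] a True by simp
  finally show ?thesis using a True by (simp add: cutoff_def)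
qed (use a in \<open>simp add: cutoff_def\<close>)

lemma cutoff_sheaf_hom: "sheaf_hom M \<O> \<F> reduced B (cutoff A \<rho> D)"
  unfolding sheaf_hom_def
proof (intro allI impI conjI ballI; elim conjE)
  fix W assume W: "openin M W" "W \<subseteq> B"
  have WA: "openin M (W \<inter> A)" "W \<inter> A \<subseteq> W" "W \<inter> A \<subseteq> A" using W A by auto
  have r: "res \<F> W (W \<inter> A) u \<in> carrier (sec \<F> (W \<inter> A))" if "u \<in> carrier (sec \<F> W)" for u
    using W WA that by (intro F.res_closed) auto
  {
    fix u assume u: "u \<in> carrier (sec \<F> W)"
    show "cutoff A \<rho> D W u \<in> carrier (sec reduced W)"
    proof (rule reduced_closedI)
      fix a assume a: "a \<in> W"
      show "\<exists>W' h. openin M W' \<and> a \<in> W' \<and> W' \<subseteq> W \<and> h \<in> carrier (sec reduced W') \<and>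
          (\<forall>b\<in>W'. cutoff A \<rho> D W u b = h b)"
      proof (cases "a \<in> A")
        case True
        with a u WA \<rho> r show ?thesis
          by (intro exI[of _ "W \<inter> A"] exI[of _ "D (W \<inter> A) (act \<rho> (W \<inter> A) (res \<F> W (W \<inter> A) u))"])
            (auto simp: cutoff_def intro!: D_closed)
      next
        case False
        \<comment> \<open>A point outside \<open>A\<close> is outside \<open>K\<close>, so the
          function is zero on a whole neighbourhood of it, even when the point lies on the boundary
          of \<open>A\<close>.\<close>
        have op: "openin M (W - K)" by (rule open_minus_compact[OF W(1) K(1)])
        from a False K op u W show ?thesis
          by (intro exI[of _ "W - K"] exI[of _ "\<lambda>a\<in>W - K. 0"])
            (auto simp: cutoff_vanish reduced_zero_closed)
      qed
    qed (simp add: cutoff_def)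
    show "cutoff A \<rho> D W (csmult W c u) = complex_smult \<O> reduced W c (cutoff A \<rho> D W u)" for c
    proof -
      have "sec_value M \<O> (W \<inter> A) (c \<odot>\<^bsub>sec \<O> (W \<inter> A)\<^esub> \<one>\<^bsub>sec \<O> (W \<inter> A)\<^esub>) a =
          sec_value M \<O> W (c \<odot>\<^bsub>sec \<O> W\<^esub> \<one>\<^bsub>sec \<O> W\<^esub>) a" if "a \<in> W \<inter> A" for a
        using sec_value_res[OF W(1) WA(1,2) that const_closed[OF W(1)]] const_res[OF W(1) WA(1,2)] by simp
      then show ?thesis
        using u W WA \<rho> r
        by (auto simp: cutoff_def csmult_res act_csmult D_csmult complex_smult_def[of _ reduced] intro!: restrict_ext)
    qed
    fix W' assume W': "openin M W'" "W' \<subseteq> W"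
    have W'A: "openin M (W' \<inter> A)" "W' \<inter> A \<subseteq> W \<inter> A" using W' A by auto
    have "D (W' \<inter> A) (act \<rho> (W' \<inter> A) (res \<F> W' (W' \<inter> A) (res \<F> W W' u))) a =
        D (W \<inter> A) (act \<rho> (W \<inter> A) (res \<F> W (W \<inter> A) u)) a" if a: "a \<in> W' \<inter> A" for a
    proof -
      have "res \<F> W' (W' \<inter> A) (res \<F> W W' u) = res \<F> (W \<inter> A) (W' \<inter> A) (res \<F> W (W \<inter> A) u)"
        using F.res_res[OF W(1) W'(1) W'A(1) _ W'(2) u] F.res_res[OF W(1) WA(1) W'A(1,2) WA(2) u] by simp
      then have "act \<rho> (W' \<inter> A) (res \<F> W' (W' \<inter> A) (res \<F> W W' u)) =
          res \<F> (W \<inter> A) (W' \<inter> A) (act \<rho> (W \<inter> A) (res \<F> W (W \<inter> A) u))"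
        using act_res[OF WA(1) W'A \<rho>(1) r[OF u]] by simp
      then show ?thesis
        using D_local[OF WA(1,3) act_closed[OF WA(1) \<rho>(1) r[OF u]] W'A a] by simp
    qed
    note restr = this
    show "cutoff A \<rho> D W' (res \<F> W W' u) = res reduced W W' (cutoff A \<rho> D W u)"
    proof
      fix b
      show "cutoff A \<rho> D W' (res \<F> W W' u) b = res reduced W W' (cutoff A \<rho> D W u) b"
      proof (cases "b \<in> W' \<inter> A")
        case True
        then have "b \<in> W'" "b \<in> A" "b \<in> W" using W'(2) by auto
        then show ?thesis unfolding cutoff_def reduced_simps using restr[OF True] by simp
      next
        case False
        then show ?thesis using W'(2) by (auto simp: cutoff_def restrict_def)
      qed
    qed
  }
  fix u v assume "u \<in> carrier (sec \<F> W)" "v \<in> carrier (sec \<F> W)"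
  then show "cutoff A \<rho> D W (u \<oplus>\<^bsub>sec \<F> W\<^esub> v) =
      cutoff A \<rho> D W u \<oplus>\<^bsub>sec reduced W\<^esub> cutoff A \<rho> D W v"
    using W WA \<rho> r by (auto simp: cutoff_def F.res_add act_add D_add intro!: restrict_ext)
qed

lemma cutoff_inside:
  assumes V: "openin M V" "V \<subseteq> A" and u: "u \<in> carrier (sec \<F> V)"
  shows "cutoff A \<rho> D V u = D V (act \<rho> V u)"
proof -
  have "V \<inter> A = V" using V by blast
  then have "cutoff A \<rho> D V u = restrict (D V (act \<rho> V u)) V"
    using V u by (auto simp: cutoff_def F.res_self intro!: restrict_ext)
  then show ?thesis
    using reduced_extensional[OF D_closed[OF V act_closed[OF V(1) \<rho>(1) u]]] by (simp add: extensional_restrict)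
qed

text \<open>Multiplication by \<rho> commutes with multiplication by each \<open>f\<close>, so every
  commutator passes through it. The induction runs from the right end of \<open>fs\<close>, since
  \<open>foldl\<close> applies the last commutator outermost.\<close>

lemma foldl_commutator_cutoff:
  assumes W: "openin M W" "W \<subseteq> A" and fs: "set fs \<subseteq> carrier (sec \<O> W)"
    and V: "openin M V" "V \<subseteq> W" and u: "u \<in> carrier (sec \<F> V)"
  shows "foldl (commutator \<O> \<F> reduced W) (cutoff A \<rho> D) fs V u =
    foldl (commutator \<O> \<F> reduced W) D fs V (act \<rho> V u)"
  using fs u
proof (induction fs arbitrary: u rule: rev_induct)
  case Nil
  then show ?case using cutoff_inside[of V u] V W by auto
next
  case (snoc f fs)
  have f: "res \<O> W V f \<in> carrier (sec \<O> V)" using snoc.prems V W by (intro res_closed) auto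
  then show ?case
    using snoc V \<rho> by (simp add: commutator_def[of _ _ _ _ _ f] act_smult)
qed

text \<open>Near a point of \<open>A\<close> the order bound of \<open>D\<close> is inherited. Near
  any other point of \<open>B\<close> the operator is zero, hence of order at most 0.\<close>

lemma cutoff_differential_operator: "differential_operator M \<O> \<F> reduced B (cutoff A \<rho> D)"
  unfolding differential_operator_def
proof (intro conjI ballI cutoff_sheaf_hom)
  fix a assume a: "a \<in> B"
  show "\<exists>W r. openin M W \<and> a \<in> W \<and> W \<subseteq> B \<and> has_order_le M \<O> \<F> reduced W r (cutoff A \<rho> D)"
  proof (cases "a \<in> A")
    case True
    then obtain W r where W: "openin M W" "a \<in> W" "W \<subseteq> A" and r: "has_order_le M \<O> \<F> reduced W r D"
      using D unfolding Diff_c_def differential_operator_def by blast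
    have "has_order_le M \<O> \<F> reduced (W \<inter> B) r (cutoff A \<rho> D)"
      unfolding has_order_le_def zero_hom_on_def
    proof (intro allI impI ballI; elim conjE)
      fix W' V u and fs :: "'o list"
      assume W': "openin M W'" "W' \<subseteq> W \<inter> B" and fs: "length fs = Suc r" "set fs \<subseteq> carrier (sec \<O> W')"
        and V: "openin M V" "V \<subseteq> W'" and u: "u \<in> carrier (sec \<F> V)"
      have "zero_hom_on M \<F> reduced W' (foldl (commutator \<O> \<F> reduced W') D fs)"
        using r W' fs unfolding has_order_le_def by blast
      then have "foldl (commutator \<O> \<F> reduced W') D fs V (act \<rho> V u) = \<zero>\<^bsub>sec reduced V\<^esub>"
        using V u \<rho> unfolding zero_hom_on_def by simp
      then show "foldl (commutator \<O> \<F> reduced W') (cutoff A \<rho> D) fs V u = \<zero>\<^bsub>sec reduced V\<^esub>"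
        using foldl_commutator_cutoff[OF W'(1) _ fs(2) V u] W' W by auto
    qed
    then show ?thesis using W a B by (intro exI[of _ "W \<inter> B"] exI[of _ r]) auto
  next
    case False
    have "has_order_le M \<O> \<F> reduced (B - K) 0 (cutoff A \<rho> D)"
      unfolding has_order_le_def zero_hom_on_def
    proof (intro allI impI ballI; elim conjE)
      fix W' V u and fs :: "'o list"
      assume W': "openin M W'" "W' \<subseteq> B - K" and fs: "length fs = Suc 0" "set fs \<subseteq> carrier (sec \<O> W')"
        and V: "openin M V" "V \<subseteq> W'" and u: "u \<in> carrier (sec \<F> V)"
      obtain f where f: "fs = [f]" "f \<in> carrier (sec \<O> W')" using fs by (auto simp: length_Suc_conv)
      have "cutoff A \<rho> D V v = (\<lambda>a\<in>V. 0)" if "v \<in> carrier (sec \<F> V)" for v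
      proof
        show "cutoff A \<rho> D V v a = (\<lambda>a\<in>V. 0) a" for a
          using cutoff_vanish[OF V(1) that, of a] V W' by (cases "a \<in> V") (auto simp: cutoff_def)
      qed
      moreover have "res \<O> W' V f \<odot>\<^bsub>sec \<F> V\<^esub> u \<in> carrier (sec \<F> V)"
        using V W' f u by (intro F_smult_closed res_closed) auto
      ultimately show "foldl (commutator \<O> \<F> reduced W') (cutoff A \<rho> D) fs V u = \<zero>\<^bsub>sec reduced V\<^esub>"
        using u reduced_zero_minus[OF V(1)] by (simp add: f commutator_def cong: restrict_cong)
    qed
    moreover have "openin M (B - K)" by (rule open_minus_compact[OF B K(1)])
    ultimately show ?thesis using a False K by (intro exI[of _ "B - K"] exI[of _ 0]) auto
  qed
qed

text \<open>The operator vanishes on \<open>B - K\<close>, so its support is \<open>K\<close> minus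
  an open set, a closed subset of a compact set.\<close>

lemma cutoff_Diff_c: "cutoff A \<rho> D \<in> Diff_c M \<O> \<F> reduced B"
proof -
  define G where "G = \<Union>{W. openin M W \<and> W \<subseteq> B \<and> zero_hom_on M \<F> reduced W (cutoff A \<rho> D)}"
  have G: "openin M G" by (auto simp: G_def)
  have "zero_hom_on M \<F> reduced (B - K) (cutoff A \<rho> D)"
    unfolding zero_hom_on_def
  proof (intro allI impI ballI; elim conjE)
    fix V u assume V: "openin M V" "V \<subseteq> B - K" and u: "u \<in> carrier (sec \<F> V)"
    show "cutoff A \<rho> D V u = \<zero>\<^bsub>sec reduced V\<^esub>"
    proof
      show "cutoff A \<rho> D V u a = \<zero>\<^bsub>sec reduced V\<^esub> a" for a
        using cutoff_vanish[OF V(1) u, of a] V by (cases "a \<in> V") (auto simp: cutoff_def)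
    qed
  qed
  then have "B - K \<subseteq> G" using open_minus_compact[OF B K(1)] unfolding G_def by blast
  then have eq: "hom_support M \<F> reduced B (cutoff A \<rho> D) = K - G"
    using K(3) unfolding hom_support_def G_def[symmetric] by blast
  have "compactin M (K - G)"
    using K(1) G compactin_imp_closedin[OF Hausdorff K(1)]
    by (intro closed_compactin[OF K(1)] closedin_diff) auto
  then show ?thesis
    unfolding Diff_c_def using cutoff_differential_operator eq by simp
qed

text \<open>Here \<open>s\<close> is the product of \<rho> and \<open>w\<close>, extended by zero to
  \<open>A\<close>. The two functions agree on \<open>A \<inter> B\<close> and vanish on the rest of
  \<open>A\<close> and of \<open>B\<close>, so the sets under the suprema differ at most by 0, which
  \<open>diff_seminorm\<close> inserts on both sides.\<close>

lemma diff_seminorm_cutoff: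
  assumes s: "s \<in> carrier (sec \<F> A)" and w: "w \<in> carrier (sec \<F> B)"
    and sw: "res \<F> A (A \<inter> B) s = act \<rho> (A \<inter> B) (res \<F> B (A \<inter> B) w)"
    and s0: "res \<F> A (A - K) s = \<zero>\<^bsub>sec \<F> (A - K)\<^esub>"
  shows "diff_seminorm A D s = diff_seminorm B (cutoff A \<rho> D) w"
proof -
  have AB: "openin M (A \<inter> B)" using A B by blast
  have AK: "openin M (A - K)" by (rule open_minus_compact[OF A K(1)])
  have 1: "D A s a = cutoff A \<rho> D B w a" if "a \<in> A \<inter> B" for a
    using D_local[OF A _ s AB, of a] that sw by (simp add: cutoff_def Int_commute)
  have 2: "D A s a = 0" if "a \<in> A - B" for a
  proof -
    have a: "a \<in> A - K" using that K by auto
    then have "D A s a = D (A - K) \<zero>\<^bsub>sec \<F> (A - K)\<^esub> a"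
      using D_local[OF A _ s AK, of a] s0 by auto
    also have "\<dots> = 0" using D_zero[OF AK Diff_subset] a by simp
    finally show ?thesis .
  qed
  have 3: "cutoff A \<rho> D B w a = 0" if "a \<in> B - A" for a
    using that by (simp add: cutoff_def)
  have "insert 0 ((\<lambda>a. cmod (D A s a)) ` A) = insert 0 ((\<lambda>a. cmod (D A s a)) ` (A \<inter> B))"
    using 2 by (auto simp: image_iff) (metis DiffI IntI norm_zero)
  also have "(\<lambda>a. cmod (D A s a)) ` (A \<inter> B) = (\<lambda>a. cmod (cutoff A \<rho> D B w a)) ` (A \<inter> B)"
    using 1 by (intro image_cong) auto
  also have "insert 0 \<dots> = insert 0 ((\<lambda>a. cmod (cutoff A \<rho> D B w a)) ` B)"
    using 3 by (auto simp: image_iff) (metis DiffI IntI norm_zero)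
  finally show ?thesis by (simp add: diff_seminorm_def)
qed

end

end

section \<open>Compactly supported sections\<close>

context sheaf_of_complex_algebras
begin

text \<open>Openness of complements of compact sets is a hypothesis because this context carries no
  separation axiom. A partition subordinate to the single set \<open>V\<close> thereby turns into
  one cutoff function.\<close>

lemma compact_support_weight_sum:
  assumes open_minus: "\<And>K. compactin M K \<Longrightarrow> openin M (topspace M - K)"
    and ps: "\<And>\<rho> W. (\<rho>, W) \<in> set ps \<Longrightarrow> compact_support \<rho> V"
  shows "compact_support (weight_sum ps) V"
  using ps
proof (induction ps)
  case Nil
  interpret cring "sec \<O> (topspace M)" by (rule cring_sec) simp
  show ?case by (auto simp: compact_support_def res_self intro!: exI[of _ "{}"])
next
  case (Cons p ps)
  interpret R: cring "sec \<O> (topspace M)" by (rule cring_sec) simp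
  let ?T = "topspace M"
  have "compact_support (fst p) V" "compact_support (weight_sum ps) V"
    using Cons.prems[of "fst p" "snd p"] Cons.IH[OF Cons.prems[OF list.set_intros(2)]] by simp_all
  then obtain K L where car: "fst p \<in> carrier (sec \<O> ?T)" "weight_sum ps \<in> carrier (sec \<O> ?T)"
    and K: "compactin M K" "K \<subseteq> V" "msec (fst p) (?T - K) = \<zero>\<^bsub>sec \<O> (?T - K)\<^esub>"
    and L: "compactin M L" "L \<subseteq> V" "msec (weight_sum ps) (?T - L) = \<zero>\<^bsub>sec \<O> (?T - L)\<^esub>"
    unfolding compact_support_def by blast
  let ?Z = "?T - (K \<union> L)"
  have KL: "compactin M (K \<union> L)" using K L by (simp add: compactin_Un)
  have zero: "msec f ?Z = \<zero>\<^bsub>sec \<O> ?Z\<^esub>"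
    if f: "f \<in> carrier (sec \<O> ?T)" and J: "compactin M J" "J \<subseteq> K \<union> L" "msec f (?T - J) = \<zero>\<^bsub>sec \<O> (?T - J)\<^esub>" for f J
  proof -
    interpret h: ring_hom_cring "sec \<O> (?T - J)" "sec \<O> ?Z" "res \<O> (?T - J) ?Z"
      using J by (intro ring_hom_res open_minus KL) auto
    have "msec f ?Z = res \<O> (?T - J) ?Z (msec f (?T - J))"
      using f J by (intro res_res[symmetric] open_minus KL) auto
    then show ?thesis using J(3) by simp
  qed
  interpret h: ring_hom_cring "sec \<O> ?T" "sec \<O> ?Z" "res \<O> ?T ?Z"
    by (intro ring_hom_res open_minus KL) auto
  have "msec (weight_sum (p # ps)) ?Z = \<zero>\<^bsub>sec \<O> ?Z\<^esub>"
    using car zero[OF car(1) K(1) _ K(3)] zero[OF car(2) L(1) _ L(3)] by simp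
  then show ?case
    unfolding compact_support_def using car KL K(2) L(2) by (intro conjI exI[of _ "K \<union> L"]) auto
qed

end

lemma sections_on_simps [simp]:
  "carrier (sections_on \<O> \<F> U S) = S" "add (sections_on \<O> \<F> U S) = add (sec \<F> U)"
  "zero (sections_on \<O> \<F> U S) = zero (sec \<F> U)"
  "smult (sections_on \<O> \<F> U S) = complex_smult \<O> \<F> U"
  by (simp_all add: sections_on_def)

lemma topspace_smooth_topology [simp]:
  "topspace (smooth_topology M \<O> \<F> U) = carrier (sec \<F> U)"
proof
  show "topspace (smooth_topology M \<O> \<F> U) \<subseteq> carrier (sec \<F> U)"
    using openin_topspace[of "smooth_topology M \<O> \<F> U"]
    unfolding smooth_topology_def openin_seminorm_topology by simp
  have "openin (smooth_topology M \<O> \<F> U) (carrier (sec \<F> U))"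
    unfolding smooth_topology_def openin_seminorm_topology
    by (auto intro!: exI[of _ "{}"] exI[of _ "1::real"])
  then show "carrier (sec \<F> U) \<subseteq> topspace (smooth_topology M \<O> \<F> U)"
    by (rule openin_subset)
qed

context formal_manifold_module
begin

lemma minus_sections_on:
  "x \<ominus>\<^bsub>sections_on \<O> \<F> U (carrier (sec \<F> U))\<^esub> y = x \<ominus>\<^bsub>sec \<F> U\<^esub> y"
  by (simp add: a_minus_def a_inv_def m_inv_def)

text \<open>\<open>T\<close> is multiplication by \<rho> followed by extension by zero, described
  only through restrictions. This serves both directions: \<open>A \<subseteq> B\<close> for
  multiplying a restriction, \<open>B \<subseteq> A\<close> for extending. Differences of values of
  \<open>T\<close> have the same kind of restrictions, so the identity of seminorms holds around
  every point.\<close>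

lemma smooth_continuous:
  assumes A: "openin M A" and B: "openin M B" and K: "compactin M K" "K \<subseteq> A" "K \<subseteq> B"
    and \<rho>: "\<rho> \<in> \<Gamma>" "msec \<rho> (topspace M - K) = \<zero>\<^bsub>sec \<O> (topspace M - K)\<^esub>"
    and T: "\<And>u. u \<in> carrier (sec \<F> B) \<Longrightarrow> T u \<in> carrier (sec \<F> A)"
    and T_res: "\<And>u. u \<in> carrier (sec \<F> B) \<Longrightarrow> res \<F> A (A \<inter> B) (T u) = act \<rho> (A \<inter> B) (res \<F> B (A \<inter> B) u)"
    and T_zero: "\<And>u. u \<in> carrier (sec \<F> B) \<Longrightarrow> res \<F> A (A - K) (T u) = \<zero>\<^bsub>sec \<F> (A - K)\<^esub>"
  shows "continuous_map (smooth_topology M \<O> \<F> B) (smooth_topology M \<O> \<F> A) T"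
  unfolding continuous_map_def
proof (intro conjI allI impI)
  show "T \<in> topspace (smooth_topology M \<O> \<F> B) \<rightarrow> topspace (smooth_topology M \<O> \<F> A)"
    using T by simp
  fix W assume W: "openin (smooth_topology M \<O> \<F> A) W"
  have AB: "openin M (A \<inter> B)" using A B by blast
  have AK: "openin M (A - K)" by (rule open_minus_compact[OF A K(1)])
  have seminorm: "diff_seminorm A D (T u \<ominus>\<^bsub>sec \<F> A\<^esub> T v) = diff_seminorm B (cutoff A \<rho> D) (u \<ominus>\<^bsub>sec \<F> B\<^esub> v)"
    if D: "D \<in> Diff_c M \<O> \<F> reduced A" and u: "u \<in> carrier (sec \<F> B)" and v: "v \<in> carrier (sec \<F> B)" for D u v
  proof (rule diff_seminorm_cutoff[OF A B K \<rho> D])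
    show "T u \<ominus>\<^bsub>sec \<F> A\<^esub> T v \<in> carrier (sec \<F> A)" using A T u v by simp
    show "u \<ominus>\<^bsub>sec \<F> B\<^esub> v \<in> carrier (sec \<F> B)" using B u v by simp
    have r: "res \<F> B (A \<inter> B) w \<in> carrier (sec \<F> (A \<inter> B))" if "w \<in> carrier (sec \<F> B)" for w
      using B AB that by (intro F.res_closed) auto
    show "res \<F> A (A \<inter> B) (T u \<ominus>\<^bsub>sec \<F> A\<^esub> T v) = act \<rho> (A \<inter> B) (res \<F> B (A \<inter> B) (u \<ominus>\<^bsub>sec \<F> B\<^esub> v))"
      unfolding F_res_minus[OF A AB Int_lower1 T[OF u] T[OF v]] F_res_minus[OF B AB Int_lower2 u v]
        T_res[OF u] T_res[OF v] act_minus[OF AB \<rho>(1) r[OF u] r[OF v]] ..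
    interpret abelian_group "sec \<F> (A - K)" by (rule abelian_group_F[OF AK])
    show "res \<F> A (A - K) (T u \<ominus>\<^bsub>sec \<F> A\<^esub> T v) = \<zero>\<^bsub>sec \<F> (A - K)\<^esub>"
      unfolding F_res_minus[OF A AK Diff_subset T[OF u] T[OF v]] T_zero[OF u] T_zero[OF v]
      by (simp add: a_minus_def)
  qed
  show "openin (smooth_topology M \<O> \<F> B) {u \<in> topspace (smooth_topology M \<O> \<F> B). T u \<in> W}"
    unfolding topspace_smooth_topology unfolding smooth_topology_def openin_seminorm_topology
      sections_on_simps minus_sections_on
  proof (intro conjI ballI)
    fix x assume x: "x \<in> {u \<in> carrier (sec \<F> B). T u \<in> W}"
    then obtain \<Q> \<epsilon> where \<Q>: "finite \<Q>" "\<Q> \<subseteq> diff_seminorm A ` Diff_c M \<O> \<F> reduced A" "0 < \<epsilon>"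
      "{y \<in> carrier (sec \<F> A). \<forall>p\<in>\<Q>. p (y \<ominus>\<^bsub>sec \<F> A\<^esub> T x) < \<epsilon>} \<subseteq> W"
      using W unfolding smooth_topology_def openin_seminorm_topology sections_on_simps minus_sections_on by blast
    obtain \<D> where \<D>: "finite \<D>" "\<D> \<subseteq> Diff_c M \<O> \<F> reduced A" "\<Q> = diff_seminorm A ` \<D>"
      using finite_subset_image[OF \<Q>(1,2)] by blast
    let ?\<Q> = "(\<lambda>D. diff_seminorm B (cutoff A \<rho> D)) ` \<D>"
    have "?\<Q> \<subseteq> diff_seminorm B ` Diff_c M \<O> \<F> reduced B"
      using cutoff_Diff_c[OF A B K \<rho>] \<D>(2) by blast
    moreover have "{y \<in> carrier (sec \<F> B). \<forall>p\<in>?\<Q>. p (y \<ominus>\<^bsub>sec \<F> B\<^esub> x) < \<epsilon>} \<subseteq> {u \<in> carrier (sec \<F> B). T u \<in> W}"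
    proof
      fix y assume y: "y \<in> {y \<in> carrier (sec \<F> B). \<forall>p\<in>?\<Q>. p (y \<ominus>\<^bsub>sec \<F> B\<^esub> x) < \<epsilon>}"
      have "\<forall>p\<in>\<Q>. p (T y \<ominus>\<^bsub>sec \<F> A\<^esub> T x) < \<epsilon>"
      proof
        fix p assume "p \<in> \<Q>"
        then obtain D where D: "D \<in> \<D>" "p = diff_seminorm A D" using \<D>(3) by blast
        then have "p (T y \<ominus>\<^bsub>sec \<F> A\<^esub> T x) = diff_seminorm B (cutoff A \<rho> D) (y \<ominus>\<^bsub>sec \<F> B\<^esub> x)"
          using seminorm[of D y x] \<D>(2) x y by auto
        also have "\<dots> < \<epsilon>" using y D(1) by blast
        finally show "p (T y \<ominus>\<^bsub>sec \<F> A\<^esub> T x) < \<epsilon>" .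
      qed
      then show "y \<in> {u \<in> carrier (sec \<F> B). T u \<in> W}" using \<Q>(4) T y by auto
    qed
    ultimately show "\<exists>\<Q> \<epsilon>. finite \<Q> \<and> \<Q> \<subseteq> diff_seminorm B ` Diff_c M \<O> \<F> reduced B \<and> 0 < \<epsilon> \<and>
        {y \<in> carrier (sec \<F> B). \<forall>p\<in>\<Q>. p (y \<ominus>\<^bsub>sec \<F> B\<^esub> x) < \<epsilon>} \<subseteq> {u \<in> carrier (sec \<F> B). T u \<in> W}"
      using \<D>(1) \<Q>(3) by (intro exI[of _ ?\<Q>] exI[of _ \<epsilon>] conjI finite_imageI)
  qed blast
qed

text \<open>Locality applied to \<open>u\<close> and zero. It turns the complement of a support,
  which is defined as a union, into one open set on which \<open>u\<close> vanishes.\<close>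

lemma vanish_Union:
  assumes U: "openin M U" "u \<in> carrier (sec \<F> U)"
    and C: "\<And>W. W \<in> \<C> \<Longrightarrow> openin M W \<and> W \<subseteq> U \<and> res \<F> U W u = \<zero>\<^bsub>sec \<F> W\<^esub>"
  shows "res \<F> U (\<Union>\<C>) u = \<zero>\<^bsub>sec \<F> (\<Union>\<C>)\<^esub>"
proof -
  have op: "openin M (\<Union>\<C>)" using C by blast
  have sub: "\<Union>\<C> \<subseteq> U" using C by blast
  show ?thesis
  proof (rule F.locality[of \<C> "\<Union>\<C>"])
    fix W assume W: "W \<in> \<C>"
    then have "W \<subseteq> \<Union>\<C>" by blast
    then show "res \<F> (\<Union>\<C>) W (res \<F> U (\<Union>\<C>) u) = res \<F> (\<Union>\<C>) W \<zero>\<^bsub>sec \<F> (\<Union>\<C>)\<^esub>"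
      using C[OF W] F.res_res[OF U(1) op _ _ sub U(2), of W] F_res_zero[OF op, of W] by simp
  qed (use C op sub U in \<open>auto intro: F.res_closed\<close>)
qed

lemma section_eqI:
  assumes "openin M U" "openin M V" "openin M W" "V \<union> W = U"
    and "s \<in> carrier (sec \<F> U)" "t \<in> carrier (sec \<F> U)"
    and "res \<F> U V s = res \<F> U V t" "res \<F> U W s = res \<F> U W t"
  shows "s = t"
  by (rule F.locality[of "{V, W}" U]) (use assms in auto)

text \<open>One restriction replaces the union hidden in \<open>sec_support\<close>; for compact
  \<open>K\<close> both descriptions agree by \<open>supported_in_iff\<close>.\<close>

definition vanishes_off :: "'a set \<Rightarrow> 'a set \<Rightarrow> 'f \<Rightarrow> bool"
  where "vanishes_off K U u \<longleftrightarrow> res \<F> U (U - K) u = \<zero>\<^bsub>sec \<F> (U - K)\<^esub>"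

lemma vanishes_off_subset:
  assumes U: "openin M U" "u \<in> carrier (sec \<F> U)" and K: "compactin M K" "vanishes_off K U u"
    and W: "openin M W" "W \<subseteq> U - K"
  shows "res \<F> U W u = \<zero>\<^bsub>sec \<F> W\<^esub>"
proof -
  have UK: "openin M (U - K)" by (rule open_minus_compact[OF U(1) K(1)])
  have "res \<F> U W u = res \<F> (U - K) W (res \<F> U (U - K) u)"
    using F.res_res[OF U(1) UK W(1,2) Diff_subset U(2)] by simp
  then show ?thesis using K(2) F_res_zero[OF UK W] by (simp add: vanishes_off_def)
qed

lemma vanishes_off_mono:
  assumes "openin M U" "u \<in> carrier (sec \<F> U)" "compactin M K" "vanishes_off K U u" "compactin M L" "K \<subseteq> L"
  shows "vanishes_off L U u"
  unfolding vanishes_off_def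
  using assms by (intro vanishes_off_subset[OF assms(1-4)] open_minus_compact) auto

lemma vanishes_off_res:
  assumes "openin M U" "u \<in> carrier (sec \<F> U)" "compactin M K" "vanishes_off K U u" "openin M V" "V \<subseteq> U"
  shows "vanishes_off K V (res \<F> U V u)"
proof -
  have VK: "openin M (V - K)" by (rule open_minus_compact[OF assms(5,3)])
  have "V - K \<subseteq> U - K" using assms(6) by blast
  then show ?thesis
    unfolding vanishes_off_def F.res_res[OF assms(1,5) VK Diff_subset assms(6,2)]
    by (rule vanishes_off_subset[OF assms(1-4) VK])
qed

lemma vanishes_off_add:
  assumes "openin M U" "u \<in> carrier (sec \<F> U)" "v \<in> carrier (sec \<F> U)" "compactin M K"
    "vanishes_off K U u" "vanishes_off K U v"
  shows "vanishes_off K U (u \<oplus>\<^bsub>sec \<F> U\<^esub> v)"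
proof -
  have UK: "openin M (U - K)" by (rule open_minus_compact[OF assms(1,4)])
  interpret abelian_group "sec \<F> (U - K)" by (rule abelian_group_F[OF UK])
  show ?thesis using assms UK by (simp add: vanishes_off_def F.res_add)
qed

lemma vanishes_off_act_left:
  assumes "compactin M K" "\<rho> \<in> \<Gamma>" "msec \<rho> (topspace M - K) = \<zero>\<^bsub>sec \<O> (topspace M - K)\<^esub>"
    and U: "openin M U" "u \<in> carrier (sec \<F> U)"
  shows "vanishes_off K U (act \<rho> U u)"
proof -
  have UK: "openin M (U - K)" by (rule open_minus_compact[OF U(1) assms(1)])
  show ?thesis
    unfolding vanishes_off_def act_res[OF U(1) UK Diff_subset assms(2) U(2)]
    by (rule act_vanish[OF assms(1-3) UK]) (use U UK in \<open>auto intro: F.res_closed\<close>)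
qed

lemma csmult_zero: "openin M U \<Longrightarrow> csmult U c \<zero>\<^bsub>sec \<F> U\<^esub> = \<zero>\<^bsub>sec \<F> U\<^esub>"
  by (simp add: complex_smult_def module.smult_r_null[OF F.module_sec] const_closed)

lemma vanishes_off_csmult:
  assumes "openin M U" "u \<in> carrier (sec \<F> U)" "compactin M K" "vanishes_off K U u"
  shows "vanishes_off K U (csmult U c u)"
proof -
  have UK: "openin M (U - K)" by (rule open_minus_compact[OF assms(1,3)])
  show ?thesis using assms UK by (simp add: vanishes_off_def csmult_res csmult_zero)
qed

lemma vanishes_off_zero: "openin M U \<Longrightarrow> compactin M K \<Longrightarrow> vanishes_off K U \<zero>\<^bsub>sec \<F> U\<^esub>"
  by (simp add: vanishes_off_def F_res_zero open_minus_compact)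

lemma supported_in_iff:
  assumes U: "openin M U" and K: "compactin M K"
  shows "u \<in> supported_in M \<F> U K \<longleftrightarrow> u \<in> carrier (sec \<F> U) \<and> vanishes_off K U u"
proof -
  have UK: "openin M (U - K)" by (rule open_minus_compact[OF U K])
  let ?\<C> = "{W. openin M W \<and> W \<subseteq> U \<and> res \<F> U W u = \<zero>\<^bsub>sec \<F> W\<^esub>}"
  have "sec_support M \<F> U u \<subseteq> K \<longleftrightarrow> vanishes_off K U u" if u: "u \<in> carrier (sec \<F> U)"
  proof
    assume "sec_support M \<F> U u \<subseteq> K"
    then have sub: "U - K \<subseteq> \<Union>?\<C>" unfolding sec_support_def by blast
    have op: "openin M (\<Union>?\<C>)" by blast
    have "\<Union>?\<C> \<subseteq> U" by blast
    moreover have "res \<F> U (\<Union>?\<C>) u = \<zero>\<^bsub>sec \<F> (\<Union>?\<C>)\<^esub>" by (rule vanish_Union[OF U u]) blast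
    ultimately show "vanishes_off K U u"
      using F.res_res[OF U op UK sub _ u] F_res_zero[OF op UK sub] by (simp add: vanishes_off_def)
  next
    assume "vanishes_off K U u"
    then have "U - K \<in> ?\<C>" using UK by (simp add: vanishes_off_def Diff_subset)
    then show "sec_support M \<F> U u \<subseteq> K" unfolding sec_support_def by blast
  qed
  then show ?thesis by (auto simp: supported_in_def)
qed

definition Fc :: "'a set \<Rightarrow> 'f set"
  where "Fc U = {u \<in> carrier (sec \<F> U). \<exists>K. compactin M K \<and> K \<subseteq> U \<and> vanishes_off K U u}"

lemma Fc_eq: "openin M U \<Longrightarrow> (\<Union>K \<in> {K. compactin M K \<and> K \<subseteq> U}. supported_in M \<F> U K) = Fc U"
  by (auto simp: Fc_def supported_in_iff)

lemma FcI: "\<lbrakk>u \<in> carrier (sec \<F> U); compactin M K; K \<subseteq> U; vanishes_off K U u\<rbrakk> \<Longrightarrow> u \<in> Fc U"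
  unfolding Fc_def by blast

lemma FcE:
  assumes "u \<in> Fc U"
  obtains K where "u \<in> carrier (sec \<F> U)" "compactin M K" "K \<subseteq> U" "vanishes_off K U u"
  using assms unfolding Fc_def by blast

lemma Fc_carrier: "u \<in> Fc U \<Longrightarrow> u \<in> carrier (sec \<F> U)"
  by (simp add: Fc_def)

lemma Fc_add:
  assumes U: "openin M U" and "u \<in> Fc U" "v \<in> Fc U"
  shows "u \<oplus>\<^bsub>sec \<F> U\<^esub> v \<in> Fc U"
proof -
  obtain K where K: "u \<in> carrier (sec \<F> U)" "compactin M K" "K \<subseteq> U" "vanishes_off K U u"
    using assms(2) by (rule FcE)
  obtain L where L: "v \<in> carrier (sec \<F> U)" "compactin M L" "L \<subseteq> U" "vanishes_off L U v"
    using assms(3) by (rule FcE)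
  have KL: "compactin M (K \<union> L)" using K L by (simp add: compactin_Un)
  show ?thesis
    using U K L KL vanishes_off_mono[OF U K(1,2,4) KL] vanishes_off_mono[OF U L(1,2,4) KL]
    by (intro FcI[of _ _ "K \<union> L"] vanishes_off_add) auto
qed

lemma Fc_csmult: "openin M U \<Longrightarrow> u \<in> Fc U \<Longrightarrow> csmult U c u \<in> Fc U"
  by (elim FcE) (auto intro!: FcI vanishes_off_csmult)

lemma Fc_zero: "openin M U \<Longrightarrow> \<zero>\<^bsub>sec \<F> U\<^esub> \<in> Fc U"
  by (intro FcI[of _ _ "{}"] vanishes_off_zero) auto

lemma module_Fc:
  assumes U: "openin M U"
  shows "Module.module complex_ring (sections_on \<O> \<F> U (Fc U))"
proof -
  interpret C: cring "sec \<O> U" by (rule cring_sec[OF U])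
  interpret A: Module.algebra complex_ring "sec \<O> U" by (rule algebra_sec[OF U])
  interpret V: Module.module "sec \<O> U" "sec \<F> U" by (rule F.module_sec[OF U])
  \<comment> \<open>Complex scalars act through the constants \<open>?c c\<close>. As
    \<open>?c\<close> respects sums, products and 1, the vector space axioms follow from those of
    the \<O>(U)-module \<F>(U).\<close>
  let ?c = "\<lambda>c. c \<odot>\<^bsub>sec \<O> U\<^esub> \<one>\<^bsub>sec \<O> U\<^esub>"
  have c: "?c c \<in> carrier (sec \<O> U)" for c by (rule const_closed[OF U])
  have c_add: "?c (a + b) = ?c a \<oplus>\<^bsub>sec \<O> U\<^esub> ?c b" for a b
    using A.smult_l_distr[of a b "\<one>\<^bsub>sec \<O> U\<^esub>"] by simp
  have c_mult: "?c (a * b) = ?c a \<otimes>\<^bsub>sec \<O> U\<^esub> ?c b" for a b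
    using A.smult_assoc2[of a "\<one>\<^bsub>sec \<O> U\<^esub>" "?c b"] A.smult_assoc1[of a b "\<one>\<^bsub>sec \<O> U\<^esub>"] c[of b] by simp
  have c_one: "?c 1 = \<one>\<^bsub>sec \<O> U\<^esub>"
    using A.smult_one[of "\<one>\<^bsub>sec \<O> U\<^esub>"] by simp
  have cs_add: "csmult U (a + b) u = csmult U a u \<oplus>\<^bsub>sec \<F> U\<^esub> csmult U b u" if "u \<in> carrier (sec \<F> U)" for a b u
    unfolding complex_smult_def c_add using that c by (intro V.smult_l_distr)
  have cs_mult: "csmult U (a * b) u = csmult U a (csmult U b u)" if "u \<in> carrier (sec \<F> U)" for a b u
    unfolding complex_smult_def c_mult using that c by (intro V.smult_assoc1)
  have cs_one: "csmult U 1 u = u" if "u \<in> carrier (sec \<F> U)" for u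
    unfolding complex_smult_def c_one using that by (rule V.smult_one)
  have cs_dist: "csmult U a (u \<oplus>\<^bsub>sec \<F> U\<^esub> v) = csmult U a u \<oplus>\<^bsub>sec \<F> U\<^esub> csmult U a v"
    if "u \<in> carrier (sec \<F> U)" "v \<in> carrier (sec \<F> U)" for a u v
    unfolding complex_smult_def using that c by (intro V.smult_r_distr)
  have cs_zero: "csmult U 0 u = \<zero>\<^bsub>sec \<F> U\<^esub>" if "u \<in> carrier (sec \<F> U)" for u
    using A.smult_l_null[of "\<one>\<^bsub>sec \<O> U\<^esub>"] V.smult_l_null[OF that] by (simp add: complex_smult_def)
  have neg: "csmult U (- 1) u \<oplus>\<^bsub>sec \<F> U\<^esub> u = \<zero>\<^bsub>sec \<F> U\<^esub>" if "u \<in> carrier (sec \<F> U)" for u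
    using cs_add[OF that, of "- 1" 1] cs_one[OF that] cs_zero[OF that] by simp
  show ?thesis
  proof (rule moduleI, goal_cases)
    case 1
    show ?case by (rule algebra.R_cring[OF algebra_sec[OF U]])
  next
    case 2
    show ?case
    proof (rule abelian_groupI, goal_cases)
      case (6 u)
      then show ?case
        using neg[of u] Fc_csmult[OF U, of u] by (auto intro!: bexI[of _ "csmult U (- 1) u"] dest: Fc_carrier)
    qed (auto simp: Fc_add[OF U] Fc_zero[OF U] Fc_carrier V.M.a_ac)
  qed (auto simp: Fc_csmult[OF U] Fc_carrier cs_add cs_mult cs_one cs_dist)
qed

abbreviation Dc :: "'a set \<Rightarrow> 'f tvs"
  where "Dc U \<equiv> sections_compact M \<O> \<F> U"

lemma Dc_eq: "openin M U \<Longrightarrow> Dc U = inductive_limit (sections_on \<O> \<F> U (Fc U))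
    (sections_supported M \<O> \<F> U ` {K. compactin M K \<and> K \<subseteq> U})"
  by (simp add: sections_compact_def Fc_eq)

lemma Dc_simps:
  assumes "openin M U"
  shows "carrier (Dc U) = Fc U" "add (Dc U) = add (sec \<F> U)" "zero (Dc U) = zero (sec \<F> U)"
    "smult (Dc U) = csmult U"
  by (simp_all add: Dc_eq[OF assms])

lemma topo_sections_supported:
  "topo (sections_supported M \<O> \<F> U K) = subtopology (smooth_topology M \<O> \<F> U) (supported_in M \<F> U K)"
  by (simp add: sections_supported_def)

lemma topspace_sections_supported:
  assumes "openin M U" "S \<in> sections_supported M \<O> \<F> U ` {K. compactin M K \<and> K \<subseteq> U}"
  shows "topspace (topo S) \<subseteq> carrier (sections_on \<O> \<F> U (Fc U))"
  using assms by (auto simp: topo_sections_supported simp flip: Fc_eq)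

lemma LCS_Dc: "openin M U \<Longrightarrow> LCS (Dc U)"
  unfolding Dc_eq by (rule LCS_inductive_limit[OF module_Fc topspace_sections_supported])

lemma continuous_map_into_Dc:
  assumes U: "openin M U" and K: "compactin M K" "K \<subseteq> U"
  shows "continuous_map (subtopology (smooth_topology M \<O> \<F> U) (supported_in M \<F> U K)) (topo (Dc U)) (\<lambda>x. x)"
  unfolding Dc_eq[OF U] topo_sections_supported[symmetric]
  by (rule continuous_map_into_inductive_limit[OF module_Fc[OF U]]) (use U K topspace_sections_supported in auto)

lemma continuous_linear_map_from_Dc:
  assumes U: "openin M U" and E: "LCS E" and h: "linear_map (Dc U) E h"
    and cont: "\<And>K. \<lbrakk>compactin M K; K \<subseteq> U\<rbrakk> \<Longrightarrow>
      continuous_map (subtopology (smooth_topology M \<O> \<F> U) (supported_in M \<F> U K)) (topo E) h"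
  shows "continuous_linear_map (Dc U) E h"
  unfolding continuous_linear_map_def
proof (rule conjI[OF h])
  have "linear_map (sections_on \<O> \<F> U (Fc U)) E h"
    using h by (simp add: linear_map_def Dc_simps[OF U])
  then show "continuous_map (topo (Dc U)) (topo E) h"
    unfolding Dc_eq[OF U]
    by (rule continuous_map_from_inductive_limit[OF module_Fc[OF U] E _ _ topspace_sections_supported[OF U]])
      (use cont in \<open>auto simp: topo_sections_supported\<close>)
qed

end

section \<open>Partitions of unity on sections and extension by zero\<close>

context formal_manifold_module
begin

text \<open>The weights sum to 1 near \<open>K\<close> and \<open>u\<close> vanishes off
  \<open>K\<close>, so both sections agree on \<open>U - K\<close> and on every
  \<open>U \<inter> N\<close>. One list serves all sections that vanish off \<open>K\<close>; the
  continuity of glued maps depends on this uniformity.\<close>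

lemma partition_sections:
  assumes K: "compactin M K" "K \<subseteq> \<Union>\<C>" and \<C>: "\<And>V. V \<in> \<C> \<Longrightarrow> openin M V"
  shows "\<exists>ps. (\<forall>(\<rho>, V) \<in> set ps. V \<in> \<C> \<and> compact_support \<rho> V) \<and>
    (\<forall>U u. openin M U \<and> u \<in> carrier (sec \<F> U) \<and> vanishes_off K U u \<longrightarrow> act (weight_sum ps) U u = u)"
proof -
  have "\<exists>ps \<N>. (\<forall>(\<rho>, V) \<in> set ps. V \<in> \<C> \<and> compact_support \<rho> V) \<and> K \<subseteq> \<Union>\<N> \<and>
      (\<forall>N\<in>\<N>. openin M N \<and> msec (weight_sum ps) N = \<one>\<^bsub>sec \<O> N\<^esub>)"
    by (rule partition_of_unity[OF K \<C>])
  then obtain ps \<N> where ps: "\<forall>(\<rho>, V) \<in> set ps. V \<in> \<C> \<and> compact_support \<rho> V" and KN: "K \<subseteq> \<Union>\<N>"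
    and \<N>: "\<forall>N\<in>\<N>. openin M N \<and> msec (weight_sum ps) N = \<one>\<^bsub>sec \<O> N\<^esub>"
    by (elim exE conjE)
  note \<N> = \<N>[rule_format, THEN conjunct1] \<N>[rule_format, THEN conjunct2]
  define \<rho> where "\<rho> = weight_sum ps"
  have \<rho>: "\<rho> \<in> \<Gamma>"
    unfolding \<rho>_def by (rule weight_sum_closed) (use ps in \<open>auto dest!: bspec\<close>)
  have "act \<rho> U u = u" if U: "openin M U" and u: "u \<in> carrier (sec \<F> U)" and off: "vanishes_off K U u" for U u
  proof (rule F.locality[of "insert (U - K) ((\<lambda>N. U \<inter> N) ` \<N>)" U])
    have UK: "openin M (U - K)" by (rule open_minus_compact[OF U K(1)])
    show "openin M V" if "V \<in> insert (U - K) ((\<lambda>N. U \<inter> N) ` \<N>)" for V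
      using that UK U \<N>(1) by auto
    show "\<Union>(insert (U - K) ((\<lambda>N. U \<inter> N) ` \<N>)) = U" using KN by auto
    fix V assume "V \<in> insert (U - K) ((\<lambda>N. U \<inter> N) ` \<N>)"
    then consider "V = U - K" | N where "N \<in> \<N>" "V = U \<inter> N" by auto
    then show "res \<F> U V (act \<rho> U u) = res \<F> U V u"
    proof cases
      case 1
      then show ?thesis
        using off act_res[OF U UK Diff_subset \<rho> u] act_zero[OF UK \<rho>] by (simp add: vanishes_off_def)
    next
      case 2
      have V: "openin M V" using 2 U \<N>(1) by auto
      interpret h: ring_hom_cring "sec \<O> N" "sec \<O> V" "res \<O> N V"
        by (rule ring_hom_res[OF \<N>(1)[OF 2(1)] V]) (use 2 in auto)
      have "msec \<rho> V = res \<O> N V (msec \<rho> N)"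
        using \<rho> 2 V \<N>(1)[OF 2(1)] openin_subset[OF \<N>(1)[OF 2(1)]]
        by (intro res_res[symmetric]) auto
      then have "msec \<rho> V = \<one>\<^bsub>sec \<O> V\<^esub>" using \<N>(2)[OF 2(1)] by (simp add: \<rho>_def)
      then show ?thesis
        using act_res[OF U V _ \<rho> u] act_one[OF V] F.res_closed[OF U V _ u] 2 by simp
    qed
  qed (use U u \<rho> in auto)
  with ps show ?thesis unfolding \<rho>_def by blast
qed

lemma cutoff_exists:
  assumes K: "compactin M K" "K \<subseteq> V" and V: "openin M V"
  obtains \<rho> where "compact_support \<rho> V"
    "\<And>U u. \<lbrakk>openin M U; u \<in> carrier (sec \<F> U); vanishes_off K U u\<rbrakk> \<Longrightarrow> act \<rho> U u = u"
proof -
  obtain ps where ps: "\<forall>(\<rho>, W) \<in> set ps. W \<in> {V} \<and> compact_support \<rho> W"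
    and act: "\<forall>U u. openin M U \<and> u \<in> carrier (sec \<F> U) \<and> vanishes_off K U u \<longrightarrow> act (weight_sum ps) U u = u"
    using partition_sections[of K "{V}"] K V by auto
  have "compact_support (weight_sum ps) V"
    by (rule compact_support_weight_sum) (use ps open_minus_compact[OF openin_topspace] in auto)
  with act that show ?thesis by blast
qed

lemma vanishes_off_Int:
  assumes "openin M U" "u \<in> carrier (sec \<F> U)" "compactin M K" "compactin M L"
    "vanishes_off K U u" "vanishes_off L U u"
  shows "vanishes_off (K \<inter> L) U u"
proof -
  have "U - (K \<inter> L) = \<Union>{U - K, U - L}" by auto
  moreover have "res \<F> U (\<Union>{U - K, U - L}) u = \<zero>\<^bsub>sec \<F> (\<Union>{U - K, U - L})\<^esub>"
    by (rule vanish_Union[OF assms(1,2)]) (use assms open_minus_compact in \<open>auto simp: vanishes_off_def\<close>)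
  ultimately show ?thesis unfolding vanishes_off_def by simp
qed

lemma compactin_Int': "compactin M K \<Longrightarrow> compactin M L \<Longrightarrow> compactin M (K \<inter> L)"
  using compactin_imp_closedin[OF Hausdorff] by (intro closed_Int_compactin) auto

text \<open>\<open>ext_zero\<close> refers to the exact support of \<open>u\<close>, whereas in
  applications only some compact set containing it is known. The sets \<open>V\<close> and
  \<open>U\<close> minus the support cover \<open>U\<close>, and locality on this cover gives
  uniqueness.\<close>

lemma ext_eq:
  assumes U: "openin M U" and V: "openin M V" "V \<subseteq> U" and s: "s \<in> carrier (sec \<F> U)"
    and K: "compactin M K" "K \<subseteq> V" "vanishes_off K U s" and u: "res \<F> U V s = u"
  shows "ext_zero M \<F> U V u = s"
  unfolding ext_zero_def
proof (rule the_equality)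
  have u_closed: "u \<in> carrier (sec \<F> V)" unfolding u[symmetric] by (rule F.res_closed[OF U V s])
  have u_off: "vanishes_off K V u"
    unfolding u[symmetric] by (rule vanishes_off_res[OF U s K(1,3) V])
  define G where "G = \<Union>{W. openin M W \<and> W \<subseteq> V \<and> res \<F> V W u = \<zero>\<^bsub>sec \<F> W\<^esub>}"
  have G: "openin M G" "G \<subseteq> V" by (auto simp: G_def)
  have supp: "sec_support M \<F> V u = V - G" by (simp add: sec_support_def G_def)
  have "V - K \<subseteq> G" using u_off open_minus_compact[OF V(1) K(1)] by (auto simp: G_def vanishes_off_def)
  then have eq: "U - (V - G) = \<Union>{U - K, G}" using K(2) V(2) G(2) by auto
  have UK: "openin M (U - K)" by (rule open_minus_compact[OF U K(1)])
  have op: "openin M (U - (V - G))" unfolding eq using UK G(1) by blast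
  have "res \<F> U G s = \<zero>\<^bsub>sec \<F> G\<^esub>"
  proof -
    have "res \<F> U G s = res \<F> V G u"
      unfolding u[symmetric] using F.res_res[OF U V(1) G V(2) s] by simp
    also have "\<dots> = \<zero>\<^bsub>sec \<F> G\<^esub>"
      unfolding G_def by (rule vanish_Union[OF V(1) u_closed]) blast
    finally show ?thesis .
  qed
  then have "res \<F> U (\<Union>{U - K, G}) s = \<zero>\<^bsub>sec \<F> (\<Union>{U - K, G})\<^esub>"
    using K(3) UK G V(2) by (intro vanish_Union[OF U s]) (auto simp: vanishes_off_def)
  then show *: "s \<in> carrier (sec \<F> U) \<and> res \<F> U V s = u \<and>
      res \<F> U (U - sec_support M \<F> V u) s = \<zero>\<^bsub>sec \<F> (U - sec_support M \<F> V u)\<^esub>"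
    unfolding supp eq using s u by simp
  fix t assume t: "t \<in> carrier (sec \<F> U) \<and> res \<F> U V t = u \<and>
      res \<F> U (U - sec_support M \<F> V u) t = \<zero>\<^bsub>sec \<F> (U - sec_support M \<F> V u)\<^esub>"
  show "t = s"
    by (rule section_eqI[OF U V(1) op]) (use t * V G in \<open>auto simp: supp\<close>)
qed

lemma ext_props:
  assumes U: "openin M U" and V: "openin M V" "V \<subseteq> U" and u: "u \<in> carrier (sec \<F> V)"
    and K: "compactin M K" "K \<subseteq> V" "vanishes_off K V u"
  shows "ext_zero M \<F> U V u \<in> carrier (sec \<F> U)" "res \<F> U V (ext_zero M \<F> U V u) = u"
    "vanishes_off K U (ext_zero M \<F> U V u)"
proof -
  have UK: "openin M (U - K)" by (rule open_minus_compact[OF U K(1)])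
  have VK: "openin M (V - K)" by (rule open_minus_compact[OF V(1) K(1)])
  have Int: "V \<inter> (U - K) = V - K" and Un: "V \<union> (U - K) = U" using V(2) K(2) by auto
  have "res \<F> (U - K) (V - K) \<zero>\<^bsub>sec \<F> (U - K)\<^esub> = \<zero>\<^bsub>sec \<F> (V - K)\<^esub>"
    using V(2) by (intro F_res_zero[OF UK VK]) auto
  then obtain s where s: "s \<in> carrier (sec \<F> U)" "res \<F> U V s = u" "vanishes_off K U s"
    using F.gluing_two[OF V(1) UK u F_zero_closed[OF UK]] K(3) unfolding Int Un vanishes_off_def by auto
  have "ext_zero M \<F> U V u = s" by (rule ext_eq[OF U V s(1) K(1,2) s(3,2)])
  with s show "ext_zero M \<F> U V u \<in> carrier (sec \<F> U)" "res \<F> U V (ext_zero M \<F> U V u) = u"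
    "vanishes_off K U (ext_zero M \<F> U V u)" by simp_all
qed

lemma ext_Fc:
  assumes "openin M U" "openin M V" "V \<subseteq> U" "u \<in> Fc V"
  shows "ext_zero M \<F> U V u \<in> Fc U"
proof -
  obtain K where K: "u \<in> carrier (sec \<F> V)" "compactin M K" "K \<subseteq> V" "vanishes_off K V u"
    using assms(4) by (rule FcE)
  show ?thesis
    using ext_props[OF assms(1-3) K(1-4)] K assms(3) by (intro FcI[of _ _ K]) auto
qed

lemma ext_self: "openin M U \<Longrightarrow> u \<in> Fc U \<Longrightarrow> ext_zero M \<F> U U u = u"
  by (elim FcE, rule ext_eq) (auto simp: F.res_self)

text \<open>The extension to \<open>U\<close>, restricted to \<open>V\<close>, is the extension to
  \<open>V\<close>; \<open>ext_eq\<close> applies to both steps with the same compact set.\<close>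

lemma ext_ext:
  assumes U: "openin M U" and V: "openin M V" "V \<subseteq> U" and W: "openin M W" "W \<subseteq> V" and u: "u \<in> Fc W"
  shows "ext_zero M \<F> U V (ext_zero M \<F> V W u) = ext_zero M \<F> U W u"
proof -
  obtain K where K: "u \<in> carrier (sec \<F> W)" "compactin M K" "K \<subseteq> W" "vanishes_off K W u"
    using u by (rule FcE)
  have WU: "W \<subseteq> U" and KV: "K \<subseteq> V" using V W K by auto
  note 1 = ext_props[OF U W(1) WU K]
  have "ext_zero M \<F> V W u = res \<F> U V (ext_zero M \<F> U W u)"
    using 1 F.res_res[OF U V(1) W V(2) 1(1)]
    by (intro ext_eq[OF V(1) W _ K(2,3)] F.res_closed[OF U V] vanishes_off_res[OF U _ K(2) _ V]) auto
  then show ?thesis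
    using ext_eq[OF U V 1(1) K(2) KV 1(3) refl] by simp
qed

text \<open>All values of \<open>T\<close> vanish off the one compact set \<open>K\<close>, so
  \<open>T\<close> factors through a single step of the inductive limit. It is thus continuous into
  \<open>Dc A\<close> on all of \<F>(B).\<close>

lemma smooth_continuous_Dc:
  assumes A: "openin M A" and B: "openin M B" and K: "compactin M K" "K \<subseteq> A" "K \<subseteq> B"
    and \<rho>: "\<rho> \<in> \<Gamma>" "msec \<rho> (topspace M - K) = \<zero>\<^bsub>sec \<O> (topspace M - K)\<^esub>"
    and T: "\<And>u. u \<in> carrier (sec \<F> B) \<Longrightarrow> T u \<in> carrier (sec \<F> A)"
    and T_res: "\<And>u. u \<in> carrier (sec \<F> B) \<Longrightarrow> res \<F> A (A \<inter> B) (T u) = act \<rho> (A \<inter> B) (res \<F> B (A \<inter> B) u)"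
    and T_zero: "\<And>u. u \<in> carrier (sec \<F> B) \<Longrightarrow> vanishes_off K A (T u)"
  shows "continuous_map (smooth_topology M \<O> \<F> B) (topo (Dc A)) T"
proof -
  have "continuous_map (smooth_topology M \<O> \<F> B) (smooth_topology M \<O> \<F> A) T"
    by (rule smooth_continuous[OF A B K \<rho> T T_res T_zero[unfolded vanishes_off_def]])
  then have "continuous_map (smooth_topology M \<O> \<F> B)
      (subtopology (smooth_topology M \<O> \<F> A) (supported_in M \<F> A K)) T"
    using T T_zero by (auto simp: continuous_map_in_subtopology supported_in_iff[OF A K(1)])
  from continuous_map_compose[OF this continuous_map_into_Dc[OF A K(1,2)]]
  show ?thesis by (simp add: o_def)
qed

lemma act_res_Fc:
  assumes U: "openin M U" and V: "openin M V" "V \<subseteq> U" and \<rho>: "compact_support \<rho> V" and u: "u \<in> carrier (sec \<F> U)"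
  shows "act \<rho> V (res \<F> U V u) \<in> Fc V"
proof -
  obtain K where K: "\<rho> \<in> \<Gamma>" "compactin M K" "K \<subseteq> V" "msec \<rho> (topspace M - K) = \<zero>\<^bsub>sec \<O> (topspace M - K)\<^esub>"
    using \<rho> unfolding compact_support_def by blast
  have r: "res \<F> U V u \<in> carrier (sec \<F> V)" by (rule F.res_closed[OF U V u])
  show ?thesis
    by (rule FcI[OF act_closed[OF V(1) K(1) r] K(2,3) vanishes_off_act_left[OF K(2,1,4) V(1) r]])
qed

text \<open>Restriction to \<open>V\<close> does not produce compact support in \<open>V\<close>;
  the weight does. This is \<open>smooth_continuous_Dc\<close> with \<open>V\<close> as the target
  and the larger \<open>U\<close> as the source.\<close>

lemma act_res_continuous:
  assumes U: "openin M U" and V: "openin M V" "V \<subseteq> U" and \<rho>: "compact_support \<rho> V"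
  shows "continuous_map (smooth_topology M \<O> \<F> U) (topo (Dc V)) (\<lambda>u. act \<rho> V (res \<F> U V u))"
proof -
  obtain K where K: "\<rho> \<in> \<Gamma>" "compactin M K" "K \<subseteq> V" "msec \<rho> (topspace M - K) = \<zero>\<^bsub>sec \<O> (topspace M - K)\<^esub>"
    using \<rho> unfolding compact_support_def by blast
  have VU: "V \<inter> U = V" using V(2) by blast
  have r: "res \<F> U V u \<in> carrier (sec \<F> V)" if "u \<in> carrier (sec \<F> U)" for u
    by (rule F.res_closed[OF U V that])
  show ?thesis
  proof (rule smooth_continuous_Dc[OF V(1) U K(2,3) _ K(1,4)])
    show "K \<subseteq> U" using K V by blast
    fix u assume u: "u \<in> carrier (sec \<F> U)"
    show "act \<rho> V (res \<F> U V u) \<in> carrier (sec \<F> V)" by (rule act_closed[OF V(1) K(1) r[OF u]])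
    show "res \<F> V (V \<inter> U) (act \<rho> V (res \<F> U V u)) = act \<rho> (V \<inter> U) (res \<F> U (V \<inter> U) u)"
      unfolding VU by (rule F.res_self[OF V(1) act_closed[OF V(1) K(1) r[OF u]]])
    show "vanishes_off K V (act \<rho> V (res \<F> U V u))"
      by (rule vanishes_off_act_left[OF K(2,1,4) V(1) r[OF u]])
  qed
qed

lemma ext_act_res:
  assumes U: "openin M U" and V: "openin M V" "V \<subseteq> U" and \<rho>: "compact_support \<rho> V" and u: "u \<in> carrier (sec \<F> U)"
  shows "ext_zero M \<F> U V (act \<rho> V (res \<F> U V u)) = act \<rho> U u"
proof -
  obtain K where K: "\<rho> \<in> \<Gamma>" "compactin M K" "K \<subseteq> V" "msec \<rho> (topspace M - K) = \<zero>\<^bsub>sec \<O> (topspace M - K)\<^esub>"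
    using \<rho> unfolding compact_support_def by blast
  show ?thesis
    by (rule ext_eq[OF U V act_closed[OF U K(1) u] K(2,3) vanishes_off_act_left[OF K(2,1,4) U u]
          act_res[OF U V K(1) u]])
qed

lemma ext_linear:
  assumes U: "openin M U" and V: "openin M V" "V \<subseteq> U"
  shows "linear_map (Dc V) (Dc U) (ext_zero M \<F> U V)"
  unfolding linear_map_def Dc_simps[OF U] Dc_simps[OF V(1)]
proof (intro conjI ballI allI)
  fix u assume u: "u \<in> Fc V"
  show "ext_zero M \<F> U V u \<in> Fc U" by (rule ext_Fc[OF U V u])
  obtain K where K: "u \<in> carrier (sec \<F> V)" "compactin M K" "K \<subseteq> V" "vanishes_off K V u"
    using u by (rule FcE)
  note 1 = ext_props[OF U V K]
  show "ext_zero M \<F> U V (csmult V c u) = csmult U c (ext_zero M \<F> U V u)" for c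
    by (rule ext_eq[OF U V csmult_closed[OF U 1(1)] K(2,3) vanishes_off_csmult[OF U 1(1) K(2) 1(3)]])
      (simp add: csmult_res[OF U V 1(1)] 1(2))
  fix v assume v: "v \<in> Fc V"
  obtain L where L: "v \<in> carrier (sec \<F> V)" "compactin M L" "L \<subseteq> V" "vanishes_off L V v"
    using v by (rule FcE)
  note 2 = ext_props[OF U V L]
  have KL: "compactin M (K \<union> L)" "K \<union> L \<subseteq> V" using K L by (auto simp: compactin_Un)
  have "vanishes_off (K \<union> L) U (ext_zero M \<F> U V u \<oplus>\<^bsub>sec \<F> U\<^esub> ext_zero M \<F> U V v)"
    by (rule vanishes_off_add[OF U 1(1) 2(1) KL(1) vanishes_off_mono[OF U 1(1) K(2) 1(3) KL(1) Un_upper1]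
          vanishes_off_mono[OF U 2(1) L(2) 2(3) KL(1) Un_upper2]])
  then show "ext_zero M \<F> U V (u \<oplus>\<^bsub>sec \<F> V\<^esub> v) = ext_zero M \<F> U V u \<oplus>\<^bsub>sec \<F> U\<^esub> ext_zero M \<F> U V v"
    by (rule ext_eq[OF U V F_add_closed[OF U 1(1) 2(1)] KL]) (simp add: F.res_add[OF U V 1(1) 2(1)] 1(2) 2(2))
qed

lemma ext_continuous_linear:
  assumes U: "openin M U" and V: "openin M V" "V \<subseteq> U"
  shows "continuous_linear_map (Dc V) (Dc U) (ext_zero M \<F> U V)"
proof (rule continuous_linear_map_from_Dc[OF V(1) LCS_Dc[OF U] ext_linear[OF U V]])
  fix K assume K: "compactin M K" "K \<subseteq> V"
  obtain \<rho> where \<rho>: "compact_support \<rho> V"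
    and act: "\<And>U u. \<lbrakk>openin M U; u \<in> carrier (sec \<F> U); vanishes_off K U u\<rbrakk> \<Longrightarrow> act \<rho> U u = u"
    using cutoff_exists[OF K V(1)] by blast
  obtain L where L: "\<rho> \<in> \<Gamma>" "compactin M L" "L \<subseteq> V" "msec \<rho> (topspace M - L) = \<zero>\<^bsub>sec \<O> (topspace M - L)\<^esub>"
    using \<rho> unfolding compact_support_def by blast
  have UV: "U \<inter> V = V" and LU: "L \<subseteq> U" using V(2) L(3) by auto
  have *: "ext_zero M \<F> U V (act \<rho> V u) \<in> carrier (sec \<F> U)"
    "res \<F> U V (ext_zero M \<F> U V (act \<rho> V u)) = act \<rho> V u"
    "vanishes_off L U (ext_zero M \<F> U V (act \<rho> V u))" if u: "u \<in> carrier (sec \<F> V)" for u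
    using ext_props[OF U V act_closed[OF V(1) L(1) u] L(2,3) vanishes_off_act_left[OF L(2,1,4) V(1) u]] .
  \<comment> \<open>With the cutoff inserted, the extension is defined and continuous on all of
    \<F>(V), its values vanishing off the fixed compact set \<open>L\<close>. On sections supported
    in \<open>K\<close> the cutoff acts as the identity.\<close>
  have "continuous_map (smooth_topology M \<O> \<F> V) (topo (Dc U)) (\<lambda>u. ext_zero M \<F> U V (act \<rho> V u))"
    by (rule smooth_continuous_Dc[OF U V(1) L(2) LU L(3,1,4)]) (simp_all add: * UV F.res_self[OF V(1)])
  then have "continuous_map (subtopology (smooth_topology M \<O> \<F> V) (supported_in M \<F> V K)) (topo (Dc U))
      (\<lambda>u. ext_zero M \<F> U V (act \<rho> V u))"
    by (rule continuous_map_from_subtopology)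
  then show "continuous_map (subtopology (smooth_topology M \<O> \<F> V) (supported_in M \<F> V K)) (topo (Dc U))
      (ext_zero M \<F> U V)"
    by (rule continuous_map_eq) (simp add: supported_in_iff[OF V(1) K(1)] act[OF V(1)])
qed

end

section \<open>The sheaf property\<close>

context formal_manifold_module
begin

section \<open>The presheaf of generalised functions\<close>

context
  fixes E :: "'e tvs"
  assumes E: "LCS E"
begin

abbreviation \<G> :: "('a, 'f \<Rightarrow> 'e, ('f \<Rightarrow> 'e) tvs) presheaf"
  where "\<G> \<equiv> generalized_functions M \<O> \<F> E"

lemma sec_G: "sec \<G> U = L_b (Dc U) E"
  by (simp add: generalized_functions_def)

lemma res_G: "openin M V \<Longrightarrow> res \<G> U V = (\<lambda>\<eta>. \<lambda>u\<in>Fc V. \<eta> (ext_zero M \<F> U V u))"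
  by (simp add: generalized_functions_def Dc_simps)

lemma sec_G_iff:
  "openin M U \<Longrightarrow> \<eta> \<in> carrier (sec \<G> U) \<longleftrightarrow> \<eta> \<in> extensional (Fc U) \<and> continuous_linear_map (Dc U) E \<eta>"
  by (simp add: sec_G Dc_simps)

lemma sec_G_linear:
  assumes U: "openin M U" and \<eta>: "\<eta> \<in> carrier (sec \<G> U)"
  shows "u \<in> Fc U \<Longrightarrow> \<eta> u \<in> carrier E"
    and "\<lbrakk>u \<in> Fc U; v \<in> Fc U\<rbrakk> \<Longrightarrow> \<eta> (u \<oplus>\<^bsub>sec \<F> U\<^esub> v) = \<eta> u \<oplus>\<^bsub>E\<^esub> \<eta> v"
    and "u \<in> Fc U \<Longrightarrow> \<eta> (csmult U c u) = c \<odot>\<^bsub>E\<^esub> \<eta> u"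
    and "\<eta> \<zero>\<^bsub>sec \<F> U\<^esub> = \<zero>\<^bsub>E\<^esub>"
    and "continuous_map (topo (Dc U)) (topo E) \<eta>"
proof -
  have lin: "linear_map (Dc U) E \<eta>" and cont: "continuous_map (topo (Dc U)) (topo E) \<eta>"
    using \<eta> by (auto simp: sec_G_iff[OF U] continuous_linear_map_def)
  from lin show "u \<in> Fc U \<Longrightarrow> \<eta> u \<in> carrier E"
    "\<lbrakk>u \<in> Fc U; v \<in> Fc U\<rbrakk> \<Longrightarrow> \<eta> (u \<oplus>\<^bsub>sec \<F> U\<^esub> v) = \<eta> u \<oplus>\<^bsub>E\<^esub> \<eta> v"
    "u \<in> Fc U \<Longrightarrow> \<eta> (csmult U c u) = c \<odot>\<^bsub>E\<^esub> \<eta> u"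
    by (simp_all add: linear_map_def Dc_simps[OF U])
  show "\<eta> \<zero>\<^bsub>sec \<F> U\<^esub> = \<zero>\<^bsub>E\<^esub>"
    using linear_map_zero[OF LCS.vector_space[OF LCS_Dc[OF U]] LCS.vector_space[OF E] lin]
    by (simp add: Dc_simps[OF U])
qed (use \<eta> in \<open>simp add: sec_G_iff[OF U] continuous_linear_map_def\<close>)

lemma res_G_continuous_linear:
  assumes U: "openin M U" and V: "openin M V" "V \<subseteq> U"
  shows "continuous_linear_map (sec \<G> U) (sec \<G> V) (res \<G> U V)"
  using L_b_precompose[OF LCS_Dc[OF V(1)] LCS_Dc[OF U] E ext_continuous_linear[OF U V]]
  by (simp add: sec_G res_G[OF V(1)] Dc_simps[OF V(1)])

lemma presheaf_G: "presheaf_on M \<G>"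
proof
  fix U V \<eta> assume *: "openin M U" "openin M V" "V \<subseteq> U" "\<eta> \<in> carrier (sec \<G> U)"
  then show "res \<G> U V \<eta> \<in> carrier (sec \<G> V)"
    using res_G_continuous_linear[OF *(1-3)] by (simp add: continuous_linear_map_def linear_map_def)
next
  fix U \<eta> assume *: "openin M U" "\<eta> \<in> carrier (sec \<G> U)"
  then have "\<eta> \<in> extensional (Fc U)" by (simp add: sec_G_iff)
  then show "res \<G> U U \<eta> = \<eta>"
    by (intro extensionalityI[of _ "Fc U"]) (simp_all add: res_G[OF *(1)] ext_self[OF *(1)])
next
  fix U V W \<eta> assume *: "openin M U" "openin M V" "openin M W" "W \<subseteq> V" "V \<subseteq> U" "\<eta> \<in> carrier (sec \<G> U)"
  show "res \<G> V W (res \<G> U V \<eta>) = res \<G> U W \<eta>"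
    using ext_Fc[OF *(2,3,4)] ext_ext[OF *(1,2,5,3,4)]
    by (simp add: res_G[OF *(2)] res_G[OF *(3)] cong: restrict_cong)
qed

lemma presheaf_of_LCS_G: "presheaf_of_LCS M \<G>"
proof (intro presheaf_of_LCS.intro presheaf_of_LCS_axioms.intro presheaf_G)
  show "LCS (sec \<G> U)" if "openin M U" for U
    unfolding sec_G by (rule LCS_L_b[OF LCS_Dc[OF that] E])
qed (rule res_G_continuous_linear)

lemma weight_act_nil:
  "openin M U \<Longrightarrow> u \<in> carrier (sec \<F> U) \<Longrightarrow> act (weight_sum []) U u = \<zero>\<^bsub>sec \<F> U\<^esub>"
  by (rule act_null)
    (use ring_hom_cring.hom_zero[OF ring_hom_res[OF openin_topspace]] openin_subset in auto)

lemma weight_act_Cons: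
  assumes "openin M U" "u \<in> carrier (sec \<F> U)" "\<rho> \<in> \<Gamma>" "\<And>\<rho> V. (\<rho>, V) \<in> set ps \<Longrightarrow> \<rho> \<in> \<Gamma>"
  shows "act (weight_sum ((\<rho>, V) # ps)) U u = act \<rho> U u \<oplus>\<^bsub>sec \<F> U\<^esub> act (weight_sum ps) U u"
proof -
  have "weight_sum ps \<in> \<Gamma>" by (rule weight_sum_closed[OF assms(4)])
  from act_plus[OF assms(1,3) this assms(2)] show ?thesis by simp
qed

section \<open>Gluing a compatible family\<close>

context
  fixes \<C> :: "'a set set" and U :: "'a set" and \<sigma> :: "'a set \<Rightarrow> 'f \<Rightarrow> 'e"
  assumes \<C>: "\<And>V. V \<in> \<C> \<Longrightarrow> openin M V" and Un: "\<Union>\<C> = U"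
    and \<sigma>: "\<And>V. V \<in> \<C> \<Longrightarrow> \<sigma> V \<in> carrier (sec \<G> V)"
    and compatible: "\<And>V W. V \<in> \<C> \<Longrightarrow> W \<in> \<C> \<Longrightarrow> res \<G> V (V \<inter> W) (\<sigma> V) = res \<G> W (V \<inter> W) (\<sigma> W)"
begin

definition good :: "('o \<times> 'a set) list \<Rightarrow> bool"
  where "good ps \<longleftrightarrow> (\<forall>(\<rho>, V) \<in> set ps. V \<in> \<C> \<and> compact_support \<rho> V)"

text \<open>For lists as in \<open>good\<close>, each weight gives its term compact support, so the
  sum makes sense on all of \<F>(U) and whatever the weights add up to.\<close>

definition pairing :: "('o \<times> 'a set) list \<Rightarrow> 'f \<Rightarrow> 'e"
  where "pairing ps u = foldr (\<lambda>(\<rho>, V) e. \<sigma> V (act \<rho> V (res \<F> U V u)) \<oplus>\<^bsub>E\<^esub> e) ps \<zero>\<^bsub>E\<^esub>"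

lemma pairing_simps [simp]:
  "pairing [] u = \<zero>\<^bsub>E\<^esub>"
  "pairing ((\<rho>, V) # ps) u = \<sigma> V (act \<rho> V (res \<F> U V u)) \<oplus>\<^bsub>E\<^esub> pairing ps u"
  by (simp_all add: pairing_def)

lemma good_simps [simp]: "good []" "good ((\<rho>, V) # ps) \<longleftrightarrow> V \<in> \<C> \<and> compact_support \<rho> V \<and> good ps"
  by (auto simp: good_def)

lemma good_\<Gamma>: "good ps \<Longrightarrow> (\<rho>, V) \<in> set ps \<Longrightarrow> \<rho> \<in> \<Gamma>"
  by (auto simp: good_def)

lemma open_U: "openin M U"
  unfolding Un[symmetric] using \<C> by blast

lemma sub_U: "V \<in> \<C> \<Longrightarrow> V \<subseteq> U"
  using Un by blast

text \<open>Both sides are the value of the family at \<open>\<rho>\<tau>u\<close> on \<open>V \<inter> W\<close>, extended by zero.\<close>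

lemma \<sigma>_swap:
  assumes V: "V \<in> \<C>" "compact_support \<rho> V" and W: "W \<in> \<C>" "compact_support \<tau> W"
    and u: "u \<in> carrier (sec \<F> U)"
  shows "\<sigma> V (act \<rho> V (res \<F> U V (act \<tau> U u))) = \<sigma> W (act \<tau> W (res \<F> U W (act \<rho> U u)))"
proof -
  obtain K where K: "\<rho> \<in> \<Gamma>" "compactin M K" "K \<subseteq> V" "msec \<rho> (topspace M - K) = \<zero>\<^bsub>sec \<O> (topspace M - K)\<^esub>"
    using V(2) unfolding compact_support_def by blast
  obtain L where L: "\<tau> \<in> \<Gamma>" "compactin M L" "L \<subseteq> W" "msec \<tau> (topspace M - L) = \<zero>\<^bsub>sec \<O> (topspace M - L)\<^esub>"
    using W(2) unfolding compact_support_def by blast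
  define Z where "Z = V \<inter> W"
  have Z: "openin M Z" "Z \<subseteq> V" "Z \<subseteq> W" using \<C>[OF V(1)] \<C>[OF W(1)] by (auto simp: Z_def)
  define v where "v = act \<rho> Z (act \<tau> Z (res \<F> U Z u))"
  have KL: "compactin M (K \<inter> L)" "K \<inter> L \<subseteq> Z" using K L compactin_Int' by (auto simp: Z_def)
  \<comment> \<open>Applied with \<open>Y = V\<close> and with \<open>Y = W\<close>. The product of
    \<open>u\<close> with both weights vanishes off \<open>K\<close> and off \<open>L\<close>, hence
    off \<open>K \<inter> L\<close>, a compact subset of \<open>Z\<close>.\<close>
  have main: "v \<in> Fc Z \<and> ext_zero M \<F> Y Z v = act \<rho> Y (act \<tau> Y (res \<F> U Y u))"
    if Y: "openin M Y" "Y \<subseteq> U" "Z \<subseteq> Y" for Y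
  proof -
    have r: "res \<F> U Y u \<in> carrier (sec \<F> Y)" by (rule F.res_closed[OF open_U Y(1,2) u])
    define s where "s = act \<rho> Y (act \<tau> Y (res \<F> U Y u))"
    have s: "s \<in> carrier (sec \<F> Y)" unfolding s_def using Y(1) K(1) L(1) r by simp
    have "vanishes_off K Y s"
      unfolding s_def by (rule vanishes_off_act_left[OF K(2,1,4) Y(1)]) (use Y(1) L(1) r in simp)
    moreover have "vanishes_off L Y s"
      unfolding s_def act_act[OF Y(1) K(1) L(1) r]
      by (rule vanishes_off_act_left[OF L(2,1,4) Y(1)]) (use Y(1) K(1) r in simp)
    ultimately have off: "vanishes_off (K \<inter> L) Y s"
      by (rule vanishes_off_Int[OF Y(1) s K(2) L(2)])
    have res_s: "res \<F> Y Z s = v"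
      using Y Z K(1) L(1) r u by (simp add: s_def v_def act_res F.res_res[OF open_U])
    have "v \<in> Fc Z"
      using F.res_closed[OF Y(1) Z(1) Y(3) s] vanishes_off_res[OF Y(1) s KL(1) off Z(1) Y(3)]
      unfolding res_s by (intro FcI[OF _ KL])
    with ext_eq[OF Y(1) Z(1) Y(3) s KL off res_s] show ?thesis by (simp add: s_def)
  qed
  have "\<sigma> V (ext_zero M \<F> V Z v) = \<sigma> W (ext_zero M \<F> W Z v)"
    using fun_cong[OF compatible[OF V(1) W(1)], of v] main[OF \<C>[OF V(1)] sub_U[OF V(1)] Z(2)]
    unfolding Z_def[symmetric] by (simp add: res_G[OF Z(1)])
  moreover have "ext_zero M \<F> V Z v = act \<rho> V (res \<F> U V (act \<tau> U u))"
    using main[OF \<C>[OF V(1)] sub_U[OF V(1)] Z(2)] act_res[OF open_U \<C>[OF V(1)] sub_U[OF V(1)] L(1) u] by simp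
  moreover have "ext_zero M \<F> W Z v = act \<tau> W (res \<F> U W (act \<rho> U u))"
    using main[OF \<C>[OF W(1)] sub_U[OF W(1)] Z(3)] act_res[OF open_U \<C>[OF W(1)] sub_U[OF W(1)] K(1) u]
      act_act[OF \<C>[OF W(1)] K(1) L(1) F.res_closed[OF open_U \<C>[OF W(1)] sub_U[OF W(1)] u]] by simp
  ultimately show ?thesis by simp
qed

lemma term_Fc:
  assumes "V \<in> \<C>" "compact_support \<rho> V" "u \<in> carrier (sec \<F> U)"
  shows "act \<rho> V (res \<F> U V u) \<in> Fc V"
  by (rule act_res_Fc[OF open_U \<C>[OF assms(1)] sub_U[OF assms(1)] assms(2,3)])

lemma term_closed:
  assumes "V \<in> \<C>" "compact_support \<rho> V" "u \<in> carrier (sec \<F> U)"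
  shows "\<sigma> V (act \<rho> V (res \<F> U V u)) \<in> carrier E"
  by (rule sec_G_linear(1)[OF \<C>[OF assms(1)] \<sigma>[OF assms(1)] term_Fc[OF assms]])

lemma term_add:
  assumes V: "V \<in> \<C>" "compact_support \<rho> V" and u: "u \<in> carrier (sec \<F> U)" "v \<in> carrier (sec \<F> U)"
  shows "\<sigma> V (act \<rho> V (res \<F> U V (u \<oplus>\<^bsub>sec \<F> U\<^esub> v))) =
    \<sigma> V (act \<rho> V (res \<F> U V u)) \<oplus>\<^bsub>E\<^esub> \<sigma> V (act \<rho> V (res \<F> U V v))"
proof -
  note V' = \<C>[OF V(1)] sub_U[OF V(1)]
  have "res \<F> U V u \<in> carrier (sec \<F> V)" "res \<F> U V v \<in> carrier (sec \<F> V)"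
    using F.res_closed[OF open_U V'] u by auto
  then have "act \<rho> V (res \<F> U V (u \<oplus>\<^bsub>sec \<F> U\<^esub> v)) =
      act \<rho> V (res \<F> U V u) \<oplus>\<^bsub>sec \<F> V\<^esub> act \<rho> V (res \<F> U V v)"
    using F.res_add[OF open_U V' u] act_add[OF V'(1) compact_support_carrier[OF V(2)]] by simp
  then show ?thesis
    using sec_G_linear(2)[OF V'(1) \<sigma>[OF V(1)] term_Fc[OF V u(1)] term_Fc[OF V u(2)]] by simp
qed

lemma term_csmult:
  assumes V: "V \<in> \<C>" "compact_support \<rho> V" and u: "u \<in> carrier (sec \<F> U)"
  shows "\<sigma> V (act \<rho> V (res \<F> U V (csmult U c u))) = c \<odot>\<^bsub>E\<^esub> \<sigma> V (act \<rho> V (res \<F> U V u))"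
proof -
  note V' = \<C>[OF V(1)] sub_U[OF V(1)]
  have "act \<rho> V (res \<F> U V (csmult U c u)) = csmult V c (act \<rho> V (res \<F> U V u))"
    using csmult_res[OF open_U V' u]
      act_csmult[OF V'(1) compact_support_carrier[OF V(2)] F.res_closed[OF open_U V' u]] by simp
  then show ?thesis
    using sec_G_linear(3)[OF V'(1) \<sigma>[OF V(1)] term_Fc[OF V u]] by simp
qed

lemma pairing_closed: "good ps \<Longrightarrow> u \<in> carrier (sec \<F> U) \<Longrightarrow> pairing ps u \<in> carrier E"
proof (induction ps)
  case Nil
  interpret E: Module.module complex_ring E using E by (rule LCS.vector_space)
  show ?case by simp
next
  case (Cons p ps)
  interpret E: Module.module complex_ring E using E by (rule LCS.vector_space)
  show ?case using Cons by (cases p) (simp add: term_closed)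
qed

lemma pairing_add:
  assumes u: "u \<in> carrier (sec \<F> U)" "v \<in> carrier (sec \<F> U)"
  shows "good ps \<Longrightarrow> pairing ps (u \<oplus>\<^bsub>sec \<F> U\<^esub> v) = pairing ps u \<oplus>\<^bsub>E\<^esub> pairing ps v"
proof (induction ps)
  case Nil
  interpret E: Module.module complex_ring E using E by (rule LCS.vector_space)
  show ?case by simp
next
  case (Cons p ps)
  interpret E: Module.module complex_ring E using E by (rule LCS.vector_space)
  obtain \<rho> V where p: "p = (\<rho>, V)" by (cases p)
  with Cons.prems have V: "V \<in> \<C>" "compact_support \<rho> V" and ps: "good ps" by auto
  show ?case
    unfolding p pairing_simps Cons.IH[OF ps] term_add[OF V u]
    using term_closed[OF V] pairing_closed[OF ps] u by (simp add: E.M.a_ac)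
qed

lemma pairing_csmult:
  assumes u: "u \<in> carrier (sec \<F> U)"
  shows "good ps \<Longrightarrow> pairing ps (csmult U c u) = c \<odot>\<^bsub>E\<^esub> pairing ps u"
proof (induction ps)
  case Nil
  interpret E: Module.module complex_ring E using E by (rule LCS.vector_space)
  show ?case using E.smult_r_null[of c] by simp
next
  case (Cons p ps)
  interpret E: Module.module complex_ring E using E by (rule LCS.vector_space)
  obtain \<rho> V where p: "p = (\<rho>, V)" by (cases p)
  with Cons.prems have V: "V \<in> \<C>" "compact_support \<rho> V" and ps: "good ps" by auto
  show ?case
    unfolding p pairing_simps Cons.IH[OF ps] term_csmult[OF V u]
    using term_closed[OF V u] pairing_closed[OF ps u] by (simp add: E.smult_r_distr)
qed

lemma pairing_zero: "good ps \<Longrightarrow> pairing ps \<zero>\<^bsub>sec \<F> U\<^esub> = \<zero>\<^bsub>E\<^esub>"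
proof (induction ps)
  case (Cons p ps)
  interpret E: Module.module complex_ring E using E by (rule LCS.vector_space)
  obtain \<rho> V where p: "p = (\<rho>, V)" by (cases p)
  with Cons.prems have V: "V \<in> \<C>" "compact_support \<rho> V" and ps: "good ps" by auto
  note V' = \<C>[OF V(1)] sub_U[OF V(1)]
  show ?case
    unfolding p pairing_simps Cons.IH[OF ps] F_res_zero[OF open_U V']
      act_zero[OF V'(1) compact_support_carrier[OF V(2)]] sec_G_linear(4)[OF V'(1) \<sigma>[OF V(1)]] by simp
qed simp

lemma pairing_continuous:
  "good ps \<Longrightarrow> continuous_map (smooth_topology M \<O> \<F> U) (topo E) (pairing ps)"
proof (induction ps)
  case Nil
  interpret E: Module.module complex_ring E using E by (rule LCS.vector_space)
  have "pairing [] = (\<lambda>u. \<zero>\<^bsub>E\<^esub>)" by auto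
  then show ?case by (simp add: LCS.topspace_topo[OF E])
next
  case (Cons p ps)
  obtain \<rho> V where p: "p = (\<rho>, V)" by (cases p)
  with Cons.prems have V: "V \<in> \<C>" "compact_support \<rho> V" and ps: "good ps" by auto
  note V' = \<C>[OF V(1)] sub_U[OF V(1)]
  have "continuous_map (smooth_topology M \<O> \<F> U) (topo E) (\<lambda>u. \<sigma> V (act \<rho> V (res \<F> U V u)))"
    using continuous_map_compose[OF act_res_continuous[OF open_U V' V(2)] sec_G_linear(5)[OF V'(1) \<sigma>[OF V(1)]]]
    by (simp add: o_def)
  moreover have "pairing (p # ps) = (\<lambda>u. \<sigma> V (act \<rho> V (res \<F> U V u)) \<oplus>\<^bsub>E\<^esub> pairing ps u)"
    unfolding p by (rule ext) simp
  ultimately show ?case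
    using LCS.continuous_map_plus[OF E _ Cons.IH[OF ps]] by simp
qed

text \<open>In every term \<open>\<sigma>_swap\<close> exchanges the roles of \<tau> and the weight;
  additivity of \<open>\<sigma> W\<close> then collects the weights into
  \<open>weight_sum ps\<close>.\<close>

lemma pairing_act:
  assumes W: "W \<in> \<C>" "compact_support \<tau> W" and u: "u \<in> carrier (sec \<F> U)"
  shows "good ps \<Longrightarrow> pairing ps (act \<tau> U u) = \<sigma> W (act \<tau> W (res \<F> U W (act (weight_sum ps) U u)))"
proof (induction ps)
  case Nil
  note W' = \<C>[OF W(1)] sub_U[OF W(1)]
  show ?case
    unfolding weight_act_nil[OF open_U u] F_res_zero[OF open_U W']
      act_zero[OF W'(1) compact_support_carrier[OF W(2)]] sec_G_linear(4)[OF W'(1) \<sigma>[OF W(1)]] by simp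
next
  case (Cons p ps)
  obtain \<rho> V where p: "p = (\<rho>, V)" by (cases p)
  with Cons.prems have V: "V \<in> \<C>" "compact_support \<rho> V" and ps: "good ps" by auto
  have \<rho>: "\<rho> \<in> \<Gamma>" using V(2) by (rule compact_support_carrier)
  have ws: "weight_sum ps \<in> \<Gamma>" by (rule weight_sum_closed[OF good_\<Gamma>[OF ps]])
  have sum: "act (weight_sum ((\<rho>, V) # ps)) U u = act \<rho> U u \<oplus>\<^bsub>sec \<F> U\<^esub> act (weight_sum ps) U u"
    by (rule weight_act_Cons[OF open_U u \<rho> good_\<Gamma>[OF ps]])
  show ?case
    unfolding p pairing_simps Cons.IH[OF ps] sum \<sigma>_swap[OF V W u]
      term_add[OF W act_closed[OF open_U \<rho> u] act_closed[OF open_U ws u]] ..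
qed

text \<open>
  If \<open>ps\<close> and \<open>qs\<close> both sum to \<open>1\<close> on the support of \<open>u\<close>, this is independence of the partition of unity.
\<close>

lemma pairing_weight_sum:
  assumes ps: "good ps" and u: "u \<in> carrier (sec \<F> U)"
  shows "good qs \<Longrightarrow> pairing ps (act (weight_sum qs) U u) = pairing qs (act (weight_sum ps) U u)"
proof (induction qs)
  case Nil
  show ?case unfolding weight_act_nil[OF open_U u] pairing_zero[OF ps] by simp
next
  case (Cons q qs)
  obtain \<tau> W where q: "q = (\<tau>, W)" by (cases q)
  with Cons.prems have W: "W \<in> \<C>" "compact_support \<tau> W" and qs: "good qs" by auto
  have \<tau>: "\<tau> \<in> \<Gamma>" using W(2) by (rule compact_support_carrier)
  have ws: "weight_sum qs \<in> \<Gamma>" by (rule weight_sum_closed[OF good_\<Gamma>[OF qs]])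
  have sum: "act (weight_sum ((\<tau>, W) # qs)) U u = act \<tau> U u \<oplus>\<^bsub>sec \<F> U\<^esub> act (weight_sum qs) U u"
    by (rule weight_act_Cons[OF open_U u \<tau> good_\<Gamma>[OF qs]])
  show ?case
    unfolding q pairing_simps sum
      pairing_add[OF act_closed[OF open_U \<tau> u] act_closed[OF open_U ws u] ps] pairing_act[OF W u ps] Cons.IH[OF qs] ..
qed

lemma partition_U:
  assumes "compactin M K" "K \<subseteq> U"
  obtains ps where "good ps"
    "\<And>u. \<lbrakk>u \<in> carrier (sec \<F> U); vanishes_off K U u\<rbrakk> \<Longrightarrow> act (weight_sum ps) U u = u"
proof -
  have "K \<subseteq> \<Union>\<C>" using assms(2) Un by simp
  then have "\<exists>ps. (\<forall>(\<rho>, V) \<in> set ps. V \<in> \<C> \<and> compact_support \<rho> V) \<and>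
    (\<forall>U u. openin M U \<and> u \<in> carrier (sec \<F> U) \<and> vanishes_off K U u \<longrightarrow> act (weight_sum ps) U u = u)"
    by (rule partition_sections[OF assms(1) _ \<C>])
  then show ?thesis using that open_U unfolding good_def by blast
qed

text \<open>All lists that reproduce \<open>u\<close> compete, so no particular partition is
  attached to \<open>u\<close>. Later arguments may take one list for many sections at once.\<close>

definition glue :: "'f \<Rightarrow> 'e"
  where "glue = (\<lambda>u\<in>Fc U. THE e. \<exists>ps. good ps \<and> act (weight_sum ps) U u = u \<and> e = pairing ps u)"

text \<open>Two lists that both fix \<open>u\<close> give the same value by
  \<open>pairing_weight_sum\<close>, which makes the definite description unambiguous.\<close>

lemma glue_eq:
  assumes "good ps" "act (weight_sum ps) U u = u" "u \<in> Fc U"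
  shows "glue u = pairing ps u"
proof -
  have "pairing qs u = pairing ps u" if "good qs" "act (weight_sum qs) U u = u" for qs
    using pairing_weight_sum[OF assms(1) Fc_carrier[OF assms(3)] that(1)] assms(2) that(2) by simp
  note unique = this
  have "(THE e. \<exists>ps. good ps \<and> act (weight_sum ps) U u = u \<and> e = pairing ps u) = pairing ps u"
  proof (rule the_equality)
    show "\<exists>qs. good qs \<and> act (weight_sum qs) U u = u \<and> pairing ps u = pairing qs u"
      using assms(1,2) by (intro exI[of _ ps] conjI refl)
    fix e assume "\<exists>qs. good qs \<and> act (weight_sum qs) U u = u \<and> e = pairing qs u"
    then show "e = pairing ps u" using unique by (elim exE conjE) simp
  qed
  then show ?thesis unfolding glue_def restrict_apply'[OF assms(3)] .
qed

lemma glue_linear: "linear_map (Dc U) E glue"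
  unfolding linear_map_def Dc_simps[OF open_U]
proof (intro conjI ballI allI)
  fix u assume u: "u \<in> Fc U"
  obtain K where K: "u \<in> carrier (sec \<F> U)" "compactin M K" "K \<subseteq> U" "vanishes_off K U u"
    using u by (rule FcE)
  obtain ps where ps: "good ps" and
    act: "\<And>u. \<lbrakk>u \<in> carrier (sec \<F> U); vanishes_off K U u\<rbrakk> \<Longrightarrow> act (weight_sum ps) U u = u"
    using partition_U[OF K(2,3)] by blast
  show "glue u \<in> carrier E"
    unfolding glue_eq[OF ps act[OF K(1,4)] u] by (rule pairing_closed[OF ps K(1)])
  show "glue (csmult U c u) = c \<odot>\<^bsub>E\<^esub> glue u" for c
    unfolding glue_eq[OF ps act[OF K(1,4)] u]
      glue_eq[OF ps act[OF csmult_closed[OF open_U K(1)] vanishes_off_csmult[OF open_U K(1,2,4)]] Fc_csmult[OF open_U u]]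
    by (rule pairing_csmult[OF K(1) ps])
  fix v assume v: "v \<in> Fc U"
  obtain L where L: "v \<in> carrier (sec \<F> U)" "compactin M L" "L \<subseteq> U" "vanishes_off L U v"
    using v by (rule FcE)
  have KL: "compactin M (K \<union> L)" "K \<union> L \<subseteq> U" using K L by (auto simp: compactin_Un)
  have off: "vanishes_off (K \<union> L) U u" "vanishes_off (K \<union> L) U v"
    using vanishes_off_mono[OF open_U K(1,2,4) KL(1)] vanishes_off_mono[OF open_U L(1,2,4) KL(1)] by auto
  \<comment> \<open>Additivity needs one list that fixes \<open>u\<close>, \<open>v\<close> and
    their sum, hence a partition near \<open>K \<union> L\<close>.\<close>
  obtain qs where qs: "good qs" and
    act': "\<And>u. \<lbrakk>u \<in> carrier (sec \<F> U); vanishes_off (K \<union> L) U u\<rbrakk> \<Longrightarrow> act (weight_sum qs) U u = u"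
    using partition_U[OF KL] by blast
  show "glue (u \<oplus>\<^bsub>sec \<F> U\<^esub> v) = glue u \<oplus>\<^bsub>E\<^esub> glue v"
    unfolding glue_eq[OF qs act'[OF K(1) off(1)] u] glue_eq[OF qs act'[OF L(1) off(2)] v]
      glue_eq[OF qs act'[OF F_add_closed[OF open_U K(1) L(1)] vanishes_off_add[OF open_U K(1) L(1) KL(1) off]]
        Fc_add[OF open_U u v]]
    by (rule pairing_add[OF K(1) L(1) qs])
qed

text \<open>For fixed \<open>K\<close> one list fixes all sections supported there, so on them
  \<open>glue\<close> equals a single \<open>pairing\<close>, which is continuous for the smooth
  topology.\<close>

lemma glue_closed: "glue \<in> carrier (sec \<G> U)"
  unfolding sec_G_iff[OF open_U]
proof
  show "glue \<in> extensional (Fc U)" by (simp add: glue_def)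
  show "continuous_linear_map (Dc U) E glue"
  proof (rule continuous_linear_map_from_Dc[OF open_U E glue_linear])
    fix K assume K: "compactin M K" "K \<subseteq> U"
    obtain ps where ps: "good ps" and
      act: "\<And>u. \<lbrakk>u \<in> carrier (sec \<F> U); vanishes_off K U u\<rbrakk> \<Longrightarrow> act (weight_sum ps) U u = u"
      using partition_U[OF K] by blast
    have "continuous_map (subtopology (smooth_topology M \<O> \<F> U) (supported_in M \<F> U K)) (topo E) (pairing ps)"
      by (rule continuous_map_from_subtopology[OF pairing_continuous[OF ps]])
    then show "continuous_map (subtopology (smooth_topology M \<O> \<F> U) (supported_in M \<F> U K)) (topo E) glue"
    proof (rule continuous_map_eq)
      fix u assume "u \<in> topspace (subtopology (smooth_topology M \<O> \<F> U) (supported_in M \<F> U K))"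
      then have u: "u \<in> carrier (sec \<F> U)" "vanishes_off K U u"
        by (auto simp: supported_in_iff[OF open_U K(1)])
      show "pairing ps u = glue u"
        by (rule glue_eq[OF ps act[OF u] FcI[OF u(1) K u(2)], symmetric])
    qed
  qed
qed

text \<open>For \<open>u\<close> vanishing off \<open>K\<close>, a list with a single weight on
  \<open>V\<close> that fixes all sections vanishing off \<open>K\<close> already reproduces the
  extension of \<open>u\<close>. Independence of the list allows its use; only the term at
  \<open>V\<close> remains, and there the weight acts as the identity.\<close>

lemma glue_res:
  assumes V: "V \<in> \<C>"
  shows "res \<G> U V glue = \<sigma> V"
proof (rule extensionalityI[of _ "Fc V"])
  note V' = \<C>[OF V] sub_U[OF V]
  show "res \<G> U V glue \<in> extensional (Fc V)" by (simp add: res_G[OF V'(1)])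
  show "\<sigma> V \<in> extensional (Fc V)" using \<sigma>[OF V] by (simp add: sec_G_iff[OF V'(1)])
  fix u assume u: "u \<in> Fc V"
  obtain K where K: "u \<in> carrier (sec \<F> V)" "compactin M K" "K \<subseteq> V" "vanishes_off K V u"
    using u by (rule FcE)
  obtain \<rho> where \<rho>: "compact_support \<rho> V"
    and act: "\<And>U u. \<lbrakk>openin M U; u \<in> carrier (sec \<F> U); vanishes_off K U u\<rbrakk> \<Longrightarrow> act \<rho> U u = u"
    using cutoff_exists[OF K(2,3) V'(1)] by blast
  note ext = ext_props[OF open_U V' K]
  have "weight_sum [(\<rho>, V)] = \<rho>"
    using cring_sec[OF openin_topspace, THEN cring.cring_simprules(16)] compact_support_carrier[OF \<rho>] by simp
  then have "act (weight_sum [(\<rho>, V)]) U (ext_zero M \<F> U V u) = ext_zero M \<F> U V u"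
    using act[OF open_U ext(1,3)] by simp
  then have "glue (ext_zero M \<F> U V u) = pairing [(\<rho>, V)] (ext_zero M \<F> U V u)"
    using V \<rho> by (intro glue_eq ext_Fc[OF open_U V' u]) auto
  also have "\<dots> = \<sigma> V u"
  proof -
    interpret E: Module.module complex_ring E using E by (rule LCS.vector_space)
    show ?thesis
      using ext(2) act[OF V'(1) K(1,4)] sec_G_linear(1)[OF V'(1) \<sigma>[OF V] u] by simp
  qed
  finally show "res \<G> U V glue u = \<sigma> V u" using u by (simp add: res_G[OF V'(1)])
qed

end

lemma sheaf_G: "sheaf_on M \<G>"
proof (intro sheaf_on.intro sheaf_on_axioms.intro presheaf_G)
  fix \<C> U and \<eta> \<zeta> :: "'f \<Rightarrow> 'e"
  assume \<C>: "\<And>V. V \<in> \<C> \<Longrightarrow> openin M V" and Un: "\<Union>\<C> = U"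
    and \<eta>: "\<eta> \<in> carrier (sec \<G> U)" and \<zeta>: "\<zeta> \<in> carrier (sec \<G> U)"
    and eq: "\<And>V. V \<in> \<C> \<Longrightarrow> res \<G> U V \<eta> = res \<G> U V \<zeta>"
  have U: "openin M U" unfolding Un[symmetric] using \<C> by blast
  show "\<eta> = \<zeta>"
  proof (rule extensionalityI[of _ "Fc U"])
    show "\<eta> \<in> extensional (Fc U)" "\<zeta> \<in> extensional (Fc U)" using \<eta> \<zeta> by (auto simp: sec_G_iff[OF U])
    fix u assume "u \<in> Fc U"
    then obtain K where K: "u \<in> carrier (sec \<F> U)" "compactin M K" "K \<subseteq> U" "vanishes_off K U u"
      by (rule FcE)
    have "K \<subseteq> \<Union>\<C>" using K(3) Un by simp
    then obtain ps where ps: "\<forall>(\<rho>, V) \<in> set ps. V \<in> \<C> \<and> compact_support \<rho> V"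
      and act: "act (weight_sum ps) U u = u"
      using partition_sections[OF K(2) _ \<C>, of \<C>] U K by blast
    \<comment> \<open>Each weighted piece is the extension of a section over a member of the cover,
      where \<eta> and \<zeta> agree. Membership in \<open>Fc U\<close> is carried along because
      their additivity is known only there.\<close>
    have "act (weight_sum ps) U u \<in> Fc U \<and> \<eta> (act (weight_sum ps) U u) = \<zeta> (act (weight_sum ps) U u)"
      using ps
    proof (induction ps)
      case Nil
      show ?case
        unfolding weight_act_nil[OF U K(1)] sec_G_linear(4)[OF U \<eta>] sec_G_linear(4)[OF U \<zeta>]
        using Fc_zero[OF U] by simp
    next
      case (Cons p ps)
      obtain \<rho> V where p: "p = (\<rho>, V)" by (cases p)
      with Cons.prems have V: "V \<in> \<C>" "compact_support \<rho> V"
        and ps: "\<forall>(\<rho>, V) \<in> set ps. V \<in> \<C> \<and> compact_support \<rho> V" by auto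
      have V': "openin M V" "V \<subseteq> U" using \<C> V(1) Un by auto
      have ps_\<Gamma>: "\<rho> \<in> \<Gamma>" if "(\<rho>, V) \<in> set ps" for \<rho> V
        using ps that by (auto dest!: bspec)
      have v: "act \<rho> V (res \<F> U V u) \<in> Fc V" by (rule act_res_Fc[OF U V' V(2) K(1)])
      have ext: "ext_zero M \<F> U V (act \<rho> V (res \<F> U V u)) = act \<rho> U u" by (rule ext_act_res[OF U V' V(2) K(1)])
      have Fc: "act \<rho> U u \<in> Fc U" using ext_Fc[OF U V' v] unfolding ext .
      have "\<eta> (act \<rho> U u) = \<zeta> (act \<rho> U u)"
        using fun_cong[OF eq[OF V(1)], of "act \<rho> V (res \<F> U V u)"] v by (simp add: res_G[OF V'(1)] ext)
      moreover note IH = Cons.IH[OF ps]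
      moreover have "act (weight_sum ((\<rho>, V) # ps)) U u = act \<rho> U u \<oplus>\<^bsub>sec \<F> U\<^esub> act (weight_sum ps) U u"
        by (rule weight_act_Cons[OF U K(1) compact_support_carrier[OF V(2)] ps_\<Gamma>])
      ultimately show ?case
        unfolding p
        using Fc_add[OF U Fc] sec_G_linear(2)[OF U \<eta> Fc] sec_G_linear(2)[OF U \<zeta> Fc] by simp
    qed
    then show "\<eta> u = \<zeta> u" unfolding act by simp
  qed
next
  fix \<C> U and \<sigma> :: "'a set \<Rightarrow> 'f \<Rightarrow> 'e"
  assume "\<And>V. V \<in> \<C> \<Longrightarrow> openin M V" "\<Union>\<C> = U" "\<And>V. V \<in> \<C> \<Longrightarrow> \<sigma> V \<in> carrier (sec \<G> V)"
    "\<And>V W. V \<in> \<C> \<Longrightarrow> W \<in> \<C> \<Longrightarrow> res \<G> V (V \<inter> W) (\<sigma> V) = res \<G> W (V \<inter> W) (\<sigma> W)"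
  note * = this
  show "\<exists>t\<in>carrier (sec \<G> U). \<forall>V\<in>\<C>. res \<G> U V t = \<sigma> V"
    using glue_closed[OF *] glue_res[OF *] by blast
qed

end

end

theorem lemma4p11:
  fixes M :: "'a topology"
    and \<O> :: "('a, 'o, (complex, 'o) module) presheaf"
    and \<F> :: "('a, 'f, ('o, 'f) module) presheaf"
    and E :: "'e tvs"
  assumes "formal_manifold M \<O>"
    and "sheaf_of_modules M \<O> \<F>"
    and "quasi_complete_LCS E"
  shows "presheaf_of_LCS M (generalized_functions M \<O> \<F> E) \<and>
         sheaf_on M (generalized_functions M \<O> \<F> E)"
proof -
  interpret formal_manifold_module M \<O> \<F>
    using assms(1,2) by (rule formal_manifold_module.intro)
  have "LCS E" using assms(3) by (rule quasi_complete_LCS.axioms)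
  then show ?thesis using presheaf_of_LCS_G sheaf_G by blast
qed


end
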